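(* Let $(M,d_M,0_M)$ and $(N,d_N,0_N)$ be infinite pointed metric spaces, and let $f: M \to N$ and $\omega: M \to \mathbb{C}$ be maps with $f(0_M)=0_N$ or $\omega(0_M)=0$, such that the linear map $\omega\widehat{f}$ determined by $\delta(x) \mapsto \omega(x)\,\delta(f(x))$ ($x\in M$) defines (extends to) a bounded linear operator $\omega\widehat{f}:\mathcal{F}(M)\to\mathcal{F}(N)$. Then the following properties are equivalent: (i) $\omega\widehat{f}$ is compact; (ii) $\omega\widehat{f}$ is weakly compact; (iii) $\omega\widehat{f}$ is super strictly singular; (iv) $\omega\widehat{f}$ is super strictly cosingular; (v) $\omega\widehat{f}$ is strictly singular; (vi) $\omega\widehat{f}$ is strictly cosingular; (vii) $\omega\widehat{f}$ does not fix any copy of $\ell^1$; (viii) $\omega\widehat{f}$ does not fix any complemented copy of $\ell^1$.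
   Context: All vector spaces are over $\mathbb{C}$. A pointed metric space is a metric space $(M,d)$ with a distinguished point $0_M\in M$. $\mathrm{Lip}_0(M)$ is the Banach space of Lipschitz functions $g:M\to\mathbb{C}$ with $g(0_M)=0$, normed by $\|g\|_L=\sup_{x\neq y}\frac{|g(x)-g(y)|}{d(x,y)}$. For $x\in M$, $\delta(x)\in \mathrm{Lip}_0(M)^*$ is evaluation at $x$, $\langle g,\delta(x)\rangle=g(x)$ (so $\delta(0_M)=0$). The Lipschitz-free space $\mathcal{F}(M)$ is the norm-closed linear span of $\{\delta(x): x\in M\}$ in $\mathrm{Lip}_0(M)^*$. Let $X,Y$ be Banach spaces and $T:X\to Y$ a bounded linear operator; $S_E$ denotes the unit sphere and $B_X$ the closed unit ball; subspaces by which one takes quotients are closed. - $T$ is strictly singular if there is no infinite-dimensional (closed) subspace $E\subset X$ such that $T|_E$ is an isomorphism onto its range. - $T$ is strictly cosingular if for every closed subspace $Z\subset Y$ with $\dim(Y/Z)=\infty$, the map $Q\circ T:X\to Y/Z$ is not surjective, where $Q:Y\to Y/Z$ is the canonical quotient map. - $T$ is super strictly singular if for every $\varepsilon>0$ there is $N_\varepsilon\in\mathbb{N}$, $N_\varepsilon\ge 1$, such that for every subspace $E\subset X$ with $\dim(E)\ge N_\varepsilon$ there is $x\in S_E$ with $\|T(x)\|\le\varepsilon$; that is, $b_n(T):=\sup_{E\subset X,\ \dim E=n}\ \inf\{\|T(x)\|:x\in S_E\}\to 0$ as $n\to\infty$. - $T$ is super strictly cosingular if $a_n(T):=\sup\{\alpha_E(T):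 E\subset Y \text{ closed subspace},\ \dim(Y/E)=n\}\to 0$ as $n\to\infty$, where $\alpha_E(T):=\sup\{\alpha\ge 0:\alpha B_{Y/E}\subset Q\circ T(B_X)\}$ and $Q:Y\to Y/E$ is the canonical quotient map. - $T$ fixes a copy of $\ell^1$ if there are closed subspaces $E\subset X$ and $F\subset Y$, both isomorphic to $\ell^1$, such that $T|_E:E\to F$ is an isomorphism. $T$ fixes a complemented copy of $\ell^1$ if, in addition, $E$ and $F$ can be chosen so that $E$ is complemented in $X$ and $F$ is complemented in $Y$. *)

theory Defs
  imports "HOL-Analysis.Analysis"
begin

section \<open>Complex normed spaces\<close>

class complex_normed_vector = real_normed_vector +
  fixes scaleC :: "complex \<Rightarrow> 'a \<Rightarrow> 'a" (infixr "*\<^sub>C" 75)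
  assumes scaleC_add_right: "c *\<^sub>C (x + y) = c *\<^sub>C x + c *\<^sub>C y"
    and scaleC_add_left: "(c + d) *\<^sub>C x = c *\<^sub>C x + d *\<^sub>C x"
    and scaleC_scaleC: "c *\<^sub>C d *\<^sub>C x = (c * d) *\<^sub>C x"
    and scaleC_one: "1 *\<^sub>C x = x"
    and scaleR_scaleC: "r *\<^sub>R x = complex_of_real r *\<^sub>C x"
    and norm_scaleC: "norm (c *\<^sub>C x) = norm c * norm x"

class complex_banach = complex_normed_vector + banach

global_interpretation complex_vector:
  vector_space "scaleC :: complex \<Rightarrow> 'a \<Rightarrow> 'a::complex_normed_vector"
  by standard (simp_all add: scaleC_add_right scaleC_add_left scaleC_scaleC scaleC_one)

instantiation complex :: complex_banach
begin
definition scaleC_complex :: "complex \<Rightarrow> complex \<Rightarrow> complex"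
  where "scaleC_complex c x = c * x"
instance
  by standard (simp_all add: scaleC_complex_def algebra_simps norm_mult scaleR_conv_of_real)
end

definition bounded_clinear ::
  "('a::complex_normed_vector \<Rightarrow> 'b::complex_normed_vector) \<Rightarrow> bool"
  where "bounded_clinear T \<longleftrightarrow> bounded_linear T \<and> (\<forall>c x. T (c *\<^sub>C x) = c *\<^sub>C T x)"

lemma bounded_linear_scaleC:
  "bounded_linear (\<lambda>x::'a::complex_normed_vector. c *\<^sub>C x)"
proof (rule bounded_linear_intro[where K = "norm c"])
  fix r and x :: 'a
  show "c *\<^sub>C r *\<^sub>R x = r *\<^sub>R c *\<^sub>C x"
    by (simp add: scaleR_scaleC scaleC_scaleC mult.commute)
qed (simp_all add: scaleC_add_right norm_scaleC mult.commute)

lemma csubspace_closure: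
  assumes "complex_vector.subspace (S :: 'a::complex_normed_vector set)"
  shows "complex_vector.subspace (closure S)"
proof (rule complex_vector.subspaceI)
  show "0 \<in> closure S"
    using complex_vector.subspace_0[OF assms] closure_subset by blast
next
  fix x y assume "x \<in> closure S" "y \<in> closure S"
  then obtain f g where "\<forall>n. f n \<in> S" "f \<longlonglongrightarrow> x" "\<forall>n. g n \<in> S" "g \<longlonglongrightarrow> y"
    unfolding closure_sequential by blast
  then have "\<forall>n. f n + g n \<in> S" "(\<lambda>n. f n + g n) \<longlonglongrightarrow> x + y"
    using complex_vector.subspace_add[OF assms] by (auto intro: tendsto_add)
  then show "x + y \<in> closure S"
    unfolding closure_sequential by (intro exI[of _ "\<lambda>n. f n + g n"] conjI)
next
  fix c x assume "x \<in> closure S"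
  then obtain f where "\<forall>n. f n \<in> S" "f \<longlonglongrightarrow> x"
    unfolding closure_sequential by blast
  then have "\<forall>n. c *\<^sub>C f n \<in> S" "(\<lambda>n. c *\<^sub>C f n) \<longlonglongrightarrow> c *\<^sub>C x"
    using complex_vector.subspace_scale[OF assms]
    by (auto intro: bounded_linear.tendsto[OF bounded_linear_scaleC])
  then show "c *\<^sub>C x \<in> closure S"
    unfolding closure_sequential by (intro exI[of _ "\<lambda>n. c *\<^sub>C f n"] conjI)
qed

lemma bounded_clinear_blinfun_iff:
  "bounded_clinear (blinfun_apply \<phi>) \<longleftrightarrow> (\<forall>c x. blinfun_apply \<phi> (c *\<^sub>C x) = c *\<^sub>C blinfun_apply \<phi> x)"
  for \<phi> :: "'a::complex_normed_vector \<Rightarrow>\<^sub>L 'b::complex_normed_vector"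
  by (simp add: bounded_clinear_def blinfun.bounded_linear_right)

text \<open>The Banach space of bounded complex-linear functionals, with the operator norm
  inherited from the bounded real-linear maps.\<close>

typedef (overloaded) 'a cdual =
  "{\<phi> :: 'a::complex_normed_vector \<Rightarrow>\<^sub>L complex. bounded_clinear (blinfun_apply \<phi>)}"
  morphisms blinfun_of_cdual Abs_cdual
  by (rule exI[of _ 0]) (simp add: bounded_clinear_blinfun_iff)

setup_lifting type_definition_cdual

lift_definition cdual_apply :: "'a::complex_normed_vector cdual \<Rightarrow> 'a \<Rightarrow> complex"
  is blinfun_apply .

instantiation cdual :: (complex_normed_vector) complex_normed_vector
begin

lift_definition norm_cdual :: "'a cdual \<Rightarrow> real" is norm .
lift_definition zero_cdual :: "'a cdual" is 0
  by (simp add: bounded_clinear_blinfun_iff)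
lift_definition plus_cdual :: "'a cdual \<Rightarrow> 'a cdual \<Rightarrow> 'a cdual" is "(+)"
  by (simp add: bounded_clinear_blinfun_iff blinfun.bilinear_simps scaleC_add_right)
lift_definition minus_cdual :: "'a cdual \<Rightarrow> 'a cdual \<Rightarrow> 'a cdual" is "(-)"
  by (simp add: bounded_clinear_blinfun_iff blinfun.bilinear_simps complex_vector.scale_right_diff_distrib)
lift_definition uminus_cdual :: "'a cdual \<Rightarrow> 'a cdual" is uminus
  by (simp add: bounded_clinear_blinfun_iff blinfun.bilinear_simps)
lift_definition scaleR_cdual :: "real \<Rightarrow> 'a cdual \<Rightarrow> 'a cdual" is "(*\<^sub>R)"
  by (simp add: bounded_clinear_blinfun_iff blinfun.bilinear_simps scaleC_complex_def)
lift_definition scaleC_cdual :: "complex \<Rightarrow> 'a cdual \<Rightarrow> 'a cdual"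
  is "\<lambda>c \<phi>. blinfun_mult_right c o\<^sub>L \<phi>"
  by (simp add: bounded_clinear_blinfun_iff blinfun_mult_right.rep_eq scaleC_complex_def)

definition dist_cdual :: "'a cdual \<Rightarrow> 'a cdual \<Rightarrow> real"
  where "dist_cdual \<phi> \<psi> = norm (\<phi> - \<psi>)"
definition sgn_cdual :: "'a cdual \<Rightarrow> 'a cdual"
  where "sgn_cdual \<phi> = inverse (norm \<phi>) *\<^sub>R \<phi>"
definition uniformity_cdual :: "('a cdual \<times> 'a cdual) filter"
  where "uniformity_cdual = (INF e\<in>{0 <..}. principal {(\<phi>, \<psi>). dist \<phi> \<psi> < e})"
definition open_cdual :: "'a cdual set \<Rightarrow> bool"
  where "open_cdual S = (\<forall>\<phi>\<in>S. \<forall>\<^sub>F (\<phi>', \<psi>) in uniformity. \<phi>' = \<phi> \<longrightarrow> \<psi> \<in> S)"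

instance
proof
  fix \<phi> \<psi> \<theta> :: "'a cdual" and a b :: real and c d :: complex
  show "dist \<phi> \<psi> = norm (\<phi> - \<psi>)" by (fact dist_cdual_def)
  show "sgn \<phi> = inverse (norm \<phi>) *\<^sub>R \<phi>" by (fact sgn_cdual_def)
  show "uniformity = (INF e\<in>{0 <..}. principal {(\<phi>, \<psi> :: 'a cdual). dist \<phi> \<psi> < e})"
    by (fact uniformity_cdual_def)
  show "open S = (\<forall>\<phi>\<in>S. \<forall>\<^sub>F (\<phi>', \<psi>) in uniformity. \<phi>' = \<phi> \<longrightarrow> \<psi> \<in> S)" for S :: "'a cdual set"
    by (fact open_cdual_def)
  show "\<phi> + \<psi> + \<theta> = \<phi> + (\<psi> + \<theta>)" "\<phi> + \<psi> = \<psi> + \<phi>" "0 + \<phi> = \<phi>" "- \<phi> + \<phi> = 0"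
      "\<phi> - \<psi> = \<phi> + - \<psi>" "a *\<^sub>R (\<phi> + \<psi>) = a *\<^sub>R \<phi> + a *\<^sub>R \<psi>"
      "(a + b) *\<^sub>R \<phi> = a *\<^sub>R \<phi> + b *\<^sub>R \<phi>" "a *\<^sub>R b *\<^sub>R \<phi> = (a * b) *\<^sub>R \<phi>" "1 *\<^sub>R \<phi> = \<phi>"
      "(norm \<phi> = 0) = (\<phi> = 0)" "norm (\<phi> + \<psi>) \<le> norm \<phi> + norm \<psi>" "norm (a *\<^sub>R \<phi>) = \<bar>a\<bar> * norm \<phi>"
    by (transfer, simp add: algebra_simps norm_triangle_ineq)+
  show "c *\<^sub>C (\<phi> + \<psi>) = c *\<^sub>C \<phi> + c *\<^sub>C \<psi>" "(c + d) *\<^sub>C \<phi> = c *\<^sub>C \<phi> + d *\<^sub>C \<phi>"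
      "c *\<^sub>C d *\<^sub>C \<phi> = (c * d) *\<^sub>C \<phi>" "1 *\<^sub>C \<phi> = \<phi>" "a *\<^sub>R \<phi> = complex_of_real a *\<^sub>C \<phi>"
    by (transfer, rule blinfun_eqI,
        simp add: blinfun_mult_right.rep_eq blinfun.bilinear_simps algebra_simps
          scaleR_conv_of_real)+
  show "norm (c *\<^sub>C \<phi>) = norm c * norm \<phi>"
  proof (transfer, rule antisym)
    fix c :: complex and f :: "'a \<Rightarrow>\<^sub>L complex"
    let ?g = "\<lambda>c f. blinfun_mult_right c o\<^sub>L f"
    have le: "norm (?g c f) \<le> norm c * norm f" for c and f :: "'a \<Rightarrow>\<^sub>L complex"
      by (rule norm_blinfun_bound)
        (auto simp: blinfun_mult_right.rep_eq norm_mult mult.assoc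
          intro!: mult_left_mono norm_blinfun)
    show "norm (?g c f) \<le> norm c * norm f" by (fact le)
    show "norm c * norm f \<le> norm (?g c f)"
    proof (cases "c = 0")
      case False
      then have "?g (inverse c) (?g c f) = f"
        by (intro blinfun_eqI) (simp add: blinfun_mult_right.rep_eq)
      with le[of "inverse c" "?g c f"] False show ?thesis
        by (simp add: norm_divide field_simps)
    qed simp
  qed
qed

end

lemma closed_cdual_carrier:
  "closed {\<phi> :: 'a::complex_normed_vector \<Rightarrow>\<^sub>L complex. bounded_clinear (blinfun_apply \<phi>)}"
proof -
  have "{\<phi> :: 'a \<Rightarrow>\<^sub>L complex. bounded_clinear (blinfun_apply \<phi>)}
      = (\<Inter>c. \<Inter>x. {\<phi>. blinfun_apply \<phi> (c *\<^sub>C x) = c * blinfun_apply \<phi> x})"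
    by (auto simp: bounded_clinear_blinfun_iff scaleC_complex_def)
  also have "closed \<dots>"
    by (intro closed_INT ballI closed_Collect_eq continuous_intros)
  finally show ?thesis .
qed

instance cdual :: (complex_normed_vector) complex_banach
proof
  fix X :: "nat \<Rightarrow> 'a cdual"
  assume "Cauchy X"
  then have "Cauchy (\<lambda>n. blinfun_of_cdual (X n))"
    unfolding Cauchy_def dist_norm by transfer
  then obtain f where f: "(\<lambda>n. blinfun_of_cdual (X n)) \<longlonglongrightarrow> f"
    using Cauchy_convergent_iff convergent_def by blast
  have "bounded_clinear (blinfun_apply f)"
    using closed_sequentially[OF closed_cdual_carrier _ f] blinfun_of_cdual by blast
  then have f': "blinfun_of_cdual (Abs_cdual f) = f"
    by (simp add: Abs_cdual_inverse)
  have "X \<longlonglongrightarrow> Abs_cdual f"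
    using f unfolding tendsto_iff dist_norm
    by (simp add: norm_cdual.rep_eq minus_cdual.rep_eq f')
  then show "convergent X"
    by (auto simp: convergent_def)
qed


section \<open>Lipschitz-free spaces\<close>

class pointed_metric_space = metric_space +
  fixes basepoint :: 'a

typedef (overloaded) 'a lip0 =
  "{g :: 'a::pointed_metric_space \<Rightarrow> complex. (\<exists>C. C-lipschitz_on UNIV g) \<and> g basepoint = 0}"
  morphisms lip0_apply Abs_lip0
  by (rule exI[of _ "\<lambda>_. 0"]) (auto intro!: exI[of _ 0] simp: lipschitz_on_def)

setup_lifting type_definition_lip0

text \<open>The supremum ranges over all pairs: by \<^term>\<open>(0::real) / 0 = 0\<close> the diagonal contributes
  only the value 0, and the index set is never empty, even for a one-point space.\<close>

definition lip_norm :: "('a::metric_space \<Rightarrow> complex) \<Rightarrow> real"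
  where "lip_norm g = (SUP (x, y)\<in>UNIV. norm (g x - g y) / dist x y)"

lemma lip_norm_le:
  assumes "\<And>x y. norm (g x - g y) \<le> C * dist x y" "0 \<le> C"
  shows "lip_norm g \<le> C"
  unfolding lip_norm_def
  by (rule cSUP_least) (auto simp: divide_le_eq assms)

lemma lip_norm_bound:
  fixes g :: "'a::metric_space \<Rightarrow> complex"
  assumes "C-lipschitz_on UNIV g"
  shows "norm (g x - g y) \<le> lip_norm g * dist x y"
proof (cases "x = y")
  case False
  have "bdd_above (range (\<lambda>(x, y). norm (g x - g y) / dist x y))"
    using assms by (intro bdd_aboveI[of _ C]) (auto simp: lipschitz_on_def dist_norm divide_le_eq)
  then have "norm (g x - g y) / dist x y \<le> lip_norm g"
    unfolding lip_norm_def by (rule cSUP_upper2[of _ _ "(x, y)"]) auto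
  with False show ?thesis by (simp add: divide_le_eq)
qed simp

lemma lip_norm_nonneg:
  fixes g :: "'a::metric_space \<Rightarrow> complex"
  assumes "C-lipschitz_on UNIV g"
  shows "0 \<le> lip_norm g"
proof -
  have "bdd_above (range (\<lambda>(x, y). norm (g x - g y) / dist x y))"
    using assms by (intro bdd_aboveI[of _ C]) (auto simp: lipschitz_on_def dist_norm divide_le_eq)
  then show ?thesis
    unfolding lip_norm_def by (rule cSUP_upper2[of _ _ "(undefined, undefined)"]) auto
qed

lemma lip_norm_scale_le:
  fixes g :: "'a::metric_space \<Rightarrow> complex"
  assumes "C-lipschitz_on UNIV g"
  shows "lip_norm (\<lambda>x. c * g x) \<le> norm c * lip_norm g"
proof (rule lip_norm_le)
  show "norm (c * g x - c * g y) \<le> norm c * lip_norm g * dist x y" for x y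
    using mult_left_mono[OF lip_norm_bound[OF assms, of x y], of "norm c"]
    by (simp flip: right_diff_distrib add: norm_mult mult.assoc)
qed (simp add: lip_norm_nonneg[OF assms])

lemma lipschitz_on_scale:
  "C-lipschitz_on UNIV g \<Longrightarrow> (norm c * C)-lipschitz_on UNIV (\<lambda>x. c * g x)"
  for g :: "'a::metric_space \<Rightarrow> complex"
  by (auto simp: lipschitz_on_def dist_norm norm_mult mult.assoc
      simp flip: right_diff_distrib intro!: mult_left_mono)

lemma lip_norm_scale:
  fixes g :: "'a::metric_space \<Rightarrow> complex"
  assumes "C-lipschitz_on UNIV g"
  shows "lip_norm (\<lambda>x. c * g x) = norm c * lip_norm g"
proof (rule antisym)
  show "lip_norm (\<lambda>x. c * g x) \<le> norm c * lip_norm g"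
    by (rule lip_norm_scale_le[OF assms])
  show "norm c * lip_norm g \<le> lip_norm (\<lambda>x. c * g x)"
  proof (cases "c = 0")
    case True
    then show ?thesis
      using lip_norm_nonneg[OF lipschitz_on_scale[OF assms, of c]] by simp
  next
    case False
    then have "(\<lambda>x. inverse c * (c * g x)) = g"
      by (simp add: fun_eq_iff)
    with lip_norm_scale_le[OF lipschitz_on_scale[OF assms, of c], of "inverse c"] False
    show ?thesis
      by (simp add: norm_divide field_simps)
  qed
qed

lemma lip_norm_triangle:
  fixes g h :: "'a::metric_space \<Rightarrow> complex"
  assumes g: "C-lipschitz_on UNIV g" and h: "D-lipschitz_on UNIV h"
  shows "lip_norm (\<lambda>x. g x + h x) \<le> lip_norm g + lip_norm h"
proof (rule lip_norm_le)
  fix x y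
  have "norm (g x + h x - (g y + h y)) \<le> norm (g x - g y) + norm (h x - h y)"
    by (metis add_diff_add norm_triangle_ineq)
  also have "\<dots> \<le> (lip_norm g + lip_norm h) * dist x y"
    using lip_norm_bound[OF g, of x y] lip_norm_bound[OF h, of x y] by (simp add: distrib_right)
  finally show "norm (g x + h x - (g y + h y)) \<le> (lip_norm g + lip_norm h) * dist x y" .
qed (simp add: lip_norm_nonneg[OF g] lip_norm_nonneg[OF h])

instantiation lip0 :: (pointed_metric_space) complex_normed_vector
begin

lift_definition norm_lip0 :: "'a lip0 \<Rightarrow> real" is lip_norm .
lift_definition zero_lip0 :: "'a lip0" is "\<lambda>_. 0"
  by (auto intro!: exI[of _ 0] simp: lipschitz_on_def)
lift_definition plus_lip0 :: "'a lip0 \<Rightarrow> 'a lip0 \<Rightarrow> 'a lip0" is "\<lambda>g h x. g x + h x"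
  by (auto intro: lipschitz_on_add)
lift_definition minus_lip0 :: "'a lip0 \<Rightarrow> 'a lip0 \<Rightarrow> 'a lip0" is "\<lambda>g h x. g x - h x"
  by (auto intro: lipschitz_on_diff)
lift_definition uminus_lip0 :: "'a lip0 \<Rightarrow> 'a lip0" is "\<lambda>g x. - g x"
  by (auto simp: lipschitz_on_minus)
lift_definition scaleC_lip0 :: "complex \<Rightarrow> 'a lip0 \<Rightarrow> 'a lip0" is "\<lambda>c g x. c * g x"
  by (auto intro: lipschitz_on_scale)
lift_definition scaleR_lip0 :: "real \<Rightarrow> 'a lip0 \<Rightarrow> 'a lip0" is "\<lambda>r g x. complex_of_real r * g x"
  by (auto intro: lipschitz_on_scale)

definition dist_lip0 :: "'a lip0 \<Rightarrow> 'a lip0 \<Rightarrow> real"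
  where "dist_lip0 g h = norm (g - h)"
definition sgn_lip0 :: "'a lip0 \<Rightarrow> 'a lip0"
  where "sgn_lip0 g = inverse (norm g) *\<^sub>R g"
definition uniformity_lip0 :: "('a lip0 \<times> 'a lip0) filter"
  where "uniformity_lip0 = (INF e\<in>{0 <..}. principal {(g, h). dist g h < e})"
definition open_lip0 :: "'a lip0 set \<Rightarrow> bool"
  where "open_lip0 S = (\<forall>g\<in>S. \<forall>\<^sub>F (g', h) in uniformity. g' = g \<longrightarrow> h \<in> S)"

instance
proof
  fix g h k :: "'a lip0" and a b :: real and c d :: complex
  show "dist g h = norm (g - h)" by (fact dist_lip0_def)
  show "sgn g = inverse (norm g) *\<^sub>R g" by (fact sgn_lip0_def)
  show "uniformity = (INF e\<in>{0 <..}. principal {(g, h :: 'a lip0). dist g h < e})"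
    by (fact uniformity_lip0_def)
  show "open S = (\<forall>g\<in>S. \<forall>\<^sub>F (g', h) in uniformity. g' = g \<longrightarrow> h \<in> S)" for S :: "'a lip0 set"
    by (fact open_lip0_def)
  show "g + h + k = g + (h + k)" "g + h = h + g" "0 + g = g" "- g + g = 0"
      "g - h = g + - h" "a *\<^sub>R (g + h) = a *\<^sub>R g + a *\<^sub>R h"
      "(a + b) *\<^sub>R g = a *\<^sub>R g + b *\<^sub>R g" "a *\<^sub>R b *\<^sub>R g = (a * b) *\<^sub>R g" "1 *\<^sub>R g = g"
      "c *\<^sub>C (g + h) = c *\<^sub>C g + c *\<^sub>C h" "(c + d) *\<^sub>C g = c *\<^sub>C g + d *\<^sub>C g"
      "c *\<^sub>C d *\<^sub>C g = (c * d) *\<^sub>C g" "1 *\<^sub>C g = g" "a *\<^sub>R g = complex_of_real a *\<^sub>C g"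
    by (transfer, simp add: algebra_simps)+
  show "norm (a *\<^sub>R g) = \<bar>a\<bar> * norm g"
    by transfer (auto simp: lip_norm_scale)
  show "norm (c *\<^sub>C g) = norm c * norm g"
    by transfer (auto simp: lip_norm_scale)
  show "norm (g + h) \<le> norm g + norm h"
    by transfer (auto intro: lip_norm_triangle)
  show "(norm g = 0) = (g = 0)"
  proof transfer
    fix g :: "'a \<Rightarrow> complex"
    assume "(\<exists>C. C-lipschitz_on UNIV g) \<and> g basepoint = 0"
    then obtain C where C: "C-lipschitz_on UNIV g" and 0: "g basepoint = 0" by blast
    show "(lip_norm g = 0) = (g = (\<lambda>_. 0))"
    proof
      assume "lip_norm g = 0"
      then have "g x = 0" for x
        using lip_norm_bound[OF C, of x basepoint] 0 by simp
      then show "g = (\<lambda>_. 0)" by blast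
    next
      assume "g = (\<lambda>_. 0)"
      then show "lip_norm g = 0"
        using lip_norm_scale[OF C, of 0] by simp
    qed
  qed
qed

end

lemma lip0_apply_le: "norm (lip0_apply g x) \<le> norm g * dist x basepoint"
  by transfer (metis diff_zero lip_norm_bound)

lemma bounded_linear_lip0_apply: "bounded_linear (\<lambda>g. lip0_apply g x)"
  by (rule bounded_linear_intro[where K = "dist x basepoint"])
    (simp_all add: plus_lip0.rep_eq scaleR_lip0.rep_eq scaleR_conv_of_real lip0_apply_le)

lift_definition lip0_evaluation :: "'a::pointed_metric_space \<Rightarrow> 'a lip0 cdual"
  is "\<lambda>x. Blinfun (\<lambda>g. lip0_apply g x)"
  by (simp add: bounded_clinear_def bounded_linear_Blinfun_apply bounded_linear_lip0_apply
      scaleC_lip0.rep_eq scaleC_complex_def)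

lemma cdual_apply_lip0_evaluation: "cdual_apply (lip0_evaluation x) g = lip0_apply g x"
  by transfer (simp add: bounded_linear_Blinfun_apply bounded_linear_lip0_apply)

lemma csubspace_closure_span:
  "complex_vector.subspace (closure (complex_vector.span (S :: 'a::complex_normed_vector set)))"
  by (intro csubspace_closure complex_vector.subspace_span)

typedef (overloaded) 'a lipschitz_free =
  "closure (complex_vector.span (range lip0_evaluation))
    :: 'a::pointed_metric_space lip0 cdual set"
  morphisms cdual_of_lipschitz_free Abs_lipschitz_free
  using complex_vector.subspace_0[OF csubspace_closure_span] by blast

setup_lifting type_definition_lipschitz_free

instantiation lipschitz_free :: (pointed_metric_space) complex_normed_vector
begin

lift_definition norm_lipschitz_free :: "'a lipschitz_free \<Rightarrow> real" is norm .
lift_definition zero_lipschitz_free :: "'a lipschitz_free" is 0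
  by (rule complex_vector.subspace_0[OF csubspace_closure_span])
lift_definition plus_lipschitz_free ::
    "'a lipschitz_free \<Rightarrow> 'a lipschitz_free \<Rightarrow> 'a lipschitz_free" is "(+)"
  by (rule complex_vector.subspace_add[OF csubspace_closure_span])
lift_definition minus_lipschitz_free ::
    "'a lipschitz_free \<Rightarrow> 'a lipschitz_free \<Rightarrow> 'a lipschitz_free" is "(-)"
  by (rule complex_vector.subspace_diff[OF csubspace_closure_span])
lift_definition uminus_lipschitz_free :: "'a lipschitz_free \<Rightarrow> 'a lipschitz_free" is uminus
  by (rule complex_vector.subspace_neg[OF csubspace_closure_span])
lift_definition scaleC_lipschitz_free ::
    "complex \<Rightarrow> 'a lipschitz_free \<Rightarrow> 'a lipschitz_free" is "(*\<^sub>C)"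
  by (rule complex_vector.subspace_scale[OF csubspace_closure_span])
lift_definition scaleR_lipschitz_free ::
    "real \<Rightarrow> 'a lipschitz_free \<Rightarrow> 'a lipschitz_free" is "(*\<^sub>R)"
  unfolding scaleR_scaleC by (rule complex_vector.subspace_scale[OF csubspace_closure_span])

definition dist_lipschitz_free :: "'a lipschitz_free \<Rightarrow> 'a lipschitz_free \<Rightarrow> real"
  where "dist_lipschitz_free u v = norm (u - v)"
definition sgn_lipschitz_free :: "'a lipschitz_free \<Rightarrow> 'a lipschitz_free"
  where "sgn_lipschitz_free u = inverse (norm u) *\<^sub>R u"
definition uniformity_lipschitz_free :: "('a lipschitz_free \<times> 'a lipschitz_free) filter"
  where "uniformity_lipschitz_free = (INF e\<in>{0 <..}. principal {(u, v). dist u v < e})"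
definition open_lipschitz_free :: "'a lipschitz_free set \<Rightarrow> bool"
  where "open_lipschitz_free S = (\<forall>u\<in>S. \<forall>\<^sub>F (u', v) in uniformity. u' = u \<longrightarrow> v \<in> S)"

instance
proof
  fix u v w :: "'a lipschitz_free" and a b :: real and c d :: complex
  show "dist u v = norm (u - v)" by (fact dist_lipschitz_free_def)
  show "sgn u = inverse (norm u) *\<^sub>R u" by (fact sgn_lipschitz_free_def)
  show "uniformity = (INF e\<in>{0 <..}. principal {(u, v :: 'a lipschitz_free). dist u v < e})"
    by (fact uniformity_lipschitz_free_def)
  show "open S = (\<forall>u\<in>S. \<forall>\<^sub>F (u', v) in uniformity. u' = u \<longrightarrow> v \<in> S)"
    for S :: "'a lipschitz_free set"
    by (fact open_lipschitz_free_def)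
  show "u + v + w = u + (v + w)" "u + v = v + u" "0 + u = u" "- u + u = 0"
      "u - v = u + - v" "a *\<^sub>R (u + v) = a *\<^sub>R u + a *\<^sub>R v"
      "(a + b) *\<^sub>R u = a *\<^sub>R u + b *\<^sub>R u" "a *\<^sub>R b *\<^sub>R u = (a * b) *\<^sub>R u" "1 *\<^sub>R u = u"
      "(norm u = 0) = (u = 0)" "norm (u + v) \<le> norm u + norm v" "norm (a *\<^sub>R u) = \<bar>a\<bar> * norm u"
    by (transfer, simp add: algebra_simps norm_triangle_ineq)+
  show "c *\<^sub>C (u + v) = c *\<^sub>C u + c *\<^sub>C v" "(c + d) *\<^sub>C u = c *\<^sub>C u + d *\<^sub>C u"
      "c *\<^sub>C d *\<^sub>C u = (c * d) *\<^sub>C u" "1 *\<^sub>C u = u"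
      "a *\<^sub>R u = complex_of_real a *\<^sub>C u" "norm (c *\<^sub>C u) = norm c * norm u"
    by (transfer, simp add: scaleC_add_right scaleC_add_left scaleC_scaleC scaleC_one
        scaleR_scaleC norm_scaleC)+
qed

end

instance lipschitz_free :: (pointed_metric_space) complex_banach
proof
  fix X :: "nat \<Rightarrow> 'a lipschitz_free"
  assume "Cauchy X"
  then have "Cauchy (\<lambda>n. cdual_of_lipschitz_free (X n))"
    unfolding Cauchy_def dist_norm by transfer
  then obtain f where f: "(\<lambda>n. cdual_of_lipschitz_free (X n)) \<longlonglongrightarrow> f"
    using Cauchy_convergent_iff convergent_def by blast
  have "f \<in> closure (complex_vector.span (range lip0_evaluation))"
    using closed_sequentially[OF closed_closure _ f] cdual_of_lipschitz_free by blast
  then have f': "cdual_of_lipschitz_free (Abs_lipschitz_free f) = f"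
    by (simp add: Abs_lipschitz_free_inverse)
  have "X \<longlonglongrightarrow> Abs_lipschitz_free f"
    using f unfolding tendsto_iff dist_norm
    by (simp add: norm_lipschitz_free.rep_eq minus_lipschitz_free.rep_eq f')
  then show "convergent X"
    by (auto simp: convergent_def)
qed

lift_definition lip_delta :: "'a::pointed_metric_space \<Rightarrow> 'a lipschitz_free" is lip0_evaluation
  by (meson closure_subset complex_vector.span_base rangeI subsetD)


section \<open>The sequence space \<open>\<ell>\<^sup>1\<close>\<close>

typedef ell1 = "{a :: nat \<Rightarrow> complex. summable (\<lambda>n. norm (a n))}"
  morphisms ell1_nth Abs_ell1
  by (rule exI[of _ "\<lambda>_. 0"]) simp

setup_lifting type_definition_ell1

lemma summable_norm_add:
  fixes a b :: "nat \<Rightarrow> complex"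
  assumes "summable (\<lambda>n. norm (a n))" "summable (\<lambda>n. norm (b n))"
  shows "summable (\<lambda>n. norm (a n + b n))"
  by (rule summable_comparison_test'[OF summable_add[OF assms], of 0])
    (simp add: norm_triangle_ineq)

instantiation ell1 :: complex_normed_vector
begin

lift_definition norm_ell1 :: "ell1 \<Rightarrow> real" is "\<lambda>a. \<Sum>n. norm (a n)" .
lift_definition zero_ell1 :: ell1 is "\<lambda>_. 0" by simp
lift_definition plus_ell1 :: "ell1 \<Rightarrow> ell1 \<Rightarrow> ell1" is "\<lambda>a b n. a n + b n"
  by (rule summable_norm_add)
lift_definition minus_ell1 :: "ell1 \<Rightarrow> ell1 \<Rightarrow> ell1" is "\<lambda>a b n. a n - b n"
  using summable_norm_add[of _ "\<lambda>n. - b n" for b] by simp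
lift_definition uminus_ell1 :: "ell1 \<Rightarrow> ell1" is "\<lambda>a n. - a n" by simp
lift_definition scaleC_ell1 :: "complex \<Rightarrow> ell1 \<Rightarrow> ell1" is "\<lambda>c a n. c * a n"
  by (simp add: norm_mult summable_mult)
lift_definition scaleR_ell1 :: "real \<Rightarrow> ell1 \<Rightarrow> ell1" is "\<lambda>r a n. complex_of_real r * a n"
  by (simp add: norm_mult summable_mult)

definition dist_ell1 :: "ell1 \<Rightarrow> ell1 \<Rightarrow> real"
  where "dist_ell1 a b = norm (a - b)"
definition sgn_ell1 :: "ell1 \<Rightarrow> ell1"
  where "sgn_ell1 a = inverse (norm a) *\<^sub>R a"
definition uniformity_ell1 :: "(ell1 \<times> ell1) filter"
  where "uniformity_ell1 = (INF e\<in>{0 <..}. principal {(a, b). dist a b < e})"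
definition open_ell1 :: "ell1 set \<Rightarrow> bool"
  where "open_ell1 S = (\<forall>a\<in>S. \<forall>\<^sub>F (a', b) in uniformity. a' = a \<longrightarrow> b \<in> S)"

instance
proof
  fix x y z :: ell1 and a b :: real and c d :: complex
  show "dist x y = norm (x - y)" by (fact dist_ell1_def)
  show "sgn x = inverse (norm x) *\<^sub>R x" by (fact sgn_ell1_def)
  show "uniformity = (INF e\<in>{0 <..}. principal {(a, b :: ell1). dist a b < e})"
    by (fact uniformity_ell1_def)
  show "open S = (\<forall>a\<in>S. \<forall>\<^sub>F (a', b) in uniformity. a' = a \<longrightarrow> b \<in> S)" for S :: "ell1 set"
    by (fact open_ell1_def)
  show "x + y + z = x + (y + z)" "x + y = y + x" "0 + x = x" "- x + x = 0"
      "x - y = x + - y" "a *\<^sub>R (x + y) = a *\<^sub>R x + a *\<^sub>R y"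
      "(a + b) *\<^sub>R x = a *\<^sub>R x + b *\<^sub>R x" "a *\<^sub>R b *\<^sub>R x = (a * b) *\<^sub>R x" "1 *\<^sub>R x = x"
      "c *\<^sub>C (x + y) = c *\<^sub>C x + c *\<^sub>C y" "(c + d) *\<^sub>C x = c *\<^sub>C x + d *\<^sub>C x"
      "c *\<^sub>C d *\<^sub>C x = (c * d) *\<^sub>C x" "1 *\<^sub>C x = x" "a *\<^sub>R x = complex_of_real a *\<^sub>C x"
    by (transfer, simp add: algebra_simps)+
  show "norm (a *\<^sub>R x) = \<bar>a\<bar> * norm x" "norm (c *\<^sub>C x) = norm c * norm x"
    by (transfer, simp add: norm_mult suminf_mult)+
  show "norm (x + y) \<le> norm x + norm y"
  proof transfer
    fix a b :: "nat \<Rightarrow> complex"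
    assume ab: "summable (\<lambda>n. norm (a n))" "summable (\<lambda>n. norm (b n))"
    show "(\<Sum>n. norm (a n + b n)) \<le> (\<Sum>n. norm (a n)) + (\<Sum>n. norm (b n))"
      unfolding suminf_add[OF ab]
      by (intro suminf_le summable_norm_add summable_add ab norm_triangle_ineq)
  qed
  show "(norm x = 0) = (x = 0)"
    by transfer (auto simp: suminf_eq_zero_iff fun_eq_iff)
qed

end


section \<open>Quotients and dimension\<close>

definition closed_csubspace :: "'a::complex_normed_vector set \<Rightarrow> bool"
  where "closed_csubspace E \<longleftrightarrow> complex_vector.subspace E \<and> closed E"

definition finite_cdim :: "'a::complex_normed_vector set \<Rightarrow> bool"
  where "finite_cdim E \<longleftrightarrow> (\<exists>B. finite B \<and> complex_vector.span B = E)"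

text \<open>\<^term>\<open>complex_vector.dim E\<close> is 0 for infinite-dimensional \<^term>\<open>E\<close>, whence the disjunction.\<close>

definition cdim_at_least :: "nat \<Rightarrow> 'a::complex_normed_vector set \<Rightarrow> bool"
  where "cdim_at_least n E \<longleftrightarrow> \<not> finite_cdim E \<or> n \<le> complex_vector.dim E"

text \<open>The quotient \<open>Y/Z\<close> of the whole space by \<^term>\<open>Z\<close> is the set of cosets; \<open>quot_map Z\<close> is
  the canonical map \<open>Q\<close>.\<close>

definition quot_map :: "'a::complex_normed_vector set \<Rightarrow> 'a \<Rightarrow> 'a set"
  where "quot_map Z y = {y + z | z. z \<in> Z}"

definition quot_space :: "'a::complex_normed_vector set \<Rightarrow> 'a set set"
  where "quot_space Z = range (quot_map Z)"

definition quot_norm :: "'a::complex_normed_vector set \<Rightarrow> real"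
  where "quot_norm K = (INF y\<in>K. norm y)"

text \<open>The scaled unit ball \<open>\<alpha> B\<^bsub>Y/Z\<^esub>\<close>. Cosets are scaled through representatives, since the
  pointwise product of a coset with 0 is not a coset.\<close>

definition quot_ball :: "'a::complex_normed_vector set \<Rightarrow> real \<Rightarrow> 'a set set"
  where "quot_ball Z \<alpha> = {quot_map Z (\<alpha> *\<^sub>R y) | y. quot_norm (quot_map Z y) \<le> 1}"

text \<open>\<open>dim (Y/Z) = n\<close>: there are \<open>n\<close> vectors whose cosets form a basis of \<open>Y/Z\<close>.\<close>

definition quot_cdim_eq :: "'a::complex_normed_vector set \<Rightarrow> nat \<Rightarrow> bool"
  where "quot_cdim_eq Z n \<longleftrightarrow> (\<exists>B. finite B \<and> card B = n \<and>
    (\<forall>c. quot_map Z (\<Sum>b\<in>B. c b *\<^sub>C b) = quot_map Z 0 \<longrightarrow> (\<forall>b\<in>B. c b = 0)) \<and>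
    (\<forall>K\<in>quot_space Z. \<exists>c. K = quot_map Z (\<Sum>b\<in>B. c b *\<^sub>C b)))"


section \<open>Properties of operators\<close>

definition compact_operator ::
  "('a::complex_normed_vector \<Rightarrow> 'b::complex_normed_vector) \<Rightarrow> bool"
  where "compact_operator T \<longleftrightarrow> compact (closure (T ` cball 0 1))"

definition weak_topology :: "'a::complex_normed_vector topology"
  where "weak_topology =
    topology_generated_by {\<phi> -` U | (\<phi> :: 'a \<Rightarrow> complex) U. bounded_clinear \<phi> \<and> open U}"

definition weakly_compact_operator ::
  "('a::complex_normed_vector \<Rightarrow> 'b::complex_normed_vector) \<Rightarrow> bool"
  where "weakly_compact_operator T \<longleftrightarrow>
    compactin weak_topology (weak_topology closure_of (T ` cball 0 1))"

text \<open>\<^term>\<open>T\<close> restricts to an isomorphism of normed spaces, i.e. a linear homeomorphism, of the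
  subspace \<^term>\<open>E\<close> onto the subspace \<^term>\<open>F\<close>.\<close>

definition cisomorphism_on ::
  "'a::complex_normed_vector set \<Rightarrow> 'b::complex_normed_vector set \<Rightarrow> ('a \<Rightarrow> 'b) \<Rightarrow> bool"
  where "cisomorphism_on E F T \<longleftrightarrow>
    (\<forall>x\<in>E. \<forall>y\<in>E. T (x + y) = T x + T y) \<and> (\<forall>c. \<forall>x\<in>E. T (c *\<^sub>C x) = c *\<^sub>C T x) \<and>
    (\<exists>S. homeomorphism E F T S)"

definition strictly_singular ::
  "('a::complex_normed_vector \<Rightarrow> 'b::complex_normed_vector) \<Rightarrow> bool"
  where "strictly_singular T \<longleftrightarrow>
    \<not> (\<exists>E. closed_csubspace E \<and> \<not> finite_cdim E \<and> cisomorphism_on E (T ` E) T)"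

definition strictly_cosingular ::
  "('a::complex_normed_vector \<Rightarrow> 'b::complex_normed_vector) \<Rightarrow> bool"
  where "strictly_cosingular T \<longleftrightarrow>
    (\<forall>Z. closed_csubspace Z \<and> (\<nexists>n. quot_cdim_eq Z n) \<longrightarrow> range (quot_map Z \<circ> T) \<noteq> quot_space Z)"

definition super_strictly_singular ::
  "('a::complex_normed_vector \<Rightarrow> 'b::complex_normed_vector) \<Rightarrow> bool"
  where "super_strictly_singular T \<longleftrightarrow>
    (\<forall>\<epsilon>>0. \<exists>N\<ge>1. \<forall>E. complex_vector.subspace E \<and> cdim_at_least N E \<longrightarrow>
      (\<exists>x\<in>E. norm x = 1 \<and> norm (T x) \<le> \<epsilon>))"

text \<open>The suprema are taken in \<^typ>\<open>ennreal\<close>: the inner one is infinite when \<open>dim (Y/E) = 0\<close>, and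
  the outer one ranges over the empty set (and is 0) when \<open>n > dim Y\<close>.\<close>

definition surjectivity_modulus ::
  "('a::complex_normed_vector \<Rightarrow> 'b::complex_normed_vector) \<Rightarrow> 'b set \<Rightarrow> ennreal"
  where "surjectivity_modulus T E =
    Sup {ennreal \<alpha> | \<alpha>. 0 \<le> \<alpha> \<and> quot_ball E \<alpha> \<subseteq> (quot_map E \<circ> T) ` cball 0 1}"

definition super_strictly_cosingular ::
  "('a::complex_normed_vector \<Rightarrow> 'b::complex_normed_vector) \<Rightarrow> bool"
  where "super_strictly_cosingular T \<longleftrightarrow>
    (\<lambda>n. SUP E\<in>{E. closed_csubspace E \<and> quot_cdim_eq E n}. surjectivity_modulus T E)
      \<longlonglongrightarrow> 0"

definition isomorphic_to_ell1 :: "'a::complex_normed_vector set \<Rightarrow> bool"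
  where "isomorphic_to_ell1 E \<longleftrightarrow> (\<exists>J :: 'a \<Rightarrow> ell1. cisomorphism_on E UNIV J)"

definition complemented :: "'a::complex_normed_vector set \<Rightarrow> bool"
  where "complemented E \<longleftrightarrow> (\<exists>P. bounded_clinear P \<and> P \<circ> P = P \<and> range P = E)"

definition fixes_copy_of_ell1 ::
  "('a::complex_normed_vector \<Rightarrow> 'b::complex_normed_vector) \<Rightarrow> bool"
  where "fixes_copy_of_ell1 T \<longleftrightarrow>
    (\<exists>E F. closed_csubspace E \<and> closed_csubspace F \<and>
      isomorphic_to_ell1 E \<and> isomorphic_to_ell1 F \<and> cisomorphism_on E F T)"

definition fixes_complemented_copy_of_ell1 ::
  "('a::complex_normed_vector \<Rightarrow> 'b::complex_normed_vector) \<Rightarrow> bool"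
  where "fixes_complemented_copy_of_ell1 T \<longleftrightarrow>
    (\<exists>E F. closed_csubspace E \<and> closed_csubspace F \<and>
      isomorphic_to_ell1 E \<and> isomorphic_to_ell1 F \<and> cisomorphism_on E F T \<and>
      complemented E \<and> complemented F)"

end

theory Submission
  imports Defs "HOL-Library.Ramsey"
begin

text \<open>Compactness implies all the other properties by Riesz's lemma. Conversely, each of them fails as
  soon as there are a bounded sequence \<open>x\<^sub>k\<close> in the domain and functionals \<open>\<phi>\<^sub>k\<close> on the codomain with
  \<open>\<Sum>\<^sub>k \<bar>\<phi>\<^sub>k y\<bar> \<le> C \<parallel>y\<parallel>\<close> and \<open>\<phi>\<^sub>k (T x\<^sub>j) = \<delta>\<^sub>k\<^sub>j\<close>, since these exhibit a complemented copy of \<open>\<ell>\<^sup>1\<close> that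
  \<open>T\<close> fixes. For \<open>x\<^sub>k\<close> one takes multiples of molecules and for \<open>\<phi>\<^sub>k\<close> Lipschitz functions with pairwise
  disjoint supports. If \<open>T\<close> is not compact, then the images of the molecules are not totally bounded.
  They are combinations \<open>a \<delta>(u) + b \<delta>(v)\<close>, and Ramsey's theorem applied to the mutual distances of
  the points in a separated sequence of them yields a subsequence on which disjointly supported
  bumps are bounded away from 0.\<close>

text \<open>In an image \<open>a \<delta>(u) + b \<delta>(v)\<close> of bounded norm the single
  coefficients are not under control: u and v may be very close while a and b are huge and nearly
  opposite. With v the point nearer to the base point 0, only the dipole weight |a| d(u,v) and the
  product |a+b| d(v,0) are bounded. Hence a bump must see one of the two points and miss the other,
  which limits its radius by d(u,v), unless the dipole weight is negligible. Bumps of different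
  indices must also be disjoint, which limits the radii by the mutual distances. When the points u_n
  crowd together at the scale of d(u_n,v_n), bumps around them are impossible and the points v_n
  have to carry them. The separation of the images is used to exclude crowding: crowded points with
  bounded coefficients would produce two nearly equal images.\<close>

lemma Ramsey_subsequence:
  fixes P :: "nat \<Rightarrow> nat \<Rightarrow> bool"
  obtains r :: "nat \<Rightarrow> nat" where "strict_mono r"
    "(\<forall>i j. i < j \<longrightarrow> P (r i) (r j)) \<or> (\<forall>i j. i < j \<longrightarrow> \<not> P (r i) (r j))"
proof -
  \<comment> \<open>The colouring lives on unordered pairs, so \<open>P\<close> is read in
    increasing order of the two indices; it need not be symmetric.\<close>
  define f where "f X = (if P (Min X) (Max X) then 0 else 1::nat)" for X
  have f_lt: "f X < 2" for X by (simp add: f_def)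
  have "\<exists>Y t. Y \<subseteq> UNIV \<and> infinite Y \<and> t < (2::nat) \<and> (\<forall>x\<in>Y. \<forall>y\<in>Y. x \<noteq> y \<longrightarrow> f {x, y} = t)"
    by (rule Ramsey2[OF infinite_UNIV_nat]) (use f_lt in blast)
  then obtain Y t where Y: "infinite Y" "\<forall>x\<in>Y. \<forall>y\<in>Y. x \<noteq> y \<longrightarrow> f {x, y} = t"
    by blast
  define r where "r = enumerate Y"
  have r: "strict_mono r" "\<And>i. r i \<in> Y"
    using Y(1) by (simp_all add: r_def strict_mono_enumerate enumerate_in_set)
  have "P (r i) (r j) \<longleftrightarrow> t = 0" if "i < j" for i j
  proof -
    have "r i < r j"
      using r(1) that by (simp add: strict_mono_def)
    then have "f {r i, r j} = t"
      using Y(2) r(2) by (metis less_irrefl)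
    with \<open>r i < r j\<close> show ?thesis
      by (auto simp: f_def split: if_splits)
  qed
  with that[OF r(1)] show thesis
    by (cases "t = 0") auto
qed

text \<open>Greedy choice: the balls of radius e around the finitely many earlier points never cover
  \<open>S\<close>, so a further point far from all of them exists.\<close>

lemma separated_sequence:
  fixes S :: "'a::metric_space set"
  assumes "\<not> (\<forall>e>0. \<exists>k. finite k \<and> S \<subseteq> (\<Union>x\<in>k. ball x e))"
  obtains e and x :: "nat \<Rightarrow> 'a"
  where "0 < e" "\<And>n. x n \<in> S" "\<And>i j. i \<noteq> j \<Longrightarrow> e \<le> dist (x i) (x j)"
proof -
  from assms obtain e where e: "0 < e" and no: "\<And>k. finite k \<Longrightarrow> \<not> S \<subseteq> (\<Union>x\<in>k. ball x e)"
    by blast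
  let ?Q = "\<lambda>x (n::nat) y. y \<in> S \<and> (\<forall>m<n. e \<le> dist (x m) y)"
  have "\<exists>x. \<forall>n::nat. ?Q x n (x n)"
  proof (rule dependent_wellorder_choice)
    fix n :: nat and x assume "\<And>y. y < n \<Longrightarrow> ?Q x y (x y)"
    have "\<not> S \<subseteq> (\<Union>y\<in>x ` {..<n}. ball y e)"
      by (rule no) simp
    then show "\<exists>y. ?Q x n y"
      by (force simp: not_less)
  qed simp
  then obtain x where "\<forall>n. ?Q x n (x n)" ..
  then have x: "\<And>n. x n \<in> S" "\<And>m n. m < n \<Longrightarrow> e \<le> dist (x m) (x n)"
    by simp_all
  have "e \<le> dist (x i) (x j)" if "i \<noteq> j" for i j
    using x(2)[of i j] x(2)[of j i] that by (cases i j rule: linorder_cases) (auto simp: dist_commute)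
  with e x(1) that show thesis by blast
qed

lemma totally_bounded_pigeonhole:
  assumes "finite k" "S \<subseteq> (\<Union>x\<in>k. ball x e)" "card k < n" "\<And>i. i < n \<Longrightarrow> x i \<in> S"
  obtains i j where "i < j" "j < n" "dist (x i) (x j) < 2 * e"
proof -
  have "\<exists>c\<in>k. x i \<in> ball c e" if "i < n" for i
    using assms(2,4) that by blast
  then obtain c where c: "\<And>i. i < n \<Longrightarrow> c i \<in> k \<and> dist (c i) (x i) < e"
    by (metis mem_ball)
  have "card (c ` {..<n}) \<le> card k"
    by (rule card_mono) (use c assms(1) in auto)
  then have "\<not> inj_on c {..<n}"
    using assms(3) pigeonhole[of c "{..<n}"] by simp
  then obtain i j where ij: "i < n" "j < n" "i < j" "c i = c j"
    unfolding inj_on_def by (metis lessThan_iff linorder_neqE_nat)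
  have "dist (x i) (x j) \<le> dist (c i) (x i) + dist (c j) (x j)"
    using ij(4) by (metis dist_commute dist_triangle)
  with c[OF ij(1)] c[OF ij(2)] ij that show thesis by force
qed

text \<open>The combinatorial core of Schauder's theorem on adjoints of compact operators.\<close>

lemma kernel_totally_bounded_swap:
  fixes K :: "'a \<Rightarrow> 'b \<Rightarrow> complex"
  assumes bdd: "\<And>a b. a \<in> A \<Longrightarrow> b \<in> B \<Longrightarrow> norm (K a b) \<le> C"
    and tb: "\<And>e. 0 < e \<Longrightarrow>
      \<exists>A0. finite A0 \<and> A0 \<subseteq> A \<and> (\<forall>a\<in>A. \<exists>a0\<in>A0. \<forall>b\<in>B. norm (K a b - K a0 b) \<le> e)"
    and "0 < e"
  shows "\<exists>B0. finite B0 \<and> B0 \<subseteq> B \<and> (\<forall>b\<in>B. \<exists>b0\<in>B0. \<forall>a\<in>A. norm (K a b - K a b0) \<le> e)"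
proof -
  \<comment> \<open>The error e is spent as d + 2 d + d: d for each of the two replacements of a by
    a point of \<open>A0\<close>, and 2 d for two values in one grid cell of side d, where each of
    the two coordinates varies by at most d.\<close>
  define d where "d = e / 4"
  have d: "0 < d" using \<open>0 < e\<close> by (simp add: d_def)
  from tb[OF d] obtain A0 where A0: "finite A0" "A0 \<subseteq> A"
    and near: "\<And>a. a \<in> A \<Longrightarrow> \<exists>a0\<in>A0. \<forall>b\<in>B. norm (K a b - K a0 b) \<le> d" by blast
  define q where "q z = (\<lfloor>Re z / d\<rfloor>, \<lfloor>Im z / d\<rfloor>)" for z
  \<comment> \<open>\<open>p b\<close> is the pattern of grid cells of b on the finite set
    \<open>A0\<close>; the constant value off \<open>A0\<close> leaves only finitely many patterns.
    \<open>B0\<close> will contain one b for each pattern.\<close>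
  define p where "p b = (\<lambda>a. if a \<in> A0 then q (K a b) else (0, 0))" for b
  define R where "R = {- \<lceil>\<bar>C\<bar> / d\<rceil> - 1..\<lceil>\<bar>C\<bar> / d\<rceil> + 1}"
  have coord: "\<lfloor>t / d\<rfloor> \<in> R" if "\<bar>t\<bar> \<le> C" for t
  proof -
    have "\<bar>t / d\<bar> \<le> \<bar>C\<bar> / d"
      using that d by (simp add: abs_divide divide_right_mono)
    then have "- (\<bar>C\<bar> / d) \<le> t / d" "t / d \<le> \<bar>C\<bar> / d" by linarith+
    then show ?thesis unfolding R_def atLeastAtMost_iff by linarith
  qed
  have qK: "q (K a b) \<in> R \<times> R" if "a \<in> A" "b \<in> B" for a b
    unfolding q_def using bdd[OF that] abs_Re_le_cmod[of "K a b"] abs_Im_le_cmod[of "K a b"]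
    by (auto intro!: coord)
  have "p ` B \<subseteq> {h. \<forall>a. (a \<in> A0 \<longrightarrow> h a \<in> R \<times> R) \<and> (a \<notin> A0 \<longrightarrow> h a = (0, 0))}"
    using qK A0(2) by (auto simp: p_def subset_iff)
  moreover have "finite (R \<times> R)" by (simp add: R_def)
  ultimately have fin: "finite (p ` B)"
    using finite_set_of_finite_funs[OF A0(1)] by (rule_tac finite_subset)
  define B0 where "B0 = inv_into B p ` (p ` B)"
  have close: "norm (z - w) \<le> 2 * d" if "q z = q w" for z w
  proof -
    have "\<bar>s - t\<bar> \<le> d" if "\<lfloor>s / d\<rfloor> = \<lfloor>t / d\<rfloor>" for s t
    proof -
      have "\<bar>s / d - t / d\<bar> \<le> 1" using that by linarith
      moreover have "\<bar>s / d - t / d\<bar> = \<bar>s - t\<bar> / d"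
        using d by (simp flip: diff_divide_distrib)
      ultimately show ?thesis using d by (simp add: divide_le_eq)
    qed
    then have "\<bar>Re (z - w)\<bar> \<le> d" "\<bar>Im (z - w)\<bar> \<le> d"
      using that by (simp_all add: q_def)
    with cmod_le[of "z - w"] show ?thesis by linarith
  qed
  show ?thesis
  proof (intro exI[of _ B0] conjI ballI)
    show "finite B0" using fin by (simp add: B0_def)
    show "B0 \<subseteq> B" by (auto simp: B0_def inv_into_into)
    fix b assume b: "b \<in> B"
    define b0 where "b0 = inv_into B p (p b)"
    have b0: "b0 \<in> B" "p b0 = p b"
      using b by (simp_all add: b0_def inv_into_into f_inv_into_f)
    show "\<exists>b0\<in>B0. \<forall>a\<in>A. norm (K a b - K a b0) \<le> e"
    proof (intro bexI[of _ b0] ballI)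
      show "b0 \<in> B0" using b by (simp add: B0_def b0_def)
      fix a assume "a \<in> A"
      then obtain a0 where a0: "a0 \<in> A0" "\<forall>b\<in>B. norm (K a b - K a0 b) \<le> d"
        using near by blast
      have "q (K a0 b) = q (K a0 b0)"
        using fun_cong[OF b0(2), of a0] a0(1) by (simp add: p_def)
      from close[OF this] have "norm (K a0 b - K a0 b0) \<le> 2 * d" .
      moreover have "norm (K a b - K a0 b) \<le> d" "norm (K a b0 - K a0 b0) \<le> d"
        using a0(2) b b0(1) by auto
      moreover have "K a b - K a b0 = (K a b - K a0 b) + ((K a0 b - K a0 b0) - (K a b0 - K a0 b0))"
        by simp
      ultimately have "norm (K a b - K a b0) \<le> d + (2 * d + d)"
        by (metis add_mono norm_triangle_le norm_triangle_le_diff)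
      then show "norm (K a b - K a b0) \<le> e" by (simp add: d_def)
    qed
  qed
qed

section \<open>Closed subspaces and quotients\<close>

lemma bounded_clinearD:
  assumes "bounded_clinear T"
  shows "bounded_linear T" "T 0 = 0" "T (x + y) = T x + T y" "T (x - y) = T x - T y"
    "T (c *\<^sub>C x) = c *\<^sub>C T x" "T (r *\<^sub>R x) = r *\<^sub>R T x" "T (sum f A) = (\<Sum>a\<in>A. T (f a))"
  using assms unfolding bounded_clinear_def
  by (simp_all add: linear_simps bounded_linear.linear linear_sum linear_0 linear_add linear_diff
      linear_scale)

lemma bounded_clinearI:
  assumes "\<And>x y. T (x + y) = T x + T y" "\<And>c x. T (c *\<^sub>C x) = c *\<^sub>C T x"
    and "\<And>x. norm (T x) \<le> K * norm x"
  shows "bounded_clinear T"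
  unfolding bounded_clinear_def
  by (auto intro!: bounded_linear_intro[where K = K]
      simp: assms scaleR_scaleC mult.commute[of _ K])

lemma bounded_clinear_compose:
  assumes "bounded_clinear S" "bounded_clinear T"
  shows "bounded_clinear (\<lambda>x. S (T x))"
  using assms unfolding bounded_clinear_def by (auto intro: bounded_linear_compose)

text \<open>The distance d of b from \<open>Z\<close> controls the coefficient of b: |c| d is at
  most the norm of z + c b. Hence the coefficients along a convergent sequence in the span are
  Cauchy, and the limit stays in the span.\<close>

lemma closed_csubspace_span_insert:
  assumes "closed_csubspace Z"
  shows "closed_csubspace (complex_vector.span (insert b Z))"
proof (cases "b \<in> Z")
  case True
  then have "complex_vector.span (insert b Z) = Z"
    using assms by (simp add: insert_absorb closed_csubspace_def complex_vector.span_eq_iff)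
  with assms show ?thesis by simp
next
  case False
  have sub: "complex_vector.subspace Z" and cl: "closed Z"
    using assms by (auto simp: closed_csubspace_def)
  have sp: "complex_vector.span (insert b Z) = {x. \<exists>k. x - k *\<^sub>C b \<in> Z}"
    using sub by (simp add: complex_vector.span_insert complex_vector.span_eq_iff[THEN iffD2])
  define d where "d = infdist b Z"
  have ne: "Z \<noteq> {}" using complex_vector.subspace_0[OF sub] by blast
  have d: "0 < d"
    using False in_closed_iff_infdist_zero[OF cl ne, of b] infdist_nonneg[of b Z]
    by (simp add: d_def less_le)
  have lower: "norm c * d \<le> norm (z + c *\<^sub>C b)" if "z \<in> Z" for z c
  proof (cases "c = 0")
    case False
    have "d \<le> dist b (- inverse c *\<^sub>C z)"
      unfolding d_def using that sub by (intro infdist_le complex_vector.subspace_scale)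
    then have "norm c * d \<le> norm c * norm (b + inverse c *\<^sub>C z)"
      by (intro mult_left_mono) (simp_all add: dist_norm)
    also have "\<dots> = norm (c *\<^sub>C (b + inverse c *\<^sub>C z))" by (simp add: norm_scaleC)
    also have "c *\<^sub>C (b + inverse c *\<^sub>C z) = z + c *\<^sub>C b"
      using False by (simp add: scaleC_add_right scaleC_scaleC scaleC_one)
    finally show ?thesis .
  qed simp
  have "closed {x. \<exists>k. x - k *\<^sub>C b \<in> Z}"
    unfolding closed_sequential_limits
  proof (intro allI impI, elim conjE)
    fix y l assume y: "\<forall>n. y n \<in> {x. \<exists>k. x - k *\<^sub>C b \<in> Z}" and lim: "y \<longlonglongrightarrow> l"
    from y obtain c where c: "\<And>n. y n - c n *\<^sub>C b \<in> Z" by (auto, metis)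
    have "norm (c m - c n) * d \<le> norm (y m - y n)" for m n
    proof -
      have "(y m - c m *\<^sub>C b) - (y n - c n *\<^sub>C b) \<in> Z"
        by (intro complex_vector.subspace_diff[OF sub] c)
      from lower[OF this, of "c m - c n"] show ?thesis
        by (simp add: complex_vector.scale_left_diff_distrib algebra_simps)
    qed
    then have le: "norm (c m - c n) \<le> norm (y m - y n) / d" for m n
      using d by (simp add: le_divide_eq)
    have "Cauchy c"
    proof (rule metric_CauchyI)
      fix e :: real assume "0 < e"
      then have "0 < e * d" using d by simp
      then obtain M where M: "\<And>m n. M \<le> m \<Longrightarrow> M \<le> n \<Longrightarrow> dist (y m) (y n) < e * d"
        using LIMSEQ_imp_Cauchy[OF lim] by (meson metric_CauchyD)
      have "dist (c m) (c n) < e" if "M \<le> m" "M \<le> n" for m n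
        using le[of m n] M[OF that] d
        by (simp add: dist_norm) (meson divide_less_eq le_less_trans)
      then show "\<exists>M. \<forall>m\<ge>M. \<forall>n\<ge>M. dist (c m) (c n) < e" by blast
    qed
    then obtain k where k: "c \<longlonglongrightarrow> k"
      using Cauchy_convergent_iff convergent_def by blast
    have "bounded_linear (\<lambda>c. c *\<^sub>C b)"
      by (rule bounded_linear_intro[where K = "norm b"])
        (simp_all add: scaleC_add_left scaleR_scaleC scaleC_scaleC norm_scaleC scaleR_conv_of_real
            scaleC_complex_def)
    then have "(\<lambda>n. y n - c n *\<^sub>C b) \<longlonglongrightarrow> l - k *\<^sub>C b"
      by (intro tendsto_diff lim bounded_linear.tendsto[OF _ k])
    then have "l - k *\<^sub>C b \<in> Z"
      by (rule closed_sequentially[OF cl, rotated]) (rule c)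
    then show "l \<in> {x. \<exists>k. x - k *\<^sub>C b \<in> Z}" by blast
  qed
  then show ?thesis
    by (simp add: closed_csubspace_def complex_vector.subspace_span flip: sp)
qed

lemma closed_csubspace_span_Un_finite:
  assumes "closed_csubspace Z" "finite B"
  shows "closed_csubspace (complex_vector.span (Z \<union> B))"
  using assms(2)
proof induction
  case empty
  then show ?case
    using assms(1) by (simp add: closed_csubspace_def complex_vector.span_eq_iff[THEN iffD2])
next
  case (insert b B)
  have "complex_vector.span (insert b (complex_vector.span (Z \<union> B)))
      = complex_vector.span (Z \<union> insert b B)"
    by (simp add: complex_vector.span_insert complex_vector.span_span)
  with closed_csubspace_span_insert[OF insert.IH, of b] show ?case by simp
qed

text \<open>Normalise w - z0, where z0 in \<open>Z\<close> is nearest to w up to a factor 2; this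
  factor is the origin of 1/2.\<close>

lemma riesz_lemma:
  fixes Z W :: "'a::complex_normed_vector set"
  assumes Z: "closed_csubspace Z" and W: "complex_vector.subspace W" and "Z \<subseteq> W" "\<not> W \<subseteq> Z"
  obtains x where "x \<in> W" "norm x \<le> 1" "\<And>z. z \<in> Z \<Longrightarrow> 1 / 2 \<le> norm (x - z)"
proof -
  have sub: "complex_vector.subspace Z" and cl: "closed Z"
    using Z by (auto simp: closed_csubspace_def)
  from assms obtain w where w: "w \<in> W" "w \<notin> Z" by blast
  have ne: "Z \<noteq> {}" using complex_vector.subspace_0[OF sub] by blast
  define d where "d = infdist w Z"
  have d: "0 < d"
    using w in_closed_iff_infdist_zero[OF cl ne, of w] infdist_nonneg[of w Z]
    by (simp add: d_def less_le)
  have "infdist w Z < 2 * d" using d by (simp add: d_def)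
  then obtain z0 where z0: "z0 \<in> Z" "dist w z0 < 2 * d"
    using ne unfolding infdist_def by (auto simp: cINF_less_iff bdd_below_image_dist split: if_splits)
  define r where "r = dist w z0"
  have r: "0 < r" using w z0 by (auto simp: r_def)
  show thesis
  proof (rule that)
    let ?x = "inverse r *\<^sub>R (w - z0)"
    show "?x \<in> W"
      unfolding scaleR_scaleC using W w z0 \<open>Z \<subseteq> W\<close>
      by (intro complex_vector.subspace_scale complex_vector.subspace_diff) auto
    show "norm ?x \<le> 1" using r by (simp add: r_def dist_norm)
    fix z assume "z \<in> Z"
    then have "z0 + r *\<^sub>R z \<in> Z"
      unfolding scaleR_scaleC using sub z0
      by (intro complex_vector.subspace_add complex_vector.subspace_scale)
    then have "d \<le> dist w (z0 + r *\<^sub>R z)" unfolding d_def by (rule infdist_le)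
    also have "\<dots> = norm (r *\<^sub>R (?x - z))"
      using r by (simp add: dist_norm scaleR_right_diff_distrib algebra_simps)
    also have "\<dots> = r * norm (?x - z)" using r by simp
    finally have "d \<le> r * norm (?x - z)" .
    moreover have "r * norm (?x - z) \<le> 2 * d * norm (?x - z)"
      using z0(2) by (intro mult_right_mono) (simp_all add: r_def)
    ultimately have "d * 1 \<le> d * (2 * norm (?x - z))" by linarith
    with d show "1 / 2 \<le> norm (?x - z)" by simp
  qed
qed

text \<open>Riesz's lemma is applied successively to the span of \<open>Z\<close> and the vectors
  already chosen. The hypothesis \<open>large\<close> asks only that fewer than n vectors never span
  \<open>W\<close> modulo \<open>Z\<close>, which serves large subspaces (\<open>Z\<close> trivial)
  and quotients of finite or infinite dimension (\<open>W\<close> the whole space) alike. The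
  conclusion separates cosets, not only vectors.\<close>

lemma riesz_separated:
  fixes Z W :: "'a::complex_normed_vector set"
  assumes Z: "closed_csubspace Z" and W: "complex_vector.subspace W" and "Z \<subseteq> W"
    and large: "\<And>B. finite B \<Longrightarrow> card B < n \<Longrightarrow> \<not> W \<subseteq> complex_vector.span (Z \<union> B)"
  obtains x where "\<And>i. i < n \<Longrightarrow> x i \<in> W" "\<And>i. i < n \<Longrightarrow> norm (x i) \<le> 1"
    "\<And>i j z. i < j \<Longrightarrow> j < n \<Longrightarrow> z \<in> Z \<Longrightarrow> 1 / 2 \<le> norm (x j - x i - z)"
proof -
  \<comment> \<open>The guard \<open>i < n\<close> lets the recursion run over all natural numbers
    although vectors exist only up to n.\<close>
  let ?Q = "\<lambda>x (i::nat) y. i < n \<longrightarrow> y \<in> W \<and> norm y \<le> 1 \<and>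
    (\<forall>z\<in>complex_vector.span (Z \<union> x ` {..<i}). 1 / 2 \<le> norm (y - z))"
  have "\<exists>x. \<forall>i. ?Q x i (x i)"
  proof (rule dependent_wellorder_choice)
    fix r and f g :: "nat \<Rightarrow> 'a" and i :: nat
    assume "\<And>y. y < i \<Longrightarrow> f y = g y"
    then have "f ` {..<i} = g ` {..<i}" by (intro image_cong) auto
    then show "?Q f i r = ?Q g i r" by simp
  next
    fix i :: nat and x assume IH: "\<And>y. y < i \<Longrightarrow> ?Q x y (x y)"
    show "\<exists>y. ?Q x i y"
    proof (cases "i < n")
      case True
      let ?Z = "complex_vector.span (Z \<union> x ` {..<i})"
      have "closed_csubspace ?Z"
        using Z by (rule closed_csubspace_span_Un_finite) simp
      moreover have "?Z \<subseteq> W"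
        using IH True \<open>Z \<subseteq> W\<close> by (intro complex_vector.span_minimal[OF _ W]) auto
      moreover have "card (x ` {..<i}) < n"
        using card_image_le[of "{..<i}" x] True by simp
      then have "\<not> W \<subseteq> ?Z" by (intro large) simp_all
      ultimately obtain y where "y \<in> W" "norm y \<le> 1" "\<And>z. z \<in> ?Z \<Longrightarrow> 1 / 2 \<le> norm (y - z)"
        using riesz_lemma[OF _ W] by metis
      then show ?thesis by blast
    qed simp
  qed
  then obtain x where x: "\<forall>i. ?Q x i (x i)" ..
  have "1 / 2 \<le> norm (x j - x i - z)" if "i < j" "j < n" "z \<in> Z" for i j z
  proof -
    have "x i + z \<in> complex_vector.span (Z \<union> x ` {..<j})"
      using that by (intro complex_vector.span_add complex_vector.span_base) auto
    with x that have "1 / 2 \<le> norm (x j - (x i + z))" by blast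
    then show ?thesis by (simp add: algebra_simps)
  qed
  with x that show thesis by blast
qed

lemma cdim_at_least_not_subset_span:
  assumes "complex_vector.subspace E" "cdim_at_least n E" "finite B" "card B < n"
  shows "\<not> E \<subseteq> complex_vector.span B"
proof
  assume sub: "E \<subseteq> complex_vector.span B"
  obtain A where A: "A \<subseteq> E" "complex_vector.independent A" "E \<subseteq> complex_vector.span A"
      "card A = complex_vector.dim E"
    by (rule complex_vector.basis_exists)
  have "finite A \<and> card A \<le> card B"
    using A sub by (intro complex_vector.independent_span_bound assms) auto
  moreover from this have "finite_cdim E"
    using A(1,3) assms(1) complex_vector.span_subspace unfolding finite_cdim_def by blast
  ultimately show False
    using assms(2,4) A(4) by (simp add: cdim_at_least_def)
qed

section \<open>Codimension, expressed by spanning modulo a subspace\<close>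

lemma quot_map_eq_iff:
  assumes "complex_vector.subspace Z"
  shows "quot_map Z x = quot_map Z y \<longleftrightarrow> x - y \<in> Z"
proof
  assume "quot_map Z x = quot_map Z y"
  moreover have "x \<in> quot_map Z x"
    using complex_vector.subspace_0[OF assms] by (force simp: quot_map_def)
  ultimately show "x - y \<in> Z" by (auto simp: quot_map_def)
next
  assume xy: "x - y \<in> Z"
  have "\<exists>z'. x + z = y + z' \<and> z' \<in> Z" if "z \<in> Z" for z
    using complex_vector.subspace_add[OF assms xy that]
    by (intro exI[of _ "x - y + z"]) (simp add: algebra_simps)
  moreover have "\<exists>z'. y + z = x + z' \<and> z' \<in> Z" if "z \<in> Z" for z
    using complex_vector.subspace_diff[OF assms that xy]
    by (intro exI[of _ "z - (x - y)"]) (simp add: algebra_simps)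
  ultimately show "quot_map Z x = quot_map Z y" unfolding quot_map_def by blast
qed

lemma quot_cdim_eq_altdef:
  assumes Z: "complex_vector.subspace Z"
  shows "quot_cdim_eq Z n \<longleftrightarrow> (\<exists>B. finite B \<and> card B = n \<and>
    (\<forall>c. (\<Sum>b\<in>B. c b *\<^sub>C b) \<in> Z \<longrightarrow> (\<forall>b\<in>B. c b = 0)) \<and>
    complex_vector.span (Z \<union> B) = UNIV)"
proof -
  have "(\<forall>K\<in>quot_space Z. \<exists>c. K = quot_map Z (\<Sum>b\<in>B. c b *\<^sub>C b)) \<longleftrightarrow>
      complex_vector.span (Z \<union> B) = UNIV" if "finite B" for B
  proof -
    have sp: "complex_vector.span Z = Z" using Z by (simp add: complex_vector.span_eq_iff)
    have "(\<forall>K\<in>quot_space Z. \<exists>c. K = quot_map Z (\<Sum>b\<in>B. c b *\<^sub>C b)) \<longleftrightarrow>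
        (\<forall>y. \<exists>c. y - (\<Sum>b\<in>B. c b *\<^sub>C b) \<in> Z)"
      by (simp add: quot_space_def quot_map_eq_iff[OF Z])
    also have "\<dots> \<longleftrightarrow> (\<forall>y. y \<in> complex_vector.span (Z \<union> B))"
    proof (intro iff_allI)
      fix y
      show "(\<exists>c. y - (\<Sum>b\<in>B. c b *\<^sub>C b) \<in> Z) \<longleftrightarrow> y \<in> complex_vector.span (Z \<union> B)"
      proof
        assume "\<exists>c. y - (\<Sum>b\<in>B. c b *\<^sub>C b) \<in> Z"
        then obtain c where c: "y - (\<Sum>b\<in>B. c b *\<^sub>C b) \<in> Z" ..
        have "(y - (\<Sum>b\<in>B. c b *\<^sub>C b)) + (\<Sum>b\<in>B. c b *\<^sub>C b) \<in> complex_vector.span (Z \<union> B)"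
          using c by (intro complex_vector.span_add complex_vector.span_sum complex_vector.span_scale
              complex_vector.span_base) auto
        then show "y \<in> complex_vector.span (Z \<union> B)" by simp
      next
        assume "y \<in> complex_vector.span (Z \<union> B)"
        then obtain z s where "y = z + s" "z \<in> Z" "s \<in> complex_vector.span B"
          unfolding complex_vector.span_Un sp by blast
        moreover from this obtain c where "s = (\<Sum>b\<in>B. c b *\<^sub>C b)"
          by (auto simp: complex_vector.span_finite[OF \<open>finite B\<close>])
        ultimately show "\<exists>c. y - (\<Sum>b\<in>B. c b *\<^sub>C b) \<in> Z"
          by (intro exI[of _ c]) simp
      qed
    qed
    finally show ?thesis by auto
  qed
  then show ?thesis
    by (auto simp: quot_cdim_eq_def quot_map_eq_iff[OF Z])
qed

text \<open>Each vector is congruent modulo \<open>Z\<close> to some s(y) in the span of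
  \<open>B\<close>. A basis \<open>C\<close> of the quotient is independent modulo \<open>Z\<close>,
  so its representatives under s are independent inside the span of \<open>B\<close>, and the
  exchange lemma counts them.\<close>

lemma quot_cdim_eq_imp_le_card:
  assumes Z: "complex_vector.subspace Z" and "quot_cdim_eq Z n"
    and B: "finite B" "complex_vector.span (Z \<union> B) = UNIV"
  shows "n \<le> card B"
proof -
  obtain C where C: "finite C" "card C = n"
      "\<And>c. (\<Sum>b\<in>C. c b *\<^sub>C b) \<in> Z \<Longrightarrow> (\<forall>b\<in>C. c b = 0)"
    using assms(2) unfolding quot_cdim_eq_altdef[OF Z] by blast
  have sp: "complex_vector.span Z = Z" using Z by (simp add: complex_vector.span_eq_iff)
  have "\<exists>s. s \<in> complex_vector.span B \<and> y - s \<in> Z" for y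
  proof -
    have "y \<in> complex_vector.span (Z \<union> B)" using B by simp
    then obtain z s where "y = z + s" "z \<in> Z" "s \<in> complex_vector.span B"
      unfolding complex_vector.span_Un sp by blast
    then show ?thesis by auto
  qed
  then obtain s where s: "\<And>y. s y \<in> complex_vector.span B" "\<And>y. y - s y \<in> Z" by metis
  have rep: "(\<Sum>b\<in>C. c b *\<^sub>C b) - (\<Sum>b\<in>C. c b *\<^sub>C s b) \<in> Z" for c
  proof -
    have "(\<Sum>b\<in>C. c b *\<^sub>C b) - (\<Sum>b\<in>C. c b *\<^sub>C s b) = (\<Sum>b\<in>C. c b *\<^sub>C (b - s b))"
      by (simp add: sum_subtractf complex_vector.scale_right_diff_distrib)
    then show ?thesis
      using s(2) by (simp add: complex_vector.subspace_sum[OF Z] complex_vector.subspace_scale[OF Z])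
  qed
  have zero: "\<forall>b\<in>C. c b = 0" if "(\<Sum>b\<in>C. c b *\<^sub>C s b) = 0" for c
    using C(3)[of c] rep[of c] that by simp
  have inj: "inj_on s C"
  proof (rule inj_onI, rule ccontr)
    fix b b' assume b: "b \<in> C" "b' \<in> C" "s b = s b'" "b \<noteq> b'"
    \<comment> \<open>If s identified b and b', the coefficients 1 and -1 would give a nontrivial
      relation.\<close>
    let ?c = "\<lambda>x. if x = b then 1 else if x = b' then - 1 else (0::complex)"
    have "(\<Sum>x\<in>C. ?c x *\<^sub>C s x) = (\<Sum>x\<in>{b, b'}. ?c x *\<^sub>C s x)"
      using C(1) b by (intro sum.mono_neutral_right) auto
    also have "\<dots> = 0" using b by (simp add: scaleC_one)
    finally have "\<forall>x\<in>C. ?c x = 0" by (rule zero)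
    with b show False by auto
  qed
  have "complex_vector.independent (s ` C)"
  proof (subst complex_vector.independent_explicit_module, intro allI impI)
    fix t u v assume t: "finite t" "t \<subseteq> s ` C" "(\<Sum>v\<in>t. u v *\<^sub>C v) = 0" "v \<in> t"
    let ?c = "\<lambda>b. if s b \<in> t then u (s b) else 0"
    have "(\<Sum>b\<in>C. ?c b *\<^sub>C s b) = (\<Sum>w\<in>s ` C. (if w \<in> t then u w else 0) *\<^sub>C w)"
      by (simp add: sum.reindex[OF inj])
    also have "\<dots> = (\<Sum>w\<in>t. (if w \<in> t then u w else 0) *\<^sub>C w)"
      using C(1) t by (intro sum.mono_neutral_right) auto
    also have "\<dots> = 0" using t(3) by simp
    finally have "\<forall>b\<in>C. ?c b = 0" by (rule zero)
    moreover obtain b where "b \<in> C" "v = s b" using t(2,4) by blast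
    ultimately show "u v = 0" using t(4) by auto
  qed
  then have "card (s ` C) \<le> card B"
    using complex_vector.independent_span_bound[OF B(1)] s(1) by auto
  then show ?thesis using C(2) inj by (simp add: card_image)
qed

text \<open>A smallest finite set spanning modulo \<open>Z\<close> would be a basis of the quotient:
  a nontrivial relation modulo \<open>Z\<close> would allow one of its vectors to be
  dropped.\<close>

lemma infinite_quot_cdim_imp_span_neq_UNIV:
  assumes Z: "complex_vector.subspace Z" and inf: "\<nexists>n. quot_cdim_eq Z n" and "finite B"
  shows "complex_vector.span (Z \<union> B) \<noteq> UNIV"
  using assms(3)
proof (induction "card B" arbitrary: B rule: less_induct)
  case less
  show ?case
  proof
    assume sp: "complex_vector.span (Z \<union> B) = UNIV"
    have "\<forall>b\<in>B. c b = 0" if c: "(\<Sum>b\<in>B. c b *\<^sub>C b) \<in> Z" for c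
    proof (rule ccontr)
      assume "\<not> (\<forall>b\<in>B. c b = 0)"
      then obtain b where b: "b \<in> B" "c b \<noteq> 0" by blast
      let ?S = "complex_vector.span (Z \<union> (B - {b}))"
      have "(\<Sum>x\<in>B. c x *\<^sub>C x) - (\<Sum>x\<in>B - {b}. c x *\<^sub>C x) \<in> ?S"
        using c by (intro complex_vector.span_diff complex_vector.span_sum
            complex_vector.span_scale complex_vector.span_base) auto
      also have "(\<Sum>x\<in>B. c x *\<^sub>C x) - (\<Sum>x\<in>B - {b}. c x *\<^sub>C x) = c b *\<^sub>C b"
        using less.prems b by (simp add: sum.remove)
      finally have "inverse (c b) *\<^sub>C c b *\<^sub>C b \<in> ?S" by (rule complex_vector.span_scale)
      then have "b \<in> ?S" using b by (simp add: scaleC_scaleC scaleC_one)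
      then have "Z \<union> B \<subseteq> ?S"
        using complex_vector.span_superset[of "Z \<union> (B - {b})"] by blast
      then have "complex_vector.span (Z \<union> B) \<subseteq> ?S"
        by (rule complex_vector.span_minimal) (rule complex_vector.subspace_span)
      with sp have "?S = UNIV" by auto
      moreover have "card (B - {b}) < card B" using less.prems b(1) by (rule card_Diff1_less)
      ultimately show False using less.hyps[of "B - {b}"] less.prems by simp
    qed
    with sp less.prems have "quot_cdim_eq Z (card B)"
      unfolding quot_cdim_eq_altdef[OF Z] by blast
    with inf show False by blast
  qed
qed

text \<open>Applying \<open>\<phi> k\<close> to a linear relation isolates its k-th coefficient, so
  the vectors are independent.\<close>

lemma biorthogonal_le_card:
  fixes y :: "nat \<Rightarrow> 'a::complex_normed_vector"
  assumes \<phi>: "\<And>k. bounded_clinear (\<phi> k)"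
    and bio: "\<And>k j. k < n \<Longrightarrow> j < n \<Longrightarrow> \<phi> k (y j) = (if k = j then 1 else (0::complex))"
    and "finite B" "\<And>j. j < n \<Longrightarrow> y j \<in> complex_vector.span B"
  shows "n \<le> card B"
proof -
  have inj: "inj_on y {..<n}"
    using bio by (intro inj_onI) (metis lessThan_iff zero_neq_one)
  have "complex_vector.independent (y ` {..<n})"
  proof (subst complex_vector.independent_explicit_module, intro allI impI)
    fix t u v assume t: "finite t" "t \<subseteq> y ` {..<n}" "(\<Sum>v\<in>t. u v *\<^sub>C v) = 0" "v \<in> t"
    then obtain k where k: "k < n" "v = y k" by auto
    have "0 = \<phi> k (\<Sum>w\<in>t. u w *\<^sub>C w)" using t(3) by (simp add: bounded_clinearD(2)[OF \<phi>])
    also have "\<dots> = (\<Sum>w\<in>t. u w * \<phi> k w)"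
      by (simp add: bounded_clinearD[OF \<phi>] scaleC_complex_def)
    also have "\<dots> = (\<Sum>w\<in>{v}. u w * \<phi> k w)"
    proof (rule sum.mono_neutral_right)
      show "\<forall>w\<in>t - {v}. u w * \<phi> k w = 0"
      proof
        fix w assume "w \<in> t - {v}"
        then obtain j where "j < n" "w = y j" "j \<noteq> k" using t(2) k(2) by blast
        then show "u w * \<phi> k w = 0" using bio k(1) by simp
      qed
    qed (use t in auto)
    also have "\<dots> = u v" using k bio by simp
    finally show "u v = 0" by simp
  qed
  then have "card (y ` {..<n}) \<le> card B"
    using complex_vector.independent_span_bound[OF assms(3)] assms(4) by auto
  then show ?thesis by (simp add: card_image[OF inj])
qed

section \<open>Consequences of compactness\<close>

lemma compact_operator_iff_totally_bounded:
  fixes T :: "'a::complex_normed_vector \<Rightarrow> 'b::complex_banach"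
  shows "compact_operator T \<longleftrightarrow> (\<forall>e>0. \<exists>k. finite k \<and> T ` cball 0 1 \<subseteq> (\<Union>x\<in>k. ball x e))"
proof
  assume "compact_operator T"
  then have "\<forall>e>0. \<exists>k. finite k \<and> closure (T ` cball 0 1) \<subseteq> (\<Union>x\<in>k. ball x e)"
    by (simp add: compact_operator_def compact_eq_totally_bounded)
  then show "\<forall>e>0. \<exists>k. finite k \<and> T ` cball 0 1 \<subseteq> (\<Union>x\<in>k. ball x e)"
    by (meson closure_subset order_trans)
next
  assume tb: "\<forall>e>0. \<exists>k. finite k \<and> T ` cball 0 1 \<subseteq> (\<Union>x\<in>k. ball x e)"
  have "\<exists>k. finite k \<and> closure (T ` cball 0 1) \<subseteq> (\<Union>x\<in>k. ball x e)" if "0 < e" for e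
  proof -
    from tb that obtain k where k: "finite k" "T ` cball 0 1 \<subseteq> (\<Union>x\<in>k. ball x (e / 2))"
      by (metis half_gt_zero)
    then have "T ` cball 0 1 \<subseteq> (\<Union>x\<in>k. cball x (e / 2))"
      by (meson UN_mono ball_subset_cball order_refl order_trans)
    moreover have "closed (\<Union>x\<in>k. cball x (e / 2))" using k(1) by (intro closed_UN) auto
    ultimately have "closure (T ` cball 0 1) \<subseteq> (\<Union>x\<in>k. cball x (e / 2))"
      by (rule closure_minimal)
    also have "\<dots> \<subseteq> (\<Union>x\<in>k. ball x e)" using that by (intro UN_mono) auto
    finally show ?thesis using k(1) by blast
  qed
  then show "compact_operator T"
    by (simp add: compact_operator_def compact_eq_totally_bounded complete_eq_closed)
qed

text \<open>The bound is the number of balls of radius e/2 covering the image of the unit ball. Its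
  independence of the vectors gives the uniformity in the dimension that the two
  \<open>super\<close> properties demand.\<close>

lemma compact_operator_separated_bound:
  fixes T :: "'a::complex_normed_vector \<Rightarrow> 'b::complex_banach"
  assumes "compact_operator T" "0 < e"
  obtains k :: nat where "\<And>x n. (\<And>i. i < n \<Longrightarrow> norm (x i) \<le> 1) \<Longrightarrow>
    (\<And>i j. i < j \<Longrightarrow> j < n \<Longrightarrow> e \<le> norm (T (x j) - T (x i))) \<Longrightarrow> n \<le> k"
proof -
  obtain K where K: "finite K" "T ` cball 0 1 \<subseteq> (\<Union>x\<in>K. ball x (e / 2))"
    using assms unfolding compact_operator_iff_totally_bounded by (metis half_gt_zero)
  have "n \<le> card K" if "\<And>i. i < n \<Longrightarrow> norm (x i) \<le> 1"
    and sep: "\<And>i j. i < j \<Longrightarrow> j < n \<Longrightarrow> e \<le> norm (T (x j) - T (x i))" for x and n :: nat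
  proof (rule ccontr)
    assume "\<not> n \<le> card K"
    then have "card K < n" by simp
    from totally_bounded_pigeonhole[OF K this, of "\<lambda>i. T (x i)"] that(1)
    obtain i j where "i < j" "j < n" "dist (T (x i)) (T (x j)) < 2 * (e / 2)" by auto
    with sep[of i j] show False by (simp add: dist_norm norm_minus_commute)
  qed
  then show thesis by (rule that)
qed

text \<open>On a subspace \<open>E\<close> without a unit vector of small image, \<open>T\<close> is
  bounded below by e, so k + 1 Riesz vectors of \<open>E\<close>, which are 1/2-separated, have
  e/2-separated images: one more than compactness allows.\<close>

lemma compact_imp_super_strictly_singular:
  fixes T :: "'a::complex_normed_vector \<Rightarrow> 'b::complex_banach"
  assumes T: "bounded_clinear T" and "compact_operator T"
  shows "super_strictly_singular T"
  unfolding super_strictly_singular_def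
proof (intro allI impI)
  fix e :: real assume "0 < e"
  then obtain k :: nat where k: "\<And>x n. (\<And>i. i < n \<Longrightarrow> norm (x i) \<le> 1) \<Longrightarrow>
      (\<And>i j. i < j \<Longrightarrow> j < n \<Longrightarrow> e / 2 \<le> norm (T (x j) - T (x i))) \<Longrightarrow> n \<le> k"
    using compact_operator_separated_bound[OF assms(2), of "e / 2"] by (metis half_gt_zero)
  show "\<exists>N\<ge>1. \<forall>E. complex_vector.subspace E \<and> cdim_at_least N E \<longrightarrow>
      (\<exists>x\<in>E. norm x = 1 \<and> norm (T x) \<le> e)"
  proof (intro exI[of _ "Suc k"] conjI allI impI)
    fix E :: "'a set"
    assume "complex_vector.subspace E \<and> cdim_at_least (Suc k) E"
    then have E: "complex_vector.subspace E" "cdim_at_least (Suc k) E" by auto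
    show "\<exists>x\<in>E. norm x = 1 \<and> norm (T x) \<le> e"
    proof (rule ccontr)
      assume no: "\<not> (\<exists>x\<in>E. norm x = 1 \<and> norm (T x) \<le> e)"
      have lower: "e * norm x \<le> norm (T x)" if "x \<in> E" for x
      proof (cases "x = 0")
        case False
        have "inverse (norm x) *\<^sub>R x \<in> E"
          unfolding scaleR_scaleC using E that by (intro complex_vector.subspace_scale)
        with no False have "e < norm (T (inverse (norm x) *\<^sub>R x))" by force
        then show ?thesis
          using False by (simp add: bounded_clinearD[OF T] field_simps)
      qed (simp add: bounded_clinearD[OF T])
      obtain x where x: "\<And>i. i < Suc k \<Longrightarrow> x i \<in> E" "\<And>i. i < Suc k \<Longrightarrow> norm (x i) \<le> 1"
          and sep: "\<And>i j z. i < j \<Longrightarrow> j < Suc k \<Longrightarrow> z \<in> {0} \<Longrightarrow> 1 / 2 \<le> norm (x j - x i - z)"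
      proof (rule riesz_separated[of "{0}" E "Suc k"])
        show "\<not> E \<subseteq> complex_vector.span ({0} \<union> B)" if "finite B" "card B < Suc k" for B
          using cdim_at_least_not_subset_span[OF E that] by simp
      qed (use E in \<open>auto simp: closed_csubspace_def complex_vector.subspace_0\<close>)
      have "e / 2 \<le> norm (T (x j) - T (x i))" if "i < j" "j < Suc k" for i j
      proof -
        have "e * (1 / 2) \<le> e * norm (x j - x i)"
          using sep[OF that, of 0] \<open>0 < e\<close> by (intro mult_left_mono) auto
        also have "\<dots> \<le> norm (T (x j - x i))"
          using x(1) that by (intro lower complex_vector.subspace_diff[OF E(1)]) auto
        finally show ?thesis by (simp add: bounded_clinearD[OF T])
      qed
      from k[of "Suc k" x, OF x(2) this] show False by simp
    qed
  qed simp
qed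

text \<open>A homeomorphism gives only a continuous inverse; its linearity on \<open>F\<close> is
  inherited from \<open>T\<close> by injectivity.\<close>

lemma cisomorphism_on_inverse:
  assumes "cisomorphism_on E F T" "complex_vector.subspace E"
  obtains S where "cisomorphism_on F E S" "complex_vector.subspace F"
    "\<And>x. x \<in> E \<Longrightarrow> T x \<in> F" "\<And>y. y \<in> F \<Longrightarrow> S y \<in> E"
    "\<And>x. x \<in> E \<Longrightarrow> S (T x) = x" "\<And>y. y \<in> F \<Longrightarrow> T (S y) = y"
proof -
  from assms(1) obtain S where add: "\<And>x y. x \<in> E \<Longrightarrow> y \<in> E \<Longrightarrow> T (x + y) = T x + T y"
      and sc: "\<And>c x. x \<in> E \<Longrightarrow> T (c *\<^sub>C x) = c *\<^sub>C T x" and hom: "homeomorphism E F T S"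
    unfolding cisomorphism_on_def by blast
  have TS: "T ` E = F" "S ` F = E" "\<And>x. x \<in> E \<Longrightarrow> S (T x) = x" "\<And>y. y \<in> F \<Longrightarrow> T (S y) = y"
    using hom by (auto simp: homeomorphism_def)
  have T0: "T 0 = 0"
    using sc[OF complex_vector.subspace_0[OF assms(2)], of 0] by simp
  have F: "complex_vector.subspace F"
  proof (rule complex_vector.subspaceI)
    show "0 \<in> F" using T0 TS(1) complex_vector.subspace_0[OF assms(2)] by force
    show "u + v \<in> F" if "u \<in> F" "v \<in> F" for u v
    proof -
      from that obtain x y where "x \<in> E" "u = T x" "y \<in> E" "v = T y" using TS(1) by blast
      then show ?thesis
        using add[of x y] complex_vector.subspace_add[OF assms(2), of x y] TS(1)
        by (auto intro: image_eqI[of _ T "x + y"])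
    qed
    show "c *\<^sub>C u \<in> F" if "u \<in> F" for c u
    proof -
      from that obtain x where "x \<in> E" "u = T x" using TS(1) by blast
      then show ?thesis
        using sc[of x c] complex_vector.subspace_scale[OF assms(2), of x c] TS(1)
        by (auto intro: image_eqI[of _ T "c *\<^sub>C x"])
    qed
  qed
  have "cisomorphism_on F E S"
    unfolding cisomorphism_on_def
  proof (intro conjI exI ballI allI)
    show "homeomorphism F E S T" by (rule homeomorphism_sym[THEN iffD1, OF hom])
    show "S (u + v) = S u + S v" if "u \<in> F" "v \<in> F" for u v
    proof -
      have uv: "S u \<in> E" "S v \<in> E" using that TS(2) by auto
      have "S (T (S u + S v)) = S u + S v"
        by (intro TS(3) complex_vector.subspace_add[OF assms(2)] uv)
      then show ?thesis using add[OF uv] TS(4) that by simp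
    qed
    show "S (c *\<^sub>C u) = c *\<^sub>C S u" if "u \<in> F" for c u
    proof -
      have u: "S u \<in> E" using that TS(2) by auto
      have "S (T (c *\<^sub>C S u)) = c *\<^sub>C S u"
        by (intro TS(3) complex_vector.subspace_scale[OF assms(2)] u)
      then show ?thesis using sc[OF u] TS(4) that by simp
    qed
  qed
  then show thesis by (rule that[OF _ F]) (use TS in auto)
qed

text \<open>Continuity at 0 and homogeneity: x is rescaled to norm d/2, inside the ball of radius d
  that \<open>T\<close> maps into the unit ball.\<close>

lemma cisomorphism_on_bounded:
  assumes "cisomorphism_on E F T" "complex_vector.subspace E"
  obtains C where "0 < C" "\<And>x. x \<in> E \<Longrightarrow> norm (T x) \<le> C * norm x"
proof -
  have sc: "\<And>c x. x \<in> E \<Longrightarrow> T (c *\<^sub>C x) = c *\<^sub>C T x" and cont: "continuous_on E T"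
    using assms(1) by (auto simp: cisomorphism_on_def homeomorphism_def)
  have E0: "0 \<in> E" by (rule complex_vector.subspace_0[OF assms(2)])
  have T0: "T 0 = 0" using sc[OF E0, of 0] by simp
  from cont E0 obtain d where d: "0 < d" "\<And>x. x \<in> E \<Longrightarrow> dist x 0 < d \<Longrightarrow> dist (T x) (T 0) < 1"
    unfolding continuous_on_iff by (metis zero_less_one)
  show thesis
  proof (rule that)
    show "0 < 2 / d" using d by simp
    fix x assume x: "x \<in> E"
    show "norm (T x) \<le> 2 / d * norm x"
    proof (cases "x = 0")
      case False
      define r where "r = d / (2 * norm x)"
      have r: "0 < r" using d False by (simp add: r_def)
      have "complex_of_real r *\<^sub>C x \<in> E"
        by (rule complex_vector.subspace_scale[OF assms(2) x])
      moreover have "norm (complex_of_real r *\<^sub>C x) < d"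
      proof -
        have "norm (complex_of_real r *\<^sub>C x) = r * norm x" using r by (simp add: norm_scaleC)
        also have "\<dots> < d" using d False by (simp add: r_def)
        finally show ?thesis .
      qed
      ultimately have "norm (T (complex_of_real r *\<^sub>C x)) < 1"
        using d(2) T0 by (simp add: dist_norm)
      then have "r * norm (T x) < 1" using r by (simp add: sc[OF x] norm_scaleC)
      then show ?thesis using d False by (simp add: r_def field_simps)
    qed (simp add: T0)
  qed
qed

lemma super_strictly_singular_imp_strictly_singular:
  assumes "super_strictly_singular T"
  shows "strictly_singular T"
  unfolding strictly_singular_def
proof (rule notI, elim exE conjE)
  fix E assume E: "closed_csubspace E" "\<not> finite_cdim E" and iso: "cisomorphism_on E (T ` E) T"
  have sub: "complex_vector.subspace E" using E(1) by (simp add: closed_csubspace_def)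
  obtain S where S: "cisomorphism_on (T ` E) E S" "complex_vector.subspace (T ` E)"
      "\<And>x. x \<in> E \<Longrightarrow> S (T x) = x"
    by (rule cisomorphism_on_inverse[OF iso sub]) blast
  obtain C where C: "0 < C" "\<And>y. y \<in> T ` E \<Longrightarrow> norm (S y) \<le> C * norm y"
    by (rule cisomorphism_on_bounded[OF S(1,2)]) blast
  \<comment> \<open>The inverse has bound C, so unit vectors of \<open>E\<close> have images of norm
    at least 1/C; half of that is already contradictory.\<close>
  obtain N where "\<forall>E. complex_vector.subspace E \<and> cdim_at_least N E \<longrightarrow>
      (\<exists>x\<in>E. norm x = 1 \<and> norm (T x) \<le> 1 / (2 * C))"
    using assms C(1) unfolding super_strictly_singular_def by (metis zero_less_divide_1_iff zero_less_mult_iff zero_less_numeral)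
  then obtain x where x: "x \<in> E" "norm x = 1" "norm (T x) \<le> 1 / (2 * C)"
    using sub E(2) unfolding cdim_at_least_def by blast
  have "1 \<le> C * norm (T x)" using C(2)[of "T x"] x S(3) by simp
  also have "\<dots> \<le> C * (1 / (2 * C))" using x C by (intro mult_left_mono) auto
  also have "\<dots> = 1 / 2" using C by simp
  finally show False by simp
qed

lift_definition ell1_unit :: "nat \<Rightarrow> ell1" is "\<lambda>k n. if n = k then 1 else 0"
  by (rule summable_finite[of "{k}" for k]) auto

lemma norm_ell1_nth_le: "norm (ell1_nth a n) \<le> norm a"
  by transfer (rule sum_le_suminf[of _ "{n}" for n, simplified], auto)

lemma norm_ell1_unit: "norm (ell1_unit k) = 1"
proof transfer
  show "(\<Sum>n. norm (if n = k then 1 else 0 :: complex)) = 1" for k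
    using suminf_finite[of "{k}" "\<lambda>n. norm (if n = k then 1 else 0 :: complex)"] by simp
qed

lemma norm_ell1_unit_diff: "i \<noteq> j \<Longrightarrow> 1 \<le> norm (ell1_unit i - ell1_unit j)"
  using norm_ell1_nth_le[of "ell1_unit i - ell1_unit j" i]
  by (simp add: minus_ell1.rep_eq ell1_unit.rep_eq)

text \<open>The unit vectors of \<open>ell1\<close> are 1-separated. Carried into \<open>E\<close>
  by the inverse of \<open>J\<close> and scaled into the unit ball, they remain separated after
  \<open>T\<close>, with a constant composed of the bounds of the three maps involved.\<close>

lemma compact_imp_not_fixes_copy_of_ell1:
  fixes T :: "'a::complex_normed_vector \<Rightarrow> 'b::complex_banach"
  assumes T: "bounded_clinear T" and "compact_operator T"
  shows "\<not> fixes_copy_of_ell1 T"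
  unfolding fixes_copy_of_ell1_def isomorphic_to_ell1_def
proof (rule notI, elim exE conjE)
  fix E :: "'a set" and F :: "'b set" and J :: "'a \<Rightarrow> ell1"
  assume "closed_csubspace E" and J: "cisomorphism_on E UNIV J" and TEF: "cisomorphism_on E F T"
  then have sub: "complex_vector.subspace E" by (simp add: closed_csubspace_def)
  obtain R where R: "cisomorphism_on UNIV E R" "\<And>a. R a \<in> E" "\<And>a. J (R a) = a"
    by (rule cisomorphism_on_inverse[OF J sub]) blast
  obtain S where S: "cisomorphism_on F E S" "complex_vector.subspace F"
      "\<And>x. x \<in> E \<Longrightarrow> T x \<in> F" "\<And>x. x \<in> E \<Longrightarrow> S (T x) = x"
    by (rule cisomorphism_on_inverse[OF TEF sub]) blast
  obtain A where A: "0 < A" "\<And>x. x \<in> E \<Longrightarrow> norm (J x) \<le> A * norm x"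
    by (rule cisomorphism_on_bounded[OF J sub]) blast
  obtain B where B: "0 < B" "\<And>a. norm (R a) \<le> B * norm a"
    by (rule cisomorphism_on_bounded[OF R(1)]) auto
  obtain C where C: "0 < C" "\<And>y. y \<in> F \<Longrightarrow> norm (S y) \<le> C * norm y"
    by (rule cisomorphism_on_bounded[OF S(1,2)]) blast
  define x where "x n = inverse B *\<^sub>R R (ell1_unit n)" for n
  have "norm (x n) \<le> 1" for n
    using B(1) B(2)[of "ell1_unit n"] by (simp add: x_def norm_ell1_unit field_simps)
  moreover have "1 / (A * C * B) \<le> norm (T (x j) - T (x i))" if "i \<noteq> j" for i j
  proof -
    let ?d = "R (ell1_unit j) - R (ell1_unit i)"
    have d: "?d \<in> E" by (intro complex_vector.subspace_diff[OF sub] R)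
    have "J (u - v) = J u - J v" if "u \<in> E" "v \<in> E" for u v
      using J that complex_vector.subspace_diff[OF sub that]
      unfolding cisomorphism_on_def by (metis add_diff_cancel diff_add_cancel)
    then have "J ?d = ell1_unit j - ell1_unit i" using R by simp
    then have "1 \<le> norm (J ?d)" using norm_ell1_unit_diff[of j i] that by simp
    also have "\<dots> \<le> A * norm (S (T ?d))" using A(2) d S(4) by simp
    also have "\<dots> \<le> A * (C * norm (T ?d))"
      using A(1) C(2) d S(3) by (intro mult_left_mono) auto
    also have "norm (T ?d) = B * norm (T (x j) - T (x i))"
    proof -
      have "T ?d = B *\<^sub>R (T (x j) - T (x i))"
        using B(1) by (simp add: x_def bounded_clinearD[OF T] scaleR_right_diff_distrib)
      then show ?thesis using B(1) by simp
    qed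
    finally show ?thesis using A B C by (simp add: field_simps)
  qed
  moreover obtain k :: nat where "\<And>x n. (\<And>i. i < n \<Longrightarrow> norm (x i) \<le> 1) \<Longrightarrow>
      (\<And>i j. i < j \<Longrightarrow> j < n \<Longrightarrow> 1 / (A * C * B) \<le> norm (T (x j) - T (x i))) \<Longrightarrow> n \<le> k"
    by (rule compact_operator_separated_bound[OF assms(2), of "1 / (A * C * B)"]) (use A B C in auto)
  from this[of "Suc k" x] show False using calculation by auto
qed

lemma quot_norm_le: "complex_vector.subspace E \<Longrightarrow> quot_norm (quot_map E y) \<le> norm y"
  unfolding quot_norm_def
  by (rule cINF_lower) (force simp: quot_map_def dest: complex_vector.subspace_0 intro: bdd_belowI[of _ 0])+

text \<open>If the image of the unit ball covers \<open>\<alpha>\<close> times the ball of the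
  n-dimensional quotient, then n Riesz vectors y_i modulo \<open>E\<close> lift: \<alpha> y_i is
  congruent to T x_i with x_i in the unit ball. The T x_i are \<alpha>/2-separated even modulo
  \<open>E\<close>, so compactness bounds n as soon as \<alpha> > e.\<close>

lemma compact_imp_super_strictly_cosingular:
  fixes T :: "'a::complex_normed_vector \<Rightarrow> 'b::complex_banach"
  assumes T: "bounded_clinear T" and "compact_operator T"
  shows "super_strictly_cosingular T"
proof -
  have main: "\<exists>k. \<forall>n>k. \<forall>E. closed_csubspace E \<and> quot_cdim_eq E n \<longrightarrow>
      surjectivity_modulus T E \<le> ennreal e" if "0 < e" for e
  proof -
    from \<open>0 < e\<close> obtain k :: nat where k: "\<And>x n. (\<And>i. i < n \<Longrightarrow> norm (x i) \<le> 1) \<Longrightarrow>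
        (\<And>i j. i < j \<Longrightarrow> j < n \<Longrightarrow> e / 2 \<le> norm (T (x j) - T (x i))) \<Longrightarrow> n \<le> k"
      using compact_operator_separated_bound[OF assms(2), of "e / 2"] by (metis half_gt_zero)
    have "surjectivity_modulus T E \<le> ennreal e"
      if "k < n" and E: "closed_csubspace E" "quot_cdim_eq E n" for n E
      unfolding surjectivity_modulus_def
    proof (rule Sup_least, safe)
      fix \<alpha> :: real assume \<alpha>: "0 \<le> \<alpha>" "quot_ball E \<alpha> \<subseteq> (quot_map E \<circ> T) ` cball 0 1"
      have sub: "complex_vector.subspace E" using E by (simp add: closed_csubspace_def)
      show "ennreal \<alpha> \<le> ennreal e"
      proof (rule ccontr)
        assume "\<not> ennreal \<alpha> \<le> ennreal e"
        then have "e < \<alpha>" by (meson ennreal_leI not_le)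
        obtain y where y: "\<And>i. i < n \<Longrightarrow> norm (y i) \<le> 1"
            and sep: "\<And>i j z. i < j \<Longrightarrow> j < n \<Longrightarrow> z \<in> E \<Longrightarrow> 1 / 2 \<le> norm (y j - y i - z)"
        proof (rule riesz_separated[of E UNIV n])
          show "\<not> UNIV \<subseteq> complex_vector.span (E \<union> B)" if "finite B" "card B < n" for B
            using quot_cdim_eq_imp_le_card[OF sub E(2) that(1)] that(2) by auto
        qed (use E in auto)
        have "\<exists>x. norm x \<le> 1 \<and> \<alpha> *\<^sub>R y i - T x \<in> E" if "i < n" for i
        proof -
          have "quot_map E (\<alpha> *\<^sub>R y i) \<in> quot_ball E \<alpha>"
            unfolding quot_ball_def using quot_norm_le[OF sub, of "y i"] y[OF that] by force
          from subsetD[OF \<alpha>(2) this] obtain x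
            where "norm x \<le> 1" "quot_map E (\<alpha> *\<^sub>R y i) = quot_map E (T x)" by auto
          then show ?thesis by (auto simp: quot_map_eq_iff[OF sub])
        qed
        then obtain x where x: "\<And>i. i < n \<Longrightarrow> norm (x i) \<le> 1"
            "\<And>i. i < n \<Longrightarrow> \<alpha> *\<^sub>R y i - T (x i) \<in> E"
          by metis
        have "e / 2 \<le> norm (T (x j) - T (x i))" if "i < j" "j < n" for i j
        proof -
          define z where "z = (\<alpha> *\<^sub>R y j - T (x j)) - (\<alpha> *\<^sub>R y i - T (x i))"
          have "z \<in> E" unfolding z_def
            by (rule complex_vector.subspace_diff[OF sub x(2) x(2)]) (use that in auto)
          then have "inverse \<alpha> *\<^sub>R z \<in> E"
            unfolding scaleR_scaleC by (rule complex_vector.subspace_scale[OF sub])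
          from sep[OF that this] have "\<alpha> * (1 / 2) \<le> \<alpha> * norm (y j - y i - inverse \<alpha> *\<^sub>R z)"
            using \<alpha>(1) by (rule mult_left_mono)
          also have "\<dots> = norm (\<alpha> *\<^sub>R (y j - y i - inverse \<alpha> *\<^sub>R z))" using \<alpha>(1) by simp
          also have "\<alpha> *\<^sub>R (y j - y i - inverse \<alpha> *\<^sub>R z) = T (x j) - T (x i)"
            using \<open>0 < e\<close> \<open>e < \<alpha>\<close> by (simp add: z_def algebra_simps)
          finally show ?thesis using \<open>e < \<alpha>\<close> by simp
        qed
        from k[of n x, OF x(1) this] \<open>k < n\<close> show False by simp
      qed
    qed
    then show ?thesis by blast
  qed
  show ?thesis
    unfolding super_strictly_cosingular_def
  proof (rule order_tendstoI)
    \<comment> \<open>Since a may be infinite, a positive real threshold e below it is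
      chosen.\<close>
    fix a :: ennreal assume "0 < a"
    then obtain e where e: "0 < e" "ennreal e < a"
      by (metis dense ennreal_less_zero_iff ennreal_cases infinity_ennreal_def less_top linorder_not_less top_greatest)
    from main[OF e(1)] obtain k where k: "\<And>n E. k < n \<Longrightarrow> closed_csubspace E \<Longrightarrow>
        quot_cdim_eq E n \<Longrightarrow> surjectivity_modulus T E \<le> ennreal e" by blast
    show "\<forall>\<^sub>F n in sequentially.
        (SUP E\<in>{E. closed_csubspace E \<and> quot_cdim_eq E n}. surjectivity_modulus T E) < a"
      using eventually_gt_at_top[of k]
    proof eventually_elim
      case (elim n)
      have "(SUP E\<in>{E. closed_csubspace E \<and> quot_cdim_eq E n}. surjectivity_modulus T E) \<le> ennreal e"
        using k[OF elim] by (intro SUP_least) auto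
      also note e(2)
      finally show ?case .
    qed
  qed simp
qed

text \<open>An open mapping argument with a compact set: if \<open>T\<close> is onto modulo
  \<open>Z\<close>, the closed sets n K + Z cover the codomain, and by Baire one of them has
  interior. Hence the unit ball lies in c (K - K) + Z, so it is totally bounded modulo
  \<open>Z\<close>, against an arbitrarily long Riesz sequence in the infinite-dimensional
  quotient.\<close>

lemma compact_imp_strictly_cosingular:
  fixes T :: "'a::complex_normed_vector \<Rightarrow> 'b::complex_banach"
  assumes T: "bounded_clinear T" and "compact_operator T"
  shows "strictly_cosingular T"
  unfolding strictly_cosingular_def
proof (intro allI impI notI, elim conjE)
  fix Z :: "'b set"
  assume Z: "closed_csubspace Z" "\<nexists>n. quot_cdim_eq Z n" and surj: "range (quot_map Z \<circ> T) = quot_space Z"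
  have sub: "complex_vector.subspace Z" and "closed Z" using Z by (auto simp: closed_csubspace_def)
  define K where "K = closure (T ` cball 0 1)"
  have K: "compact K" using assms(2) by (simp add: compact_operator_def K_def)
  define C where "C n = (\<Union>y\<in>(\<lambda>y. real n *\<^sub>R y) ` K. \<Union>z\<in>Z. {y + z})" for n
  have cl: "closed (C n)" for n
    unfolding C_def by (intro compact_closed_sums compact_scaling K \<open>closed Z\<close>)
  have "y \<in> (\<Union>n. C n)" for y
  proof -
    have "quot_map Z y \<in> quot_space Z" by (simp add: quot_space_def)
    with surj have "quot_map Z y \<in> range (quot_map Z \<circ> T)" by simp
    then obtain x where x: "y - T x \<in> Z" by (auto simp: quot_map_eq_iff[OF sub])
    obtain n where n: "norm x < real n" using reals_Archimedean2 by blast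
    then have n0: "0 < real n" using norm_ge_zero[of x] by linarith
    have "T (inverse (real n) *\<^sub>R x) \<in> T ` cball 0 1"
      using n n0 by (intro imageI) (simp add: field_simps)
    then have "T (inverse (real n) *\<^sub>R x) \<in> K"
      unfolding K_def by (rule subsetD[OF closure_subset])
    moreover have "y = real n *\<^sub>R T (inverse (real n) *\<^sub>R x) + (y - T x)"
      using n0 by (simp add: bounded_clinearD[OF T])
    ultimately have "y \<in> C n" unfolding C_def using x by blast
    then show ?thesis by blast
  qed
  then have cover: "(\<Union>n. C n) = UNIV" by blast
  have "\<exists>n. interior (C n) \<noteq> {}"
  proof (rule ccontr)
    assume no: "\<not> (\<exists>n. interior (C n) \<noteq> {})"
    have "(euclidean :: 'b topology) interior_of \<Union>(range C) = {}"
    proof (rule Baire_category_alt)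
      show "completely_metrizable_space (euclidean :: 'b topology) \<or>
          locally_compact_space (euclidean :: 'b topology) \<and> regular_space (euclidean :: 'b topology)"
        by (simp add: completely_metrizable_space_euclidean)
      fix S assume "S \<in> range C"
      with cl no show "closedin euclidean S \<and> euclidean interior_of S = {}" by auto
    qed simp
    with cover show False by simp
  qed
  then obtain n y0 where "y0 \<in> interior (C n)" by blast
  then obtain r where r: "0 < r" "ball y0 r \<subseteq> C n" by (meson mem_interior)
  \<comment> \<open>Differences cancel the centre y0 of the ball found by Baire.\<close>
  define D where "D = {x - y | x y. x \<in> K \<and> y \<in> K}"
  have D: "compact D" unfolding D_def by (rule compact_differences[OF K K])
  \<comment> \<open>The factor comes from writing y as 2/r times the difference of the two points y0
    + (r/2) y and y0 of n K + Z.\<close>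
  define c where "c = 2 * real n / r"
  have rep: "\<exists>\<kappa>\<in>D. y - c *\<^sub>R \<kappa> \<in> Z" if "norm y \<le> 1" for y
  proof -
    have "y0 + (r / 2) *\<^sub>R y \<in> ball y0 r"
      using that r(1) mult_left_le[of "norm y" r] by (simp add: dist_norm)
    then have "y0 + (r / 2) *\<^sub>R y \<in> C n" "y0 \<in> C n" using r by auto
    then obtain \<kappa>1 \<kappa>2 z1 z2 where z: "\<kappa>1 \<in> K" "\<kappa>2 \<in> K" "z1 \<in> Z" "z2 \<in> Z"
        "y0 + (r / 2) *\<^sub>R y = real n *\<^sub>R \<kappa>1 + z1" "y0 = real n *\<^sub>R \<kappa>2 + z2"
      unfolding C_def by auto
    have "(2 / r) *\<^sub>R (z1 - z2) \<in> Z"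
      unfolding scaleR_scaleC
      by (intro complex_vector.subspace_scale[OF sub] complex_vector.subspace_diff[OF sub] z)
    moreover have "y - c *\<^sub>R (\<kappa>1 - \<kappa>2) = (2 / r) *\<^sub>R (z1 - z2)"
    proof -
      have "y = (2 / r) *\<^sub>R ((y0 + (r / 2) *\<^sub>R y) - y0)" using r(1) by simp
      also have "\<dots> = (2 / r) *\<^sub>R ((real n *\<^sub>R \<kappa>1 + z1) - (real n *\<^sub>R \<kappa>2 + z2))" using z(5,6) by simp
      also have "\<dots> = c *\<^sub>R (\<kappa>1 - \<kappa>2) + (2 / r) *\<^sub>R (z1 - z2)" by (simp add: c_def algebra_simps)
      finally show ?thesis by simp
    qed
    ultimately show ?thesis using z(1,2) unfolding D_def by (intro bexI[of _ "\<kappa>1 - \<kappa>2"]) auto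
  qed
  \<comment> \<open>Two members of \<open>D\<close> in a common ball are less than 2 e apart, and 2
    c e < 1/2 contradicts the Riesz separation; c + 1 also covers c = 0.\<close>
  define e where "e = 1 / (4 * (c + 1))"
  have c0: "0 \<le> c" using r by (simp add: c_def)
  then have e: "0 < e" by (simp add: e_def)
  then obtain k where k: "finite k" "D \<subseteq> (\<Union>x\<in>k. ball x e)"
    using D unfolding compact_eq_totally_bounded by blast
  define N where "N = Suc (card k)"
  obtain y where y: "\<And>i. i < N \<Longrightarrow> norm (y i) \<le> 1"
      and sep: "\<And>i j z. i < j \<Longrightarrow> j < N \<Longrightarrow> z \<in> Z \<Longrightarrow> 1 / 2 \<le> norm (y j - y i - z)"
  proof (rule riesz_separated[of Z UNIV N])
    show "\<not> UNIV \<subseteq> complex_vector.span (Z \<union> B)" if "finite B" "card B < N" for B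
      using infinite_quot_cdim_imp_span_neq_UNIV[OF sub Z(2) that(1)] by auto
  qed (use Z in auto)
  have "\<exists>\<kappa>. \<kappa> \<in> D \<and> y i - c *\<^sub>R \<kappa> \<in> Z" if "i < N" for i
    using rep[OF y[OF that]] by blast
  then obtain \<kappa> where \<kappa>: "\<And>i. i < N \<Longrightarrow> \<kappa> i \<in> D" "\<And>i. i < N \<Longrightarrow> y i - c *\<^sub>R \<kappa> i \<in> Z"
    by metis
  obtain i j where ij: "i < j" "j < N" "dist (\<kappa> i) (\<kappa> j) < 2 * e"
    using totally_bounded_pigeonhole[OF k, of N \<kappa>] \<kappa>(1) by (auto simp: N_def)
  have "(y j - c *\<^sub>R \<kappa> j) - (y i - c *\<^sub>R \<kappa> i) \<in> Z"
    by (rule complex_vector.subspace_diff[OF sub \<kappa>(2) \<kappa>(2)]) (use ij in auto)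
  from sep[OF ij(1,2) this] have "1 / 2 \<le> norm (c *\<^sub>R (\<kappa> j - \<kappa> i))"
    by (simp add: algebra_simps)
  also have "\<dots> = c * dist (\<kappa> i) (\<kappa> j)" using c0 by (simp add: dist_norm norm_minus_commute)
  also have "\<dots> \<le> c * (2 * e)" using ij(3) c0 by (intro mult_left_mono) auto
  also have "\<dots> < 1 / 2" using c0 by (simp add: e_def field_simps)
  finally show False by simp
qed

section \<open>The weak topology and weak compactness of compact operators\<close>

lemma topspace_weak_topology: "topspace weak_topology = (UNIV :: 'a::complex_normed_vector set)"
proof -
  have "bounded_clinear (\<lambda>x::'a. 0 :: complex)" by (rule bounded_clinearI[where K = 0]) auto
  then have "(\<lambda>x::'a. 0 :: complex) -` UNIV \<in>
      {\<phi> -` U | (\<phi> :: 'a \<Rightarrow> complex) U. bounded_clinear \<phi> \<and> open U}" by blast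
  then show ?thesis unfolding weak_topology_def topology_generated_by_topspace by auto
qed

lemma continuous_map_weak_functional:
  fixes \<phi> :: "'a::complex_normed_vector \<Rightarrow> complex"
  assumes "bounded_clinear \<phi>"
  shows "continuous_map weak_topology euclidean \<phi>"
proof -
  have "openin weak_topology (\<phi> -` U)" if "open U" for U
    unfolding weak_topology_def
    by (rule topology_generated_by_Basis, rule CollectI, rule exI[of _ \<phi>], rule exI[of _ U])
      (simp add: assms that)
  then show ?thesis
    by (auto simp: continuous_map_def topspace_weak_topology vimage_def)
qed

lemma weak_topology_coarser:
  fixes U :: "'a::complex_normed_vector set"
  assumes "openin weak_topology U"
  shows "open U"
proof -
  have "continuous_map euclidean weak_topology (id :: 'a \<Rightarrow> 'a)"
    unfolding weak_topology_def
  proof (rule continuous_on_generated_topo)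
    fix V assume "V \<in> {\<phi> -` U | (\<phi> :: 'a \<Rightarrow> complex) U. bounded_clinear \<phi> \<and> open U}"
    then obtain \<phi> :: "'a \<Rightarrow> complex" and U where "V = \<phi> -` U" "bounded_clinear \<phi>" "open U" by blast
    then show "openin euclidean (id -` V \<inter> topspace euclidean)"
      by (auto simp: bounded_clinear_def intro!: open_vimage
          intro: bounded_linear.continuous_on continuous_on_id)
  qed (use topspace_weak_topology in \<open>auto simp: weak_topology_def topology_generated_by_topspace\<close>)
  with assms show ?thesis
    using openin_continuous_map_preimage[of euclidean weak_topology id U] by simp
qed

text \<open>The norm closure of the image is compact also in the coarser weak topology. Separating
  functionals make that topology Hausdorff, so this set is weakly closed and contains the weak
  closure. On a free space the separating functionals are supplied by Lipschitz functions.\<close>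

lemma compact_imp_weakly_compact:
  fixes T :: "'a::complex_normed_vector \<Rightarrow> 'b::complex_normed_vector"
  assumes "compact_operator T"
    and separating: "\<And>u v :: 'b. u \<noteq> v \<Longrightarrow> \<exists>\<phi> :: 'b \<Rightarrow> complex. bounded_clinear \<phi> \<and> \<phi> u \<noteq> \<phi> v"
  shows "weakly_compact_operator T"
proof -
  define K where "K = closure (T ` cball 0 1)"
  have "compactin euclidean K" using assms(1) by (simp add: compact_operator_def K_def)
  moreover have "continuous_map euclidean weak_topology (id :: 'b \<Rightarrow> 'b)"
    using weak_topology_coarser by (auto simp: continuous_map_def topspace_weak_topology)
  ultimately have K: "compactin weak_topology K"
    using image_compactin by fastforce
  have "Hausdorff_space (weak_topology :: 'b topology)"
    unfolding Hausdorff_space_def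
  proof (intro allI impI, elim conjE)
    fix u v :: 'b assume "u \<noteq> v"
    with separating obtain \<phi> :: "'b \<Rightarrow> complex" where \<phi>: "bounded_clinear \<phi>" "\<phi> u \<noteq> \<phi> v" by blast
    then obtain U V where "open U" "open V" "\<phi> u \<in> U" "\<phi> v \<in> V" "U \<inter> V = {}" by (metis hausdorff)
    then show "\<exists>U V. openin weak_topology U \<and> openin weak_topology V \<and> u \<in> U \<and> v \<in> V \<and> disjnt U V"
      using openin_continuous_map_preimage[OF continuous_map_weak_functional[OF \<phi>(1)], of U]
        openin_continuous_map_preimage[OF continuous_map_weak_functional[OF \<phi>(1)], of V]
      by (intro exI[of _ "\<phi> -` U"] exI[of _ "\<phi> -` V"])
        (auto simp: topspace_weak_topology vimage_def disjnt_iff)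
  qed
  then have "closedin weak_topology K" using K by (rule compactin_imp_closedin)
  then have "weak_topology closure_of (T ` cball 0 1) \<subseteq> K"
    by (intro closure_of_minimal) (auto simp: K_def intro: closure_subset[THEN subsetD])
  then show ?thesis
    unfolding weakly_compact_operator_def
    by (rule closed_compactin[OF K]) (rule closedin_closure_of)
qed

section \<open>Biorthogonal systems spanning a complemented copy of \<open>\<ell>\<^sup>1\<close>\<close>

text \<open>The composition of \<open>J\<close> after \<open>S\<close> is a bounded projection onto
  the range of \<open>J\<close>, which is its set of fixed points and hence closed.\<close>

lemma retract_of_bounded_clinear:
  fixes J :: "'a::complex_normed_vector \<Rightarrow> 'b::complex_normed_vector"
  assumes J: "bounded_clinear J" and S: "bounded_clinear S" and SJ: "\<And>a. S (J a) = a"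
  shows "closed_csubspace (range J)" "complemented (range J)" "cisomorphism_on (range J) UNIV S"
proof -
  have cont: "continuous_on A J" "continuous_on B S" for A B
    using bounded_clinearD(1)[OF J] bounded_clinearD(1)[OF S]
    by (auto intro: linear_continuous_on)
  have range_eq: "range J = {x. J (S x) = x}"
    using SJ by (auto, metis rangeI)
  have "complex_vector.subspace (range J)"
    unfolding range_eq
    by (rule complex_vector.subspaceI) (simp_all add: bounded_clinearD[OF J] bounded_clinearD[OF S])
  moreover have "closed {x. J (S x) = x}"
    by (intro closed_Collect_eq continuous_on_id continuous_on_compose2[OF cont(1) cont(2), of UNIV UNIV])
      simp
  ultimately show "closed_csubspace (range J)"
    by (simp add: closed_csubspace_def flip: range_eq)
  show "complemented (range J)"
    unfolding complemented_def
  proof (intro exI conjI)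
    show "bounded_clinear (\<lambda>x. J (S x))" by (rule bounded_clinear_compose[OF J S])
    show "range (\<lambda>x. J (S x)) = range J" using SJ by (auto, metis rangeI)
  qed (simp add: fun_eq_iff SJ)
  show "cisomorphism_on (range J) UNIV S"
    unfolding cisomorphism_on_def homeomorphism_def
  proof (intro conjI ballI allI exI[of _ J] cont)
    show "S ` range J = UNIV" by (simp add: image_image SJ)
  qed (auto simp: bounded_clinearD[OF S] SJ)
qed

text \<open>The conditions let the identity of \<open>ell1\<close> factor through \<open>T\<close>:
  coefficients are sent to \<Sum> a_k x_k (bounded by \<open>D\<close>), then to the codomain by
  \<open>T\<close>, and are read off there by the \<phi>_k (bounded by \<open>C\<close>).\<close>

locale l1_biorthogonal =
  fixes T :: "'a::complex_banach \<Rightarrow> 'b::complex_banach"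
    and x :: "nat \<Rightarrow> 'a" and \<phi> :: "nat \<Rightarrow> 'b \<Rightarrow> complex" and C D :: real
  assumes T: "bounded_clinear T"
    and \<phi>: "bounded_clinear (\<phi> k)"
    and x_le: "norm (x k) \<le> D"
    and summable_\<phi>: "summable (\<lambda>k. norm (\<phi> k y))"
    and suminf_\<phi>_le: "(\<Sum>k. norm (\<phi> k y)) \<le> C * norm y"
    and biorthogonal: "\<phi> k (T (x j)) = (if k = j then 1 else 0)"
begin

lemma D_pos: "0 < D"
proof -
  have "x 0 \<noteq> 0" using biorthogonal[of 0 0] by (auto simp: bounded_clinearD[OF T] bounded_clinearD[OF \<phi>])
  then show ?thesis using x_le[of 0] by (meson less_le_trans zero_less_norm_iff)
qed

lemma C_pos: "0 < C"
proof -
  have "0 < (\<Sum>k. norm (\<phi> k (T (x 0))))"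
    using summable_\<phi> by (rule suminf_pos2[of _ 0]) (simp_all add: biorthogonal)
  also have "\<dots> \<le> C * norm (T (x 0))" by (rule suminf_\<phi>_le)
  finally show ?thesis using norm_ge_zero[of "T (x 0)"] by (simp add: zero_less_mult_iff)
qed

definition synthesis :: "ell1 \<Rightarrow> 'a" where "synthesis a = (\<Sum>k. ell1_nth a k *\<^sub>C x k)"

definition analysis :: "'b \<Rightarrow> ell1" where "analysis y = Abs_ell1 (\<lambda>k. \<phi> k y)"

lemma ell1_nth_analysis: "ell1_nth (analysis y) k = \<phi> k y"
  using summable_\<phi> by (simp add: analysis_def Abs_ell1_inverse)

lemma norm_term_le: "norm (ell1_nth a k *\<^sub>C x k) \<le> norm (ell1_nth a k) * D"
  using x_le by (simp add: norm_scaleC mult_left_mono)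

lemma summable_ell1: "summable (\<lambda>k. norm (ell1_nth a k))"
  using ell1_nth[of a] by simp

lemma summable_norm_terms: "summable (\<lambda>k. norm (ell1_nth a k *\<^sub>C x k))"
  by (rule summable_comparison_test'[where N = 0, OF summable_mult2[OF summable_ell1[of a], of D]])
    (simp add: norm_term_le)

lemmas summable_terms = summable_norm_cancel[OF summable_norm_terms]

lemma bounded_clinear_synthesis: "bounded_clinear synthesis"
proof (rule bounded_clinearI)
  fix a b c
  show "synthesis (a + b) = synthesis a + synthesis b"
    unfolding synthesis_def suminf_add[OF summable_terms summable_terms]
    by (simp add: plus_ell1.rep_eq scaleC_add_left)
  show "synthesis (c *\<^sub>C a) = c *\<^sub>C synthesis a"
    unfolding synthesis_def bounded_linear.suminf[OF bounded_linear_scaleC summable_terms]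
    by (simp add: scaleC_ell1.rep_eq scaleC_scaleC)
  have "norm (synthesis a) \<le> (\<Sum>k. norm (ell1_nth a k *\<^sub>C x k))"
    unfolding synthesis_def by (rule summable_norm[OF summable_norm_terms])
  also have "\<dots> \<le> (\<Sum>k. norm (ell1_nth a k) * D)"
    by (intro suminf_le norm_term_le summable_norm_terms summable_mult2 summable_ell1)
  also have "\<dots> = norm a * D"
    by (simp add: suminf_mult2[OF summable_ell1, symmetric] norm_ell1.rep_eq)
  also have "\<dots> = D * norm a" by (rule mult.commute)
  finally show "norm (synthesis a) \<le> D * norm a" .
qed

lemma bounded_clinear_analysis: "bounded_clinear analysis"
proof (rule bounded_clinearI)
  fix u v c
  show "analysis (u + v) = analysis u + analysis v"
    by (simp add: ell1_nth_inject[symmetric] fun_eq_iff ell1_nth_analysis plus_ell1.rep_eq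
        bounded_clinearD[OF \<phi>])
  show "analysis (c *\<^sub>C u) = c *\<^sub>C analysis u"
    by (simp add: ell1_nth_inject[symmetric] fun_eq_iff ell1_nth_analysis scaleC_ell1.rep_eq
        bounded_clinearD[OF \<phi>] scaleC_complex_def)
  show "norm (analysis u) \<le> C * norm u"
    by (simp add: norm_ell1.rep_eq ell1_nth_analysis suminf_\<phi>_le)
qed

lemma analysis_synthesis: "analysis (T (synthesis a)) = a"
proof -
  have "\<phi> k (T (synthesis a)) = ell1_nth a k" for k
  proof -
    have "\<phi> k (T (synthesis a)) = (\<Sum>j. \<phi> k (T (ell1_nth a j *\<^sub>C x j)))"
      unfolding synthesis_def
      by (rule bounded_linear.suminf[OF _ summable_terms])
        (rule bounded_clinearD(1)[OF bounded_clinear_compose[OF \<phi> T]])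
    also have "\<dots> = (\<Sum>j. if j = k then ell1_nth a j else 0)"
      by (intro suminf_cong)
        (auto simp: bounded_clinearD[OF T] bounded_clinearD[OF \<phi>] scaleC_complex_def biorthogonal)
    also have "\<dots> = ell1_nth a k"
      using suminf_finite[of "{k}" "\<lambda>j. if j = k then ell1_nth a j else 0"] by simp
    finally show ?thesis .
  qed
  then show ?thesis
    by (simp add: ell1_nth_inject[symmetric] fun_eq_iff ell1_nth_analysis)
qed

lemma synthesis_unit: "synthesis (ell1_unit k) = x k"
proof -
  have "synthesis (ell1_unit k) = (\<Sum>j. if j = k then x j else 0)"
    unfolding synthesis_def
    by (intro suminf_cong) (simp add: ell1_unit.rep_eq scaleC_one)
  also have "\<dots> = x k"
    using suminf_finite[of "{k}" "\<lambda>j. if j = k then x j else 0"] by simp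
  finally show ?thesis .
qed

lemma cisomorphism_on_range_synthesis:
  "cisomorphism_on (range synthesis) (range (\<lambda>a. T (synthesis a))) T"
  unfolding cisomorphism_on_def homeomorphism_def
proof (intro conjI ballI allI exI[of _ "\<lambda>y. synthesis (analysis y)"])
  show "continuous_on (range synthesis) T"
    by (rule linear_continuous_on[OF bounded_clinearD(1)[OF T]])
  show "continuous_on (range (\<lambda>a. T (synthesis a))) (\<lambda>y. synthesis (analysis y))"
    by (intro linear_continuous_on bounded_clinearD(1) bounded_clinear_compose[OF bounded_clinear_synthesis]
        bounded_clinear_analysis)
qed (auto simp: bounded_clinearD[OF T] analysis_synthesis image_image)

text \<open>The factorisation of the identity of \<open>ell1\<close> is cut at two places:
  \<open>synthesis\<close> has the left inverse \<open>analysis\<close> after \<open>T\<close>, and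
  \<open>T\<close> after \<open>synthesis\<close> has the left inverse \<open>analysis\<close>. Both
  ranges are therefore complemented copies of \<open>ell1\<close>.\<close>

lemma fixes_complemented_copy: "fixes_complemented_copy_of_ell1 T"
  unfolding fixes_complemented_copy_of_ell1_def isomorphic_to_ell1_def
proof (intro exI conjI)
  note X = retract_of_bounded_clinear[OF bounded_clinear_synthesis
      bounded_clinear_compose[OF bounded_clinear_analysis T] analysis_synthesis]
  note Y = retract_of_bounded_clinear[OF bounded_clinear_compose[OF T bounded_clinear_synthesis]
      bounded_clinear_analysis analysis_synthesis]
  show "closed_csubspace (range synthesis)" "complemented (range synthesis)"
    "cisomorphism_on (range synthesis) UNIV (\<lambda>x. analysis (T x))" by (fact X)+
  show "closed_csubspace (range (\<lambda>a. T (synthesis a)))" "complemented (range (\<lambda>a. T (synthesis a)))"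
    "cisomorphism_on (range (\<lambda>a. T (synthesis a))) UNIV analysis" by (fact Y)+
qed (rule cisomorphism_on_range_synthesis)

lemma not_strictly_singular: "\<not> strictly_singular T"
proof -
  have "\<not> finite_cdim (range synthesis)"
  proof
    assume "finite_cdim (range synthesis)"
    then obtain B where B: "finite B" "complex_vector.span B = range synthesis"
      unfolding finite_cdim_def by blast
    have "Suc (card B) \<le> card B"
    proof (rule biorthogonal_le_card[OF _ _ B(1)])
      show "bounded_clinear (\<lambda>v. \<phi> k (T v))" for k by (rule bounded_clinear_compose[OF \<phi> T])
      show "x j \<in> complex_vector.span B" for j
        unfolding B(2) using synthesis_unit[of j, symmetric] by (rule range_eqI)
    qed (rule biorthogonal)
    then show False by simp
  qed
  moreover have "closed_csubspace (range synthesis)"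
    by (rule retract_of_bounded_clinear[OF bounded_clinear_synthesis
      bounded_clinear_compose[OF bounded_clinear_analysis T] analysis_synthesis])
  moreover have "cisomorphism_on (range synthesis) (T ` range synthesis) T"
    using cisomorphism_on_range_synthesis by (simp add: image_image)
  ultimately show ?thesis unfolding strictly_singular_def by blast
qed

text \<open>\<open>Z\<close> is the kernel of \<open>analysis\<close>. Every y is congruent modulo
  \<open>Z\<close> to the image of \<open>synthesis (analysis y)\<close>, so \<open>T\<close> is
  onto the quotient. The quotient is infinite-dimensional since the \<phi>_k vanish on
  \<open>Z\<close> and remain biorthogonal to any representatives of the T x_j.\<close>

lemma not_strictly_cosingular: "\<not> strictly_cosingular T"
proof -
  define Z where "Z = {y. analysis y = 0}"
  have "complex_vector.subspace Z"
    unfolding Z_def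
    by (rule complex_vector.subspaceI) (simp_all add: bounded_clinearD[OF bounded_clinear_analysis])
  moreover have "closed Z"
    unfolding Z_def
    by (rule closed_Collect_eq[OF linear_continuous_on[OF bounded_clinearD(1)] continuous_on_const])
      (rule bounded_clinear_analysis)
  ultimately have Z: "complex_vector.subspace Z" "closed_csubspace Z"
    by (simp_all add: closed_csubspace_def)
  have \<phi>0: "\<phi> k z = 0" if "z \<in> Z" for k z
    using that ell1_nth_analysis[of z k] by (simp add: Z_def zero_ell1.rep_eq)
  have "\<not> quot_cdim_eq Z n" for n
  proof
    assume "quot_cdim_eq Z n"
    then obtain B where B: "finite B" "complex_vector.span (Z \<union> B) = UNIV"
      unfolding quot_cdim_eq_altdef[OF Z(1)] by blast
    have "\<exists>s. s \<in> complex_vector.span B \<and> T (x j) - s \<in> Z" for j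
    proof -
      have "T (x j) \<in> complex_vector.span (Z \<union> B)" using B by simp
      then obtain z s where "T (x j) = z + s" "z \<in> Z" "s \<in> complex_vector.span B"
        unfolding complex_vector.span_Un complex_vector.span_eq_iff[THEN iffD2, OF Z(1)] by blast
      then show ?thesis by auto
    qed
    then obtain s where s: "\<And>j. s j \<in> complex_vector.span B" "\<And>j. T (x j) - s j \<in> Z" by metis
    have "Suc (card B) \<le> card B"
    proof (rule biorthogonal_le_card[OF \<phi> _ B(1) s(1)])
      show "\<phi> k (s j) = (if k = j then 1 else 0)" for k j
        using \<phi>0[OF s(2), of k j] by (simp add: bounded_clinearD[OF \<phi>] biorthogonal)
    qed
    then show False by simp
  qed
  moreover have "range (quot_map Z \<circ> T) = quot_space Z"
  proof
    show "quot_space Z \<subseteq> range (quot_map Z \<circ> T)"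
    proof
      fix K assume "K \<in> quot_space Z"
      then obtain y where "K = quot_map Z y" by (auto simp: quot_space_def)
      moreover have "y - T (synthesis (analysis y)) \<in> Z"
        by (simp add: Z_def bounded_clinearD[OF bounded_clinear_analysis] analysis_synthesis)
      ultimately have "K = (quot_map Z \<circ> T) (synthesis (analysis y))"
        by (simp add: quot_map_eq_iff[OF Z(1)])
      then show "K \<in> range (quot_map Z \<circ> T)" by blast
    qed
  qed (auto simp: quot_space_def)
  ultimately show ?thesis
    unfolding strictly_cosingular_def using Z(2) by blast
qed

text \<open>For every n the common kernel of the first n functionals has codimension n, and the
  finite sums of \<phi>_j(y) x_j lift its cosets with a bound independent of n.\<close>

lemma not_super_strictly_cosingular: "\<not> super_strictly_cosingular T"
proof
  assume sscs: "super_strictly_cosingular T"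
  \<comment> \<open>A coset of quotient norm at most 1 has a representative of norm below 2, whose
    lift has norm at most 2 C D.\<close>
  define \<alpha> where "\<alpha> = 1 / (2 * C * D)"
  have \<alpha>: "0 < \<alpha>" using C_pos D_pos by (simp add: \<alpha>_def)
  have lower: "ennreal \<alpha> \<le> (SUP E\<in>{E. closed_csubspace E \<and> quot_cdim_eq E n}. surjectivity_modulus T E)" for n
  proof -
    define Z where "Z = {y. \<forall>k<n. \<phi> k y = 0}"
    have sub: "complex_vector.subspace Z"
      unfolding Z_def by (rule complex_vector.subspaceI) (simp_all add: bounded_clinearD[OF \<phi>])
    have "Z = (\<Inter>k\<in>{..<n}. {y. \<phi> k y = 0})" by (auto simp: Z_def)
    moreover have "closed {y. \<phi> k y = 0}" for k
      by (rule closed_Collect_eq[OF linear_continuous_on[OF bounded_clinearD(1)] continuous_on_const])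
        (rule \<phi>)
    ultimately have Z: "closed_csubspace Z"
      using sub by (auto simp: closed_csubspace_def)
    have coord: "\<phi> k (\<Sum>j<n. c j *\<^sub>C T (x j)) = c k" if "k < n" for k c
      using that
      by (simp add: bounded_clinearD[OF \<phi>] scaleC_complex_def biorthogonal if_distrib cong: if_cong)
    have inj: "inj_on (\<lambda>j. T (x j)) {..<n}"
      using biorthogonal by (intro inj_onI) (metis zero_neq_one)
    have proj: "y - (\<Sum>j<n. \<phi> j y *\<^sub>C T (x j)) \<in> Z" for y
      using coord[of _ "\<lambda>j. \<phi> j y"] by (simp only: Z_def mem_Collect_eq bounded_clinearD(4)[OF \<phi>]) simp
    have "quot_cdim_eq Z n"
      unfolding quot_cdim_eq_altdef[OF sub]
    proof (intro exI[of _ "(\<lambda>j. T (x j)) ` {..<n}"] conjI allI impI)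
      show "card ((\<lambda>j. T (x j)) ` {..<n}) = n" by (simp add: card_image inj)
      fix c assume "(\<Sum>b\<in>(\<lambda>j. T (x j)) ` {..<n}. c b *\<^sub>C b) \<in> Z"
      then have "(\<Sum>j<n. c (T (x j)) *\<^sub>C T (x j)) \<in> Z" by (simp add: sum.reindex[OF inj])
      then have "c (T (x k)) = 0" if "k < n" for k
        using coord[OF that, of "\<lambda>j. c (T (x j))"] that by (simp add: Z_def)
      then show "\<forall>b\<in>(\<lambda>j. T (x j)) ` {..<n}. c b = 0" by blast
    next
      have "y \<in> complex_vector.span (Z \<union> (\<lambda>j. T (x j)) ` {..<n})" for y
      proof -
        have "(y - (\<Sum>j<n. \<phi> j y *\<^sub>C T (x j))) + (\<Sum>j<n. \<phi> j y *\<^sub>C T (x j))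
            \<in> complex_vector.span (Z \<union> (\<lambda>j. T (x j)) ` {..<n})"
          using proj by (intro complex_vector.span_add complex_vector.span_sum
              complex_vector.span_scale complex_vector.span_base) auto
        then show ?thesis by simp
      qed
      then show "complex_vector.span (Z \<union> (\<lambda>j. T (x j)) ` {..<n}) = UNIV" by blast
    qed simp
    moreover have "quot_ball Z \<alpha> \<subseteq> (quot_map Z \<circ> T) ` cball 0 1"
    proof
      fix K assume "K \<in> quot_ball Z \<alpha>"
      then obtain y where y: "K = quot_map Z (\<alpha> *\<^sub>R y)" "quot_norm (quot_map Z y) \<le> 1"
        by (auto simp: quot_ball_def)
      have "quot_map Z y \<noteq> {}"
        using complex_vector.subspace_0[OF sub] by (auto simp: quot_map_def)
      moreover have "(INF y'\<in>quot_map Z y. norm y') < 2"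
        using y(2) by (simp add: quot_norm_def)
      ultimately obtain y' where "y' \<in> quot_map Z y" "norm y' < 2"
        using cInf_lessD[of "norm ` quot_map Z y" 2] by auto
      then obtain z where z: "z \<in> Z" "norm (y + z) < 2" by (auto simp: quot_map_def)
      define v where "v = (\<Sum>j<n. \<phi> j (y + z) *\<^sub>C x j)"
      have "norm v \<le> (\<Sum>j<n. norm (\<phi> j (y + z)) * D)"
        unfolding v_def using x_le by (intro sum_norm_le) (simp add: norm_scaleC mult_left_mono)
      also have "\<dots> = (\<Sum>j<n. norm (\<phi> j (y + z))) * D" by (simp add: sum_distrib_right)
      also have "\<dots> \<le> (C * norm (y + z)) * D"
        using D_pos suminf_\<phi>_le[of "y + z"]
        by (intro mult_right_mono order_trans[OF sum_le_suminf[OF summable_\<phi>]]) auto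
      also have "\<dots> \<le> C * 2 * D" using C_pos D_pos z(2) by (intro mult_right_mono mult_left_mono) auto
      finally have "norm (\<alpha> *\<^sub>R v) \<le> 1" using C_pos D_pos by (simp add: \<alpha>_def field_simps)
      moreover have "\<alpha> *\<^sub>R y - T (\<alpha> *\<^sub>R v) \<in> Z"
      proof -
        have "T v = (\<Sum>j<n. \<phi> j (y + z) *\<^sub>C T (x j))"
          by (simp add: v_def bounded_clinearD[OF T])
        with complex_vector.subspace_diff[OF sub proj[of "y + z"] z(1)]
        have "(y + z - T v) - z \<in> Z" by simp
        then have "complex_of_real \<alpha> *\<^sub>C (y - T v) \<in> Z"
          by (intro complex_vector.subspace_scale[OF sub]) (simp add: algebra_simps)
        then show ?thesis
          by (simp add: bounded_clinearD[OF T] scaleR_diff_right flip: scaleR_scaleC)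
      qed
      then have "K = (quot_map Z \<circ> T) (\<alpha> *\<^sub>R v)" by (simp add: y(1) quot_map_eq_iff[OF sub])
      ultimately show "K \<in> (quot_map Z \<circ> T) ` cball 0 1"
        by (metis image_eqI mem_cball_0)
    qed
    then have "ennreal \<alpha> \<le> surjectivity_modulus T Z"
      unfolding surjectivity_modulus_def using \<alpha> by (intro Sup_upper) auto
    ultimately show ?thesis
      using Z by (intro SUP_upper2[of Z]) auto
  qed
  have "ennreal \<alpha> \<le> 0"
    using sscs unfolding super_strictly_cosingular_def
    by (rule tendsto_lowerbound) (auto intro: always_eventually lower)
  with \<alpha> show False by simp
qed

text \<open>A weak cluster point of the vectors \<open>T (x n)\<close> would be annihilated by every \<open>\<phi> k\<close>, whereas
  the functional \<open>\<Sum>k. \<phi> k\<close> takes the value 1 on all of them.\<close>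

lemma not_weakly_compact: "\<not> weakly_compact_operator T"
proof
  assume wc: "weakly_compact_operator T"
  define K where "K = weak_topology closure_of (T ` cball 0 1)"
  define s where "s y = (\<Sum>k. \<phi> k y)" for y
  have sum: "summable (\<lambda>k. \<phi> k y)" for y by (rule summable_norm_cancel[OF summable_\<phi>])
  have s: "bounded_clinear s"
  proof (rule bounded_clinearI)
    show "s (u + v) = s u + s v" for u v
      unfolding s_def suminf_add[OF sum sum] by (simp add: bounded_clinearD[OF \<phi>])
    show "s (c *\<^sub>C u) = c *\<^sub>C s u" for c u
      unfolding s_def by (simp add: bounded_clinearD[OF \<phi>] scaleC_complex_def suminf_mult sum)
    show "norm (s u) \<le> C * norm u" for u
      unfolding s_def using summable_norm[OF summable_\<phi>] suminf_\<phi>_le by (rule order_trans)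
  qed
  \<comment> \<open>Division by \<open>D\<close> brings the vectors into the unit ball.\<close>
  define z where "z n = T (inverse D *\<^sub>R x n)" for n
  have zK: "z n \<in> K" for n
  proof -
    have "z n \<in> T ` cball 0 1"
      unfolding z_def using x_le[of n] D_pos by (intro imageI) (simp add: field_simps)
    then show ?thesis
      unfolding K_def using closure_of_subset[of "T ` cball 0 1" weak_topology]
      by (auto simp: topspace_weak_topology)
  qed
  have \<phi>z: "\<phi> k (z n) = (if k = n then of_real (inverse D) else 0)" for k n
    by (simp add: z_def bounded_clinearD[OF T] bounded_clinearD[OF \<phi>] biorthogonal scaleR_conv_of_real)
  have sz: "s (z n) = of_real (inverse D)" for n
    unfolding s_def \<phi>z
    using suminf_finite[of "{n}" "\<lambda>k. if k = n then complex_of_real (inverse D) else 0"] by simp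
  \<comment> \<open>These sets cover the space: if every \<phi>_k vanishes at y, so does their sum
    s, and y lies in \<open>V\<close>. But \<open>U k\<close> contains z k as the only member of the
    sequence and \<open>V\<close> contains none, so no finite subfamily covers
    \<open>K\<close>.\<close>
  define U where "U k = {y. \<phi> k y \<noteq> 0}" for k
  define V where "V = {y. norm (s y) < inverse D}"
  have preimage: "openin weak_topology (\<psi> -` A)" if "bounded_clinear \<psi>" "open A"
    for \<psi> :: "'b \<Rightarrow> complex" and A
    using openin_continuous_map_preimage[OF continuous_map_weak_functional[OF that(1)], of A] that(2)
    by (simp add: topspace_weak_topology vimage_def)
  have "openin weak_topology (U k)" for k
    using preimage[OF \<phi>, of "- {0}" k] by (simp add: U_def vimage_def open_Compl)
  moreover have "openin weak_topology V"
    using preimage[OF s, of "ball 0 (inverse D)"] by (simp add: V_def vimage_def)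
  moreover have "K \<subseteq> \<Union>(insert V (range U))"
  proof
    fix y
    show "y \<in> \<Union>(insert V (range U))"
    proof (cases "\<exists>k. \<phi> k y \<noteq> 0")
      case False
      then show ?thesis using D_pos by (simp add: V_def s_def)
    qed (auto simp: U_def)
  qed
  moreover have "compactin weak_topology K" using wc by (simp add: weakly_compact_operator_def K_def)
  ultimately have "\<exists>\<F>. finite \<F> \<and> \<F> \<subseteq> insert V (range U) \<and> K \<subseteq> \<Union>\<F>"
    by (intro compactinD) auto
  then obtain \<F> where \<F>: "finite \<F>" "\<F> \<subseteq> insert V (range U)" "K \<subseteq> \<Union>\<F>" by blast
  then have "finite (\<F> - {V})" "\<F> - {V} \<subseteq> range U" by auto
  then obtain I where I: "finite I" "\<F> - {V} = U ` I" by (meson finite_subset_image)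
  obtain n where n: "n \<notin> I" using I(1) ex_new_if_finite[OF infinite_UNIV_nat] by blast
  have "z n \<notin> V" using sz[of n] D_pos by (simp add: V_def norm_inverse)
  moreover have "z n \<notin> U k" if "k \<in> I" for k using n that by (auto simp: U_def \<phi>z)
  ultimately have "z n \<notin> \<Union>\<F>" using I(2) by blast
  with zK \<F>(3) show False by blast
qed

end

section \<open>Lipschitz-free spaces and Lipschitz functions\<close>

definition lip_pairing :: "'m::pointed_metric_space lip0 \<Rightarrow> 'm lipschitz_free \<Rightarrow> complex"
  where "lip_pairing g u = cdual_apply (cdual_of_lipschitz_free u) g"

lemma lip_pairing_delta: "lip_pairing g (lip_delta x) = lip0_apply g x"
  by (simp add: lip_pairing_def lip_delta.rep_eq cdual_apply_lip0_evaluation)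

lemma norm_lip_pairing_le: "norm (lip_pairing g u) \<le> norm g * norm u"
  unfolding lip_pairing_def norm_lipschitz_free.rep_eq norm_cdual.rep_eq cdual_apply.rep_eq
  by (subst mult.commute) (rule norm_blinfun)

lemma bounded_clinear_lip_pairing: "bounded_clinear (lip_pairing g)"
proof (rule bounded_clinearI)
  show "lip_pairing g (u + v) = lip_pairing g u + lip_pairing g v" for u v
    by (simp add: lip_pairing_def plus_lipschitz_free.rep_eq cdual_apply.rep_eq plus_cdual.rep_eq
        blinfun.add_left)
  show "lip_pairing g (c *\<^sub>C u) = c *\<^sub>C lip_pairing g u" for c u
    by (simp add: lip_pairing_def scaleC_lipschitz_free.rep_eq cdual_apply.rep_eq scaleC_cdual.rep_eq
        blinfun_mult_right.rep_eq scaleC_complex_def)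
qed (rule norm_lip_pairing_le)

lemma lip_pairing_diff_left: "lip_pairing (g - h) u = lip_pairing g u - lip_pairing h u"
  by (simp add: lip_pairing_def cdual_apply.rep_eq blinfun.diff_right)

lemma lip_pairing_scaleR_left: "lip_pairing (r *\<^sub>R g) u = r *\<^sub>R lip_pairing g u"
  by (simp add: lip_pairing_def cdual_apply.rep_eq blinfun.scaleR_right)

text \<open>The free space carries the norm of the dual of \<open>lip0\<close>, so its norm is
  tested on Lipschitz functions by definition.\<close>

lemma norm_lipschitz_free_le:
  assumes "\<And>g. norm g \<le> 1 \<Longrightarrow> norm (lip_pairing g u) \<le> c" "0 \<le> c"
  shows "norm u \<le> c"
  unfolding norm_lipschitz_free.rep_eq norm_cdual.rep_eq
proof (rule norm_blinfun_bound)
  fix g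
  show "norm (blinfun_of_cdual (cdual_of_lipschitz_free u) g) \<le> c * norm g"
  proof (cases "g = 0")
    case False
    have "norm (lip_pairing (inverse (norm g) *\<^sub>R g) u) \<le> c"
      using False by (intro assms) simp
    then have "norm (lip_pairing g u) \<le> c * norm g"
      using False by (simp add: lip_pairing_scaleR_left divide_le_eq flip: divide_inverse_commute)
    then show ?thesis by (simp add: lip_pairing_def cdual_apply.rep_eq)
  qed (simp add: blinfun.zero_right)
qed fact

lemma norm_lip0_apply_diff_le: "norm (lip0_apply g x - lip0_apply g y) \<le> norm g * dist x y"
  by transfer (auto intro: lip_norm_bound)

lemma lip0_of_lipschitz_on:
  fixes g :: "'m::pointed_metric_space \<Rightarrow> complex"
  assumes "L-lipschitz_on UNIV g" "g basepoint = 0"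
  obtains h where "lip0_apply h = g" "norm h \<le> L"
proof
  show h: "lip0_apply (Abs_lip0 g) = g" using assms by (intro Abs_lip0_inverse) auto
  show "norm (Abs_lip0 g) \<le> L"
    unfolding norm_lip0.rep_eq h
    using assms(1) by (intro lip_norm_le) (auto simp: lipschitz_on_def dist_norm)
qed

lemma dist_lip_delta_le: "norm (lip_delta x - lip_delta y) \<le> dist x y"
proof (rule norm_lipschitz_free_le)
  fix g :: "'a lip0" assume "norm g \<le> 1"
  have "norm (lip_pairing g (lip_delta x - lip_delta y)) \<le> norm g * dist x y"
    by (simp add: bounded_clinearD[OF bounded_clinear_lip_pairing] lip_pairing_delta norm_lip0_apply_diff_le)
  also have "\<dots> \<le> 1 * dist x y" using \<open>norm g \<le> 1\<close> by (rule mult_right_mono) simp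
  finally show "norm (lip_pairing g (lip_delta x - lip_delta y)) \<le> dist x y" by simp
qed simp

lemma lip_pairing_eqI:
  assumes "\<And>g. lip_pairing g u = lip_pairing g v"
  shows "u = v"
proof -
  have "norm (u - v) \<le> 0"
    by (rule norm_lipschitz_free_le) (simp_all add: bounded_clinearD[OF bounded_clinear_lip_pairing] assms)
  then show ?thesis by simp
qed

lemma lip_delta_basepoint: "lip_delta basepoint = 0"
proof (rule lip_pairing_eqI)
  fix g :: "'a lip0"
  have "lip0_apply g basepoint = 0" by transfer simp
  then show "lip_pairing g (lip_delta basepoint) = lip_pairing g 0"
    by (simp add: lip_pairing_delta bounded_clinearD[OF bounded_clinear_lip_pairing])
qed

text \<open>The evaluations span a dense subspace and the set of agreement is closed. The argument
  moves to the ambient dual, where span and closure are taken in the definition of the free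
  space.\<close>

lemma bounded_clinear_eq_on_lip_delta:
  fixes S T :: "'m::pointed_metric_space lipschitz_free \<Rightarrow> 'b::complex_normed_vector"
  assumes S: "bounded_clinear S" and T: "bounded_clinear T"
    and eq: "\<And>x. S (lip_delta x) = T (lip_delta x)"
  shows "S u = T u"
proof -
  define E where "E = {u. S u = T u}"
  have E: "complex_vector.subspace E"
    unfolding E_def
    by (rule complex_vector.subspaceI) (simp_all add: bounded_clinearD[OF S] bounded_clinearD[OF T])
  have "closed E"
    unfolding E_def
    by (rule closed_Collect_eq[OF linear_continuous_on[OF bounded_clinearD(1)[OF S]]
          linear_continuous_on[OF bounded_clinearD(1)[OF T]]])
  have "complex_vector.subspace (cdual_of_lipschitz_free ` E)"
  proof (rule complex_vector.subspaceI)
    show "0 \<in> cdual_of_lipschitz_free ` E"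
      using complex_vector.subspace_0[OF E] zero_lipschitz_free.rep_eq by (metis image_eqI)
    show "a + b \<in> cdual_of_lipschitz_free ` E"
      if "a \<in> cdual_of_lipschitz_free ` E" "b \<in> cdual_of_lipschitz_free ` E" for a b
      using that complex_vector.subspace_add[OF E]
      by (auto simp flip: plus_lipschitz_free.rep_eq)
    show "c *\<^sub>C a \<in> cdual_of_lipschitz_free ` E" if "a \<in> cdual_of_lipschitz_free ` E" for c a
      using that complex_vector.subspace_scale[OF E]
      by (auto simp flip: scaleC_lipschitz_free.rep_eq)
  qed
  moreover have "range lip0_evaluation \<subseteq> cdual_of_lipschitz_free ` E"
    using eq by (auto simp: E_def simp flip: lip_delta.rep_eq)
  ultimately have sp: "complex_vector.span (range lip0_evaluation) \<subseteq> cdual_of_lipschitz_free ` E"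
    by (intro complex_vector.span_minimal)
  have "cdual_of_lipschitz_free u \<in> closure (complex_vector.span (range lip0_evaluation))"
    by (rule cdual_of_lipschitz_free)
  then obtain w where w: "\<And>n. w n \<in> complex_vector.span (range lip0_evaluation)"
      "w \<longlonglongrightarrow> cdual_of_lipschitz_free u"
    unfolding closure_sequential by blast
  then have "\<exists>e. e \<in> E \<and> w n = cdual_of_lipschitz_free e" for n using sp by blast
  then obtain e where e: "\<And>n. e n \<in> E" "\<And>n. w n = cdual_of_lipschitz_free (e n)" by metis
  have "e \<longlonglongrightarrow> u"
    using w(2) unfolding tendsto_iff dist_norm norm_lipschitz_free.rep_eq
    by (simp add: e(2) minus_lipschitz_free.rep_eq)
  then have "u \<in> E" by (rule closed_sequentially[OF \<open>closed E\<close> e(1)])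
  then show ?thesis by (simp add: E_def)
qed

text \<open>Pairing with g yields the difference quotient of g at p and q. For p = q the value is 0,
  as \<open>inverse 0 = 0\<close>.\<close>

definition molecule :: "'m::pointed_metric_space \<Rightarrow> 'm \<Rightarrow> 'm lipschitz_free"
  where "molecule p q = inverse (dist p q) *\<^sub>R (lip_delta p - lip_delta q)"

lemma norm_molecule_le: "norm (molecule p q) \<le> 1"
proof (cases "p = q")
  case False
  then show ?thesis
    using dist_lip_delta_le[of p q]
    by (simp add: molecule_def divide_le_eq flip: divide_inverse_commute)
qed (simp add: molecule_def)

text \<open>Each ball that meets \<open>S\<close> is recentred at a point of \<open>S\<close> inside
  it, at the price of doubling the radius.\<close>

lemma totally_bounded_centers:
  assumes "finite k" "S \<subseteq> (\<Union>x\<in>k. ball x e)"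
  obtains k' where "finite k'" "k' \<subseteq> S" "S \<subseteq> (\<Union>x\<in>k'. ball x (2 * e))"
proof -
  define c where "c x = (SOME s. s \<in> S \<and> dist x s < e)" for x
  define k' where "k' = c ` {x \<in> k. \<exists>s\<in>S. dist x s < e}"
  have c: "c x \<in> S \<and> dist x (c x) < e" if "s \<in> S" "dist x s < e" for x s
    unfolding c_def by (rule someI[of _ s]) (use that in auto)
  show thesis
  proof (rule that)
    show "finite k'" using assms(1) by (simp add: k'_def)
    show "k' \<subseteq> S" using c by (auto simp: k'_def)
    show "S \<subseteq> (\<Union>x\<in>k'. ball x (2 * e))"
    proof
      fix s assume s: "s \<in> S"
      then obtain x where x: "x \<in> k" "dist x s < e" using assms(2) by auto
      have "dist (c x) s < 2 * e"
        using c[OF s x(2)] x(2) dist_triangle[of "c x" s x] by (simp add: dist_commute)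
      moreover have "c x \<in> k'" using s x by (auto simp: k'_def)
      ultimately show "s \<in> (\<Union>x\<in>k'. ball x (2 * e))" by auto
    qed
  qed
qed

text \<open>Schauder's theorem in both directions, with the Lipschitz constant of a function computed on
  the molecules; this replaces the description of the unit ball as the closed absolutely convex hull
  of the molecules, which would require the Hahn--Banach theorem.\<close>

lemma compact_operator_if_molecules_totally_bounded:
  fixes T :: "'m::pointed_metric_space lipschitz_free \<Rightarrow> 'n::pointed_metric_space lipschitz_free"
  assumes T: "bounded_clinear T"
    and tb: "\<forall>e>0. \<exists>k. finite k \<and> (\<lambda>(p, q). T (molecule p q)) ` {(p, q). p \<noteq> q} \<subseteq> (\<Union>x\<in>k. ball x e)"
  shows "compact_operator T"
proof -
  define P where "P = {(p, q :: 'm). p \<noteq> q}"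
  define m where "m = (\<lambda>(p, q :: 'm). molecule p q)"
  define G where "G = {g :: 'n lip0. norm g \<le> 1}"
  obtain L where L: "0 < L" "\<And>u. norm (T u) \<le> norm u * L"
    using bounded_linear.pos_bounded[OF bounded_clinearD(1)[OF T]] by blast
  note diff_T = bounded_clinearD(4)[OF T, symmetric]
  note diff_pairing = bounded_clinearD(4)[OF bounded_clinear_lip_pairing, symmetric]
  have bdd: "norm (lip_pairing g (T u)) \<le> L" if "norm g \<le> 1" "norm u \<le> 1" for g u
  proof -
    have "norm (lip_pairing g (T u)) \<le> norm g * norm (T u)" by (rule norm_lip_pairing_le)
    also have "\<dots> \<le> 1 * (1 * L)"
      using that L by (intro mult_mono order_trans[OF L(2)] mult_right_mono) auto
    finally show ?thesis by simp
  qed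
  \<comment> \<open>The first swap: total boundedness of the images of the molecules passes to the
    Lipschitz functions in \<open>G\<close>, compared on those images only.\<close>
  have "\<exists>G0. finite G0 \<and> G0 \<subseteq> G \<and>
      (\<forall>g\<in>G. \<exists>g0\<in>G0. \<forall>a\<in>P. norm (lip_pairing g (T (m a)) - lip_pairing g0 (T (m a))) \<le> e)"
    if "0 < e" for e
  proof (rule kernel_totally_bounded_swap[where C = L])
    show "norm (lip_pairing g (T (m a))) \<le> L" if "a \<in> P" "g \<in> G" for a g
      using that by (intro bdd) (auto simp: G_def m_def norm_molecule_le split: prod.split)
    fix d :: real assume "0 < d"
    then obtain k where k: "finite k" "(\<lambda>a. T (m a)) ` P \<subseteq> (\<Union>x\<in>k. ball x (d / 2))"
      using tb[rule_format, of "d / 2"] by (auto simp: P_def m_def case_prod_beta)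
    obtain k' where k': "finite k'" "k' \<subseteq> (\<lambda>a. T (m a)) ` P" "(\<lambda>a. T (m a)) ` P \<subseteq> (\<Union>x\<in>k'. ball x d)"
      using totally_bounded_centers[OF k] by auto
    then obtain P0 where P0: "P0 \<subseteq> P" "finite P0" "k' = (\<lambda>a. T (m a)) ` P0"
      by (meson finite_subset_image)
    have "\<exists>a0\<in>P0. \<forall>g\<in>G. norm (lip_pairing g (T (m a)) - lip_pairing g (T (m a0))) \<le> d" if a: "a \<in> P" for a
    proof -
      obtain a0 where a0: "a0 \<in> P0" "dist (T (m a0)) (T (m a)) < d" using k'(3) a P0(3) by auto
      have "norm (lip_pairing g (T (m a)) - lip_pairing g (T (m a0))) \<le> d" if "g \<in> G" for g
      proof -
        have "norm (lip_pairing g (T (m a) - T (m a0))) \<le> norm g * norm (T (m a) - T (m a0))"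
          by (rule norm_lip_pairing_le)
        also have "\<dots> \<le> 1 * d"
          using that a0(2) by (intro mult_mono) (auto simp: G_def dist_norm norm_minus_commute)
        finally show ?thesis by (simp add: diff_pairing)
      qed
      with a0(1) show ?thesis by blast
    qed
    with P0 show "\<exists>P0. finite P0 \<and> P0 \<subseteq> P \<and>
        (\<forall>a\<in>P. \<exists>a0\<in>P0. \<forall>g\<in>G. norm (lip_pairing g (T (m a)) - lip_pairing g (T (m a0))) \<le> d)"
      by blast
  qed fact
  note step1 = this
  have step2: "\<exists>G0. finite G0 \<and> G0 \<subseteq> G \<and>
      (\<forall>g\<in>G. \<exists>g0\<in>G0. \<forall>u\<in>cball 0 1. norm (lip_pairing g (T u) - lip_pairing g0 (T u)) \<le> e)"
    if e: "0 < e" for e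
  proof -
    from step1[OF e] obtain G0 where G0: "finite G0" "G0 \<subseteq> G" and
      near: "\<And>g. g \<in> G \<Longrightarrow>
        \<exists>g0\<in>G0. \<forall>a\<in>P. norm (lip_pairing g (T (m a)) - lip_pairing g0 (T (m a))) \<le> e"
      by blast
    have "\<exists>g0\<in>G0. \<forall>u\<in>cball 0 1. norm (lip_pairing g (T u) - lip_pairing g0 (T u)) \<le> e" if "g \<in> G" for g
    proof -
      obtain g0 where g0: "g0 \<in> G0"
          "\<And>a. a \<in> P \<Longrightarrow> norm (lip_pairing g (T (m a)) - lip_pairing g0 (T (m a))) \<le> e"
        using near[OF \<open>g \<in> G\<close>] by blast
      \<comment> \<open>The values of \<open>?f\<close> at molecules are the difference quotients of
        its restriction to the evaluations. Their bound e is thus a Lipschitz constant, and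
        \<open>?f\<close> is the pairing with a function of norm at most e; this extends the
        estimate from molecules to the whole unit ball.\<close>
      let ?f = "\<lambda>u. lip_pairing (g - g0) (T u)"
      have f: "bounded_clinear ?f" by (rule bounded_clinear_compose[OF bounded_clinear_lip_pairing T])
      have "e-lipschitz_on UNIV (\<lambda>x. ?f (lip_delta x))"
        unfolding lipschitz_on_def
      proof (intro conjI ballI)
        fix p q :: 'm
        show "dist (?f (lip_delta p)) (?f (lip_delta q)) \<le> e * dist p q"
        proof (cases "p = q")
          case False
          then have "norm (?f (molecule p q)) \<le> e"
            using g0(2)[of "(p, q)"] by (simp add: P_def m_def lip_pairing_diff_left)
          then show ?thesis
            using False
            by (simp add: molecule_def bounded_clinearD(4,6)[OF f] dist_norm divide_le_eq
                flip: divide_inverse_commute)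
        qed simp
      qed (use e in simp)
      moreover have "?f (lip_delta basepoint) = 0"
        by (simp add: lip_delta_basepoint bounded_clinearD(2)[OF f])
      ultimately obtain h where h: "lip0_apply h = (\<lambda>x. ?f (lip_delta x))" "norm h \<le> e"
        by (rule lip0_of_lipschitz_on)
      have "?f u = lip_pairing h u" for u
        by (rule bounded_clinear_eq_on_lip_delta[OF f bounded_clinear_lip_pairing])
          (simp add: lip_pairing_delta h(1))
      moreover have "norm (lip_pairing h u) \<le> e" if "u \<in> cball 0 1" for u
      proof -
        have "norm (lip_pairing h u) \<le> norm h * norm u" by (rule norm_lip_pairing_le)
        also have "\<dots> \<le> e * 1" using that h(2) e by (intro mult_mono) auto
        finally show ?thesis by simp
      qed
      ultimately show ?thesis using g0(1) by (intro bexI[of _ g0]) (auto simp: lip_pairing_diff_left)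
    qed
    with G0 show ?thesis by blast
  qed
  show ?thesis
    unfolding compact_operator_iff_totally_bounded
  proof (intro allI impI)
    fix e :: real assume e: "0 < e"
    \<comment> \<open>The second swap returns from Lipschitz functions to vectors, now with the
      whole unit ball in place of the molecules.\<close>
    have "\<exists>U. finite U \<and> U \<subseteq> cball 0 1 \<and>
        (\<forall>u\<in>cball 0 1. \<exists>u0\<in>U. \<forall>g\<in>G. norm (lip_pairing g (T u) - lip_pairing g (T u0)) \<le> e / 2)"
    proof (rule kernel_totally_bounded_swap[where C = L])
      show "norm (lip_pairing g (T u)) \<le> L" if "g \<in> G" "u \<in> cball 0 1" for g u
        using that by (intro bdd) (auto simp: G_def)
    qed (use step2 e in auto)
    then obtain U where U: "finite U" "\<And>u. u \<in> cball 0 1 \<Longrightarrow>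
        \<exists>u0\<in>U. \<forall>g\<in>G. norm (lip_pairing g (T u) - lip_pairing g (T u0)) \<le> e / 2" by blast
    have "T u \<in> (\<Union>x\<in>T ` U. ball x e)" if u: "u \<in> cball 0 1" for u
    proof -
      obtain u0 where u0: "u0 \<in> U" "\<And>g. g \<in> G \<Longrightarrow> norm (lip_pairing g (T u) - lip_pairing g (T u0)) \<le> e / 2"
        using U(2)[OF u] by blast
      have "norm (T u - T u0) \<le> e / 2"
        by (rule norm_lipschitz_free_le)
          (use u0(2) e in \<open>auto simp: G_def bounded_clinearD(4)[OF bounded_clinear_lip_pairing]\<close>)
      with e have "dist (T u0) (T u) < e" by (simp add: dist_norm norm_minus_commute)
      with u0(1) show ?thesis by auto
    qed
    then show "\<exists>k. finite k \<and> T ` cball 0 1 \<subseteq> (\<Union>x\<in>k. ball x e)"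
      using U(1) by (intro exI[of _ "T ` U"]) blast
  qed
qed

section \<open>Disjointly supported bumps\<close>

definition bump :: "'n::pointed_metric_space \<Rightarrow> real \<Rightarrow> 'n \<Rightarrow> complex"
  where "bump w r x = complex_of_real (max 0 (r - dist x w))"

text \<open>A truncated distance is 1-Lipschitz; the bound on r keeps the base point outside the
  open support.\<close>

lemma bump_lip0:
  assumes "r \<le> dist w basepoint"
  obtains h where "lip0_apply h = bump w r" "norm h \<le> 1"
proof (rule lip0_of_lipschitz_on)
  have "\<bar>max 0 (r - dist x w) - max 0 (r - dist y w)\<bar> \<le> dist x y" for x y
    using dist_triangle[of x w y] dist_triangle[of y w x] by (simp add: dist_commute)
  then show "1-lipschitz_on UNIV (bump w r)"
    by (auto simp: lipschitz_on_def bump_def dist_norm simp flip: of_real_diff)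
  show "bump w r basepoint = 0" using assms by (simp add: bump_def dist_commute)
qed

text \<open>The lower bound is attained by the cone around x whose radius just reaches the base
  point.\<close>

lemma norm_lip_delta: "norm (lip_delta x) = dist x basepoint"
proof (rule antisym)
  show "norm (lip_delta x) \<le> dist x basepoint"
    using dist_lip_delta_le[of x basepoint] by (simp add: lip_delta_basepoint)
  obtain h where h: "lip0_apply h = bump x (dist x basepoint)" "norm h \<le> 1"
    by (rule bump_lip0[OF order_refl])
  have "dist x basepoint = norm (lip_pairing h (lip_delta x))"
    by (simp add: lip_pairing_delta h(1) bump_def)
  also have "\<dots> \<le> norm h * norm (lip_delta x)" by (rule norm_lip_pairing_le)
  also have "\<dots> \<le> norm (lip_delta x)" using h(2) by (simp add: mult_left_le_one_le)
  finally show "dist x basepoint \<le> norm (lip_delta x)" .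
qed

text \<open>The subsequence is part of the notion, so that refinements by Ramsey's theorem can be
  chained freely. Nothing is required of the pairings with other members of the sequence:
  disjointness of supports takes care of them later.\<close>

definition has_humps :: "(nat \<Rightarrow> 'n::pointed_metric_space lipschitz_free) \<Rightarrow> bool"
  where "has_humps \<gamma> \<longleftrightarrow> (\<exists>(r :: nat \<Rightarrow> nat) g c. strict_mono r \<and> 0 < c \<and> (\<forall>n. norm (g n) \<le> 1) \<and>
    (\<forall>p n m. lip0_apply (g n) p \<noteq> 0 \<and> lip0_apply (g m) p \<noteq> 0 \<longrightarrow> n = m) \<and>
    (\<forall>n. c \<le> norm (lip_pairing (g n) (\<gamma> (r n)))))"

lemma has_humps_subsequence:
  assumes "strict_mono (s :: nat \<Rightarrow> nat)" "has_humps (\<lambda>n. \<gamma> (s n))"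
  shows "has_humps \<gamma>"
  using assms(2) unfolding has_humps_def
proof (elim exE conjE, goal_cases)
  case r: (1 r g c)
  have "strict_mono (\<lambda>n. s (r n))" using assms(1) r(1) by (simp add: strict_mono_def)
  with r(2-) show ?case
    by (intro exI[of _ "\<lambda>n. s (r n)"] exI[of _ g] exI[of _ c] conjI)
qed

text \<open>By the triangle inequality, open balls whose radii sum to at most the distance of the
  centres are disjoint.\<close>

lemma has_humps_bumps:
  assumes rad: "\<And>n. rad n \<le> dist (w n) basepoint"
    and disj: "\<And>i j. i < j \<Longrightarrow> rad i + rad j \<le> dist (w i) (w j)"
    and "0 < c"
    and c: "\<And>n h. lip0_apply h = bump (w n) (rad n) \<Longrightarrow> norm h \<le> 1 \<Longrightarrow> c \<le> norm (lip_pairing h (\<gamma> n))"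
  shows "has_humps \<gamma>"
proof -
  have "\<exists>h. lip0_apply h = bump (w n) (rad n) \<and> norm h \<le> 1" for n
    using bump_lip0[OF rad] by metis
  then obtain g where g: "\<And>n. lip0_apply (g n) = bump (w n) (rad n)" "\<And>n. norm (g n) \<le> 1" by metis
  have "n = m" if "bump (w n) (rad n) p \<noteq> 0" "bump (w m) (rad m) p \<noteq> 0" for p n m
  proof (rule ccontr)
    assume "n \<noteq> m"
    then have "rad n + rad m \<le> dist (w n) (w m)"
      using disj[of n m] disj[of m n] by (cases n m rule: linorder_cases) (auto simp: dist_commute)
    moreover have "dist p (w n) < rad n" "dist p (w m) < rad m"
      using that by (auto simp: bump_def max_def split: if_splits)
    ultimately show False using dist_triangle2[of "w n" "w m" p] by (simp add: dist_commute)
  qed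
  then show ?thesis
    unfolding has_humps_def using \<open>0 < c\<close> g c
    by (intro exI[of _ id] exI[of _ g] exI[of _ c]) (auto simp: strict_mono_def)
qed

text \<open>Ramsey's theorem for a colour depending only on the smaller index.\<close>

lemma dichotomy_subsequence:
  obtains r :: "nat \<Rightarrow> nat" where "strict_mono r" "(\<forall>n. Q (r n)) \<or> (\<forall>n. \<not> Q (r n))"
proof -
  obtain r :: "nat \<Rightarrow> nat" where r: "strict_mono r"
      "(\<forall>i j. i < j \<longrightarrow> Q (r i)) \<or> (\<forall>i j. i < j \<longrightarrow> \<not> Q (r i))"
    by (rule Ramsey_subsequence[of "\<lambda>i j. Q i"])
  then have "(\<forall>n. Q (r n)) \<or> (\<forall>n. \<not> Q (r n))" using lessI by blast
  with r(1) that show thesis by blast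
qed

lemma bounded_close_subsequence:
  fixes c :: "nat \<Rightarrow> complex"
  assumes "\<And>n. norm (c n) \<le> B" "0 < e"
  obtains r :: "nat \<Rightarrow> nat" where "strict_mono r" "\<And>i j. norm (c (r i) - c (r j)) < e"
proof -
  have "bounded (range c)" using assms(1) by (auto simp: bounded_iff)
  then obtain l r where r: "strict_mono r" "(c \<circ> r) \<longlonglongrightarrow> l"
    using bounded_imp_convergent_subsequence by blast
  then obtain N where N: "\<And>m n. N \<le> m \<Longrightarrow> N \<le> n \<Longrightarrow> norm (c (r m) - c (r n)) < e"
    using CauchyD[OF LIMSEQ_imp_Cauchy[OF r(2)] assms(2)] by auto
  show thesis
  proof (rule that)
    show "strict_mono (\<lambda>n. r (n + N))" using r(1) by (simp add: strict_mono_def)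
    show "norm (c (r (i + N)) - c (r (j + N))) < e" for i j by (rule N) simp_all
  qed
qed

section \<open>Separated sequences of multiples of single evaluations\<close>

lemma norm_scaled_delta: "norm (c *\<^sub>C lip_delta w) = norm c * dist w basepoint"
  by (simp add: norm_scaleC norm_lip_delta)

lemma norm_scaled_delta_diff_le:
  "norm (c *\<^sub>C lip_delta w - c' *\<^sub>C lip_delta w')
    \<le> norm c * dist w w' + norm (c - c') * dist w' basepoint"
proof -
  have "c *\<^sub>C lip_delta w - c' *\<^sub>C lip_delta w'
      = c *\<^sub>C (lip_delta w - lip_delta w') + (c - c') *\<^sub>C lip_delta w'"
    by (simp add: complex_vector.scale_right_diff_distrib complex_vector.scale_left_diff_distrib)
  then have "norm (c *\<^sub>C lip_delta w - c' *\<^sub>C lip_delta w')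
      \<le> norm (c *\<^sub>C (lip_delta w - lip_delta w')) + norm ((c - c') *\<^sub>C lip_delta w')"
    by (metis norm_triangle_ineq)
  also have "norm (c *\<^sub>C (lip_delta w - lip_delta w')) \<le> norm c * dist w w'"
    by (simp add: norm_scaleC mult_left_mono dist_lip_delta_le)
  finally show ?thesis by (simp add: norm_scaled_delta)
qed

text \<open>The alternative in Ramsey's theorem is crowding at the scale \<rho> times the distance
  to the base point. Then these distances are all comparable, the coefficients are bounded, two of
  them can be taken almost equal, and the two vectors differ by less than e. The entry 1/4 of \<rho>
  gives the comparability, the factor 16 gives 8 \<rho> C \<le> e/2.\<close>

lemma separated_deltas:
  fixes w :: "nat \<Rightarrow> 'n::pointed_metric_space" and c :: "nat \<Rightarrow> complex"
  assumes bdd: "\<And>n. norm (c n) * dist (w n) basepoint \<le> C"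
    and sep: "\<And>i j. i \<noteq> j \<Longrightarrow> e \<le> norm (c i *\<^sub>C lip_delta (w i) - c j *\<^sub>C lip_delta (w j))"
    and "0 < C" "0 < e"
    and \<rho>: "\<rho> = min (1 / 4) (e / (16 * C))"
  obtains r :: "nat \<Rightarrow> nat" where "strict_mono r" "\<And>n. e / 2 \<le> norm (c (r n)) * dist (w (r n)) basepoint"
    "\<And>i j. i < j \<Longrightarrow>
      \<rho> * (dist (w (r i)) basepoint + dist (w (r j)) basepoint) \<le> dist (w (r i)) (w (r j))"
proof -
  define d where "d n = dist (w n) basepoint" for n
  have \<rho>0: "0 < \<rho>" "\<rho> \<le> 1 / 4" "16 * C * \<rho> \<le> e"
    using \<open>0 < C\<close> \<open>0 < e\<close> by (auto simp: \<rho> min_def field_simps)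
  \<comment> \<open>One vector of norm below e/2 forces all others to have norm at least e/2, so
    dropping an initial segment suffices.\<close>
  have "\<exists>N. \<forall>n\<ge>N. e / 2 \<le> norm (c n) * d n"
  proof (cases "\<exists>n. norm (c n) * d n < e / 2")
    case True
    then obtain k where k: "norm (c k) * d k < e / 2" ..
    have "e / 2 \<le> norm (c n) * d n" if "Suc k \<le> n" for n
    proof -
      have "e \<le> norm (c n *\<^sub>C lip_delta (w n) - c k *\<^sub>C lip_delta (w k))" using that by (intro sep) simp
      also have "\<dots> \<le> norm (c n) * d n + norm (c k) * d k"
        unfolding d_def norm_scaled_delta[symmetric] by (rule norm_triangle_ineq4)
      finally show ?thesis using k by simp
    qed
    then show ?thesis by blast
  qed (auto simp: not_less)
  then obtain N where N: "\<And>n. N \<le> n \<Longrightarrow> e / 2 \<le> norm (c n) * d n" by blast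
  have dpos: "0 < d n" if "N \<le> n" for n
    using N[OF that] \<open>0 < e\<close> zero_le_dist[of "w n" basepoint] by (auto simp: d_def less_le)
  obtain r0 :: "nat \<Rightarrow> nat" where r0: "strict_mono r0" and
      "(\<forall>i j. i < j \<longrightarrow> 2 * \<rho> * max (d (r0 i + N)) (d (r0 j + N)) \<le> dist (w (r0 i + N)) (w (r0 j + N))) \<or>
       (\<forall>i j. i < j \<longrightarrow> \<not> 2 * \<rho> * max (d (r0 i + N)) (d (r0 j + N)) \<le> dist (w (r0 i + N)) (w (r0 j + N)))"
    by (rule Ramsey_subsequence[of "\<lambda>i j. 2 * \<rho> * max (d (i + N)) (d (j + N)) \<le> dist (w (i + N)) (w (j + N))"])
  define r where "r n = r0 n + N" for n
  have r: "strict_mono r" "\<And>n. N \<le> r n"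
    using r0 by (auto simp: r_def strict_mono_def)
  have "(\<forall>i j. i < j \<longrightarrow> 2 * \<rho> * max (d (r i)) (d (r j)) \<le> dist (w (r i)) (w (r j))) \<or>
       (\<forall>i j. i < j \<longrightarrow> \<not> 2 * \<rho> * max (d (r i)) (d (r j)) \<le> dist (w (r i)) (w (r j)))"
    unfolding r_def by fact
  then show thesis
  proof
    assume far: "\<forall>i j. i < j \<longrightarrow> 2 * \<rho> * max (d (r i)) (d (r j)) \<le> dist (w (r i)) (w (r j))"
    show thesis
    proof (rule that[OF r(1)])
      show "e / 2 \<le> norm (c (r n)) * dist (w (r n)) basepoint" for n
        using N[OF r(2)] by (simp add: d_def)
      fix i j :: nat assume "i < j"
      have "\<rho> * (d (r i) + d (r j)) \<le> \<rho> * (2 * max (d (r i)) (d (r j)))"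
        using \<rho>0 by (intro mult_left_mono) auto
      with far \<open>i < j\<close>
      show "\<rho> * (dist (w (r i)) basepoint + dist (w (r j)) basepoint) \<le> dist (w (r i)) (w (r j))"
        unfolding d_def by force
    qed
  next
    assume "\<forall>i j. i < j \<longrightarrow> \<not> 2 * \<rho> * max (d (r i)) (d (r j)) \<le> dist (w (r i)) (w (r j))"
    then have close: "dist (w (r i)) (w (r j)) < 2 * \<rho> * max (d (r i)) (d (r j))" if "i < j" for i j
      using that by (simp add: not_le)
    define D where "D = d (r 0)"
    have D: "0 < D" unfolding D_def by (rule dpos[OF r(2)])
    \<comment> \<open>As 2 \<rho> \<le> 1/2, every later point is within half of the larger base
      distance from the first one.\<close>
    have range: "D / 2 \<le> d (r n) \<and> d (r n) \<le> 2 * D" for n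
    proof (cases "n = 0")
      case False
      have "2 * \<rho> * max D (d (r n)) \<le> 1 / 2 * max D (d (r n))"
        using \<rho>0 D by (intro mult_right_mono) auto
      then have "dist (w (r 0)) (w (r n)) < 1 / 2 * max D (d (r n))"
        using close[of 0 n] False by (simp add: D_def)
      moreover have "D \<le> dist (w (r 0)) (w (r n)) + d (r n)" "d (r n) \<le> dist (w (r 0)) (w (r n)) + D"
        unfolding D_def d_def by (metis dist_triangle dist_commute)+
      ultimately show ?thesis by (auto simp: max_def split: if_splits)
    qed (use D in \<open>simp add: D_def\<close>)
    have "norm (c (r n)) \<le> 2 * C / D" for n
    proof -
      have "norm (c (r n)) * (D / 2) \<le> norm (c (r n)) * d (r n)"
        using range by (intro mult_left_mono) auto
      also have "\<dots> \<le> C" using bdd by (simp add: d_def)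
      finally show ?thesis using D by (simp add: field_simps)
    qed
    \<comment> \<open>The tolerance e/(4 D) times a base distance of at most 2 D costs e/2.\<close>
    then obtain s :: "nat \<Rightarrow> nat" where s: "strict_mono s"
        "\<And>i j. norm (c (r (s i)) - c (r (s j))) < e / (4 * D)"
      by (rule bounded_close_subsequence[of "\<lambda>n. c (r n)" "2 * C / D" "e / (4 * D)"]) (use \<open>0 < e\<close> D in auto)
    define i j where "i = r (s 0)" and "j = r (s 1)"
    have sij: "s 0 < s 1" using s(1) by (simp add: strict_mono_def)
    have "i \<noteq> j" using sij r(1) unfolding i_def j_def by (metis nat_neq_iff strict_mono_less)
    then have "e \<le> norm (c i *\<^sub>C lip_delta (w i) - c j *\<^sub>C lip_delta (w j))" by (rule sep)
    also have "\<dots> \<le> norm (c i) * dist (w i) (w j) + norm (c i - c j) * d j"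
      unfolding d_def by (rule norm_scaled_delta_diff_le)
    also have "norm (c i) * dist (w i) (w j) \<le> norm (c i) * (2 * \<rho> * (4 * d i))"
    proof (rule mult_left_mono)
      have "max (d i) (d j) \<le> 4 * d i"
        using range[of "s 0"] range[of "s 1"] by (simp add: i_def j_def)
      then have "2 * \<rho> * max (d i) (d j) \<le> 2 * \<rho> * (4 * d i)" using \<rho>0 by (intro mult_left_mono) auto
      with close[OF sij] show "dist (w i) (w j) \<le> 2 * \<rho> * (4 * d i)" by (simp add: i_def j_def)
    qed simp
    also have "norm (c i) * (2 * \<rho> * (4 * d i)) = 8 * \<rho> * (norm (c i) * d i)" by simp
    also have "\<dots> \<le> 8 * \<rho> * C" using bdd[of i] \<rho>0 by (intro mult_left_mono) (auto simp: d_def)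
    also have "norm (c i - c j) * d j < e / 2"
    proof -
      have "norm (c i - c j) * d j \<le> norm (c i - c j) * (2 * D)"
        using range[of "s 1"] by (intro mult_left_mono) (auto simp: j_def)
      also have "\<dots> < e / (4 * D) * (2 * D)"
        using s(2)[of 0 1] D by (intro mult_strict_right_mono) (auto simp: i_def j_def)
      also have "\<dots> = e / 2" using D by simp
      finally show ?thesis .
    qed
    finally have "e < 8 * \<rho> * C + e / 2" by simp
    with \<rho>0(3) have False by (simp add: algebra_simps)
    then show thesis ..
  qed
qed

text \<open>In \<open>a\<^sub>n \<delta>(u\<^sub>n) + b\<^sub>n \<delta>(v\<^sub>n)\<close> the point closer to the base point is called \<open>v\<^sub>n\<close>, so
  that \<open>dist (u\<^sub>n) (v\<^sub>n)\<close> is at most twice the distance of \<open>u\<^sub>n\<close> from the base point.\<close>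

locale two_deltas =
  fixes u v :: "nat \<Rightarrow> 'n::pointed_metric_space" and a b :: "nat \<Rightarrow> complex" and C e :: real
  assumes bdd: "norm (a n *\<^sub>C lip_delta (u n) + b n *\<^sub>C lip_delta (v n)) \<le> C"
    and sep: "i \<noteq> j \<Longrightarrow> e \<le> norm ((a i *\<^sub>C lip_delta (u i) + b i *\<^sub>C lip_delta (v i))
      - (a j *\<^sub>C lip_delta (u j) + b j *\<^sub>C lip_delta (v j)))"
    and ordered: "dist (v n) basepoint \<le> dist (u n) basepoint"
    and C_pos: "0 < C" and e_pos: "0 < e"
begin

definition \<gamma> where "\<gamma> n = a n *\<^sub>C lip_delta (u n) + b n *\<^sub>C lip_delta (v n)"

abbreviation "s n \<equiv> dist (u n) (v n)"
abbreviation "du n \<equiv> dist (u n) basepoint"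
abbreviation "dv n \<equiv> dist (v n) basepoint"

lemma pairing: "lip_pairing h (\<gamma> n) = a n * lip0_apply h (u n) + b n * lip0_apply h (v n)"
  by (simp add: \<gamma>_def bounded_clinearD[OF bounded_clinear_lip_pairing] lip_pairing_delta
      scaleC_complex_def)

lemma s_le: "s n \<le> 2 * du n"
  using dist_triangle2[of "u n" "v n" basepoint] ordered[of n] by simp

text \<open>The bump of radius s/2 around u misses v and detects a. The half is needed for it to
  vanish at the base point, which may be as close to u as s/2.\<close>

lemma norm_a_s_le: "norm (a n) * s n \<le> 2 * C"
proof -
  have "s n / 2 \<le> du n" using s_le[of n] by simp
  then obtain h where h: "lip0_apply h = bump (u n) (s n / 2)" "norm h \<le> 1" by (rule bump_lip0)
  have "norm (a n) * (s n / 2) = norm (lip_pairing h (\<gamma> n))"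
    by (simp add: pairing h(1) bump_def dist_commute norm_mult)
  also have "\<dots> \<le> norm h * norm (\<gamma> n)" by (rule norm_lip_pairing_le)
  also have "\<dots> \<le> 1 * C" using h(2) bdd by (intro mult_mono) (auto simp: \<gamma>_def)
  finally show ?thesis by simp
qed

lemma split_at_v: "\<gamma> n = a n *\<^sub>C (lip_delta (u n) - lip_delta (v n)) + (a n + b n) *\<^sub>C lip_delta (v n)"
  by (simp add: \<gamma>_def scaleC_add_left complex_vector.scale_right_diff_distrib)

lemma norm_split_at_v_le: "norm (\<gamma> n - (a n + b n) *\<^sub>C lip_delta (v n)) \<le> norm (a n) * s n"
  by (simp add: split_at_v norm_scaleC mult_left_mono dist_lip_delta_le)

lemma norm_sum_dv_le: "norm (a n + b n) * dv n \<le> C + norm (a n) * s n"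
proof -
  have "norm (a n + b n) * dv n = norm (\<gamma> n - (\<gamma> n - (a n + b n) *\<^sub>C lip_delta (v n)))"
    by (simp add: norm_scaled_delta)
  also have "\<dots> \<le> norm (\<gamma> n) + norm (\<gamma> n - (a n + b n) *\<^sub>C lip_delta (v n))"
    by (rule norm_triangle_ineq4)
  also have "\<dots> \<le> C + norm (a n) * s n"
    using bdd norm_split_at_v_le by (intro add_mono) (simp_all add: \<gamma>_def)
  finally show ?thesis .
qed

text \<open>With a negligible dipole weight the vector is nearly (a + b) \<delta>(v), and the
  single-evaluation case applies to v. The bump may also see u: the dipole part changes its pairing
  by at most e \<rho>/8, against a main term of at least e \<rho>/4.\<close>

lemma humps_merging:
  fixes r :: "nat \<Rightarrow> nat"
  assumes r: "strict_mono r"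
    and small: "\<And>n. norm (a (r n)) * s (r n) < e / 8 * min (1 / 4) (e / (64 * C))"
  shows "has_humps \<gamma>"
proof (rule has_humps_subsequence[OF r])
  \<comment> \<open>This is the constant of \<open>separated_deltas\<close> for separation e/2 and
    bound 2 C, which the evaluations at v retain after removal of the dipoles.\<close>
  define \<rho> where "\<rho> = min (1 / 4) (e / (64 * C))"
  have \<rho>: "0 < \<rho>" "\<rho> \<le> 1 / 4" using C_pos e_pos by (simp_all add: \<rho>_def)
  have small': "norm (a (r n)) * s (r n) < e * \<rho> / 8" for n
    using small[of n] by (simp add: \<rho>_def)
  have e\<rho>: "e * \<rho> / 8 \<le> e / 32" using mult_left_mono[OF \<rho>(2), of e] e_pos by simp
  have ri: "r i \<noteq> r j" if "i \<noteq> j" for i j using r that by (metis strict_mono_eq)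
  have eC: "e \<le> 2 * C"
  proof -
    have "e \<le> norm (\<gamma> 0 - \<gamma> 1)" using sep[of 0 1] by (simp add: \<gamma>_def)
    also have "\<dots> \<le> norm (\<gamma> 0) + norm (\<gamma> 1)" by (rule norm_triangle_ineq4)
    also have "\<dots> \<le> C + C" using bdd by (intro add_mono) (simp_all add: \<gamma>_def)
    finally show ?thesis by simp
  qed
  let ?c = "\<lambda>n. a (r n) + b (r n)"
  have sep': "e / 2 \<le> norm (?c i *\<^sub>C lip_delta (v (r i)) - ?c j *\<^sub>C lip_delta (v (r j)))" if "i \<noteq> j" for i j
  proof -
    let ?d = "\<lambda>n. \<gamma> (r n) - ?c n *\<^sub>C lip_delta (v (r n))"
    have "e \<le> norm (\<gamma> (r i) - \<gamma> (r j))" using sep[OF ri[OF that]] by (simp add: \<gamma>_def)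
    also have "\<gamma> (r i) - \<gamma> (r j)
        = (?d i - ?d j) + (?c i *\<^sub>C lip_delta (v (r i)) - ?c j *\<^sub>C lip_delta (v (r j)))"
      by simp
    also have "norm \<dots> \<le> norm (?d i - ?d j) + norm (?c i *\<^sub>C lip_delta (v (r i)) - ?c j *\<^sub>C lip_delta (v (r j)))"
      by (rule norm_triangle_ineq)
    also have "norm (?d i - ?d j) \<le> norm (?d i) + norm (?d j)" by (rule norm_triangle_ineq4)
    finally show ?thesis
      using norm_split_at_v_le[of "r i"] norm_split_at_v_le[of "r j"] small'[of i] small'[of j] e\<rho> e_pos
      by linarith
  qed
  have bdd': "norm (?c n) * dist (v (r n)) basepoint \<le> 2 * C" for n
    using norm_sum_dv_le[of "r n"] small'[of n] e\<rho> eC C_pos by linarith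
  have \<rho>': "\<rho> = min (1 / 4) (e / 2 / (16 * (2 * C)))" by (simp add: \<rho>_def)
  obtain t :: "nat \<Rightarrow> nat" where t: "strict_mono t"
      "\<And>n. e / 2 / 2 \<le> norm (?c (t n)) * dist (v (r (t n))) basepoint"
      "\<And>i j. i < j \<Longrightarrow> \<rho> * (dist (v (r (t i))) basepoint + dist (v (r (t j))) basepoint)
        \<le> dist (v (r (t i))) (v (r (t j)))"
    by (rule separated_deltas[OF bdd' sep' _ _ \<rho>']) (use C_pos e_pos in auto)
  show "has_humps (\<lambda>n. \<gamma> (r n))"
  proof (rule has_humps_subsequence[OF t(1)], rule has_humps_bumps)
    fix n h
    assume h: "lip0_apply h = bump (v (r (t n))) (\<rho> * dv (r (t n)))" "norm h \<le> 1"
    define k where "k = r (t n)"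
    have hv: "lip0_apply h (v k) = complex_of_real (\<rho> * dv k)"
      using \<rho>(1) by (simp add: h(1) bump_def k_def)
    have "norm (lip_pairing h (\<gamma> k - (a k + b k) *\<^sub>C lip_delta (v k))) \<le> norm h * (norm (a k) * s k)"
      by (rule order_trans[OF norm_lip_pairing_le]) (intro mult_left_mono norm_split_at_v_le norm_ge_zero)
    also have "\<dots> \<le> norm (a k) * s k" using h(2) by (intro mult_left_le_one_le) auto
    also have "\<dots> \<le> e * \<rho> / 8" using small'[of "t n"] by (simp add: k_def)
    finally have 1: "norm (lip_pairing h (\<gamma> k) - (a k + b k) * (\<rho> * dv k)) \<le> e * \<rho> / 8"
      by (simp add: bounded_clinearD[OF bounded_clinear_lip_pairing] lip_pairing_delta hv scaleC_complex_def)
    have "\<rho> * (e / 4) \<le> \<rho> * (norm (a k + b k) * dv k)"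
      using t(2)[of n] \<rho>(1) by (intro mult_left_mono) (simp_all add: k_def)
    also have "\<dots> = norm ((a k + b k) * (\<rho> * dv k))" using \<rho>(1) by (simp add: norm_mult)
    also have "\<dots> \<le> norm (lip_pairing h (\<gamma> k)) + e * \<rho> / 8"
      using 1 norm_triangle_sub[of "(a k + b k) * (\<rho> * dv k)" "lip_pairing h (\<gamma> k)"]
      by (simp add: norm_minus_commute)
    finally have "\<rho> * (e / 4) \<le> norm (lip_pairing h (\<gamma> k)) + e * \<rho> / 8" .
    moreover have "\<rho> * (e / 4) = e * \<rho> / 8 + e * \<rho> / 8" by simp
    ultimately show "e * \<rho> / 8 \<le> norm (lip_pairing h (\<gamma> (r (t n))))"
      unfolding k_def by linarith
  next
    show "\<rho> * dv (r (t n)) \<le> dist (v (r (t n))) basepoint" for n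
      using \<rho> by (intro mult_left_le_one_le) auto
    show "\<rho> * dv (r (t i)) + \<rho> * dv (r (t j)) \<le> dist (v (r (t i))) (v (r (t j)))" if "i < j" for i j
      using t(3)[OF that] by (simp add: distrib_left)
    show "0 < e * \<rho> / 8" using e_pos \<rho> by simp
  qed
qed

text \<open>When the points u_n are spread out at the scale of s, bumps around them of radius at
  most s/2 miss v_n, so only a_n is seen and the pairing is a multiple of the dipole weight.\<close>

lemma humps_far:
  fixes r :: "nat \<Rightarrow> nat"
  assumes r: "strict_mono r" and c: "0 < c" "\<And>n. c \<le> norm (a (r n)) * s (r n)"
    and \<rho>: "0 < \<rho>" "\<rho> \<le> 1"
    and far: "\<And>i j. i < j \<Longrightarrow> \<rho> * max (s (r i)) (s (r j)) \<le> dist (u (r i)) (u (r j))"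
  shows "has_humps \<gamma>"
proof (rule has_humps_subsequence[OF r], rule has_humps_bumps)
  let ?rad = "\<lambda>n. \<rho> / 2 * s (r n)"
  have rad: "?rad n \<le> s (r n) / 2" for n using \<rho> mult_right_mono[of \<rho> 1 "s (r n)"] by simp
  show "?rad n \<le> dist (u (r n)) basepoint" for n using rad[of n] s_le[of "r n"] by linarith
  show "?rad i + ?rad j \<le> dist (u (r i)) (u (r j))" if "i < j" for i j
  proof -
    have "?rad i + ?rad j = \<rho> / 2 * (s (r i) + s (r j))" by (simp add: distrib_left)
    also have "\<dots> \<le> \<rho> / 2 * (2 * max (s (r i)) (s (r j)))" using \<rho> by (intro mult_left_mono) auto
    also have "\<dots> \<le> dist (u (r i)) (u (r j))" using far[OF that] by simp
    finally show ?thesis .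
  qed
  show "0 < \<rho> / 2 * c" using \<rho> c by simp
  fix n h assume h: "lip0_apply h = bump (u (r n)) (?rad n)" "norm h \<le> 1"
  have pair: "lip_pairing h (\<gamma> (r n)) = a (r n) * complex_of_real (?rad n)"
  proof -
    have "?rad n - s (r n) \<le> 0" using rad[of n] zero_le_dist[of "u (r n)" "v (r n)"] by linarith
    then show ?thesis
      using \<rho> by (simp add: pairing h(1) bump_def dist_commute max_absorb1 max_absorb2)
  qed
  have "norm (lip_pairing h (\<gamma> (r n))) = \<rho> / 2 * (norm (a (r n)) * s (r n))"
    unfolding pair using \<rho> by (simp add: norm_mult)
  with c(2)[of n] \<rho> show "\<rho> / 2 * c \<le> norm (lip_pairing h (\<gamma> (r n)))" by simp
qed

text \<open>The points u crowd, but s decreases so fast that the points v are apart: d(v_i,v_j) is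
  at least s_i - s_i/8 - s_i/16. A bump of radius s/4 around v misses u and detects b. As |a+b|
  \<le> 12 C/D, the smallness of s makes |a+b| s at most c/2, so |b| s inherits half of the bound c
  on |a| s.\<close>

lemma humps_sparse:
  fixes r :: "nat \<Rightarrow> nat"
  assumes r: "strict_mono r" and c: "0 < c" "\<And>n. c \<le> norm (a (r n)) * s (r n)"
    and close: "\<And>i j. i < j \<Longrightarrow> dist (u (r i)) (u (r j)) \<le> 1 / 8 * max (s (r i)) (s (r j))"
    and D: "0 < D" "\<And>n. D / 2 \<le> du (r n)"
    and small: "\<And>n. s (r n) \<le> D / 4" "\<And>n. s (r n) * (24 * C) \<le> c * D"
    and sparse: "\<And>i j. i < j \<Longrightarrow> s (r j) \<le> s (r i) / 16"
  shows "has_humps \<gamma>"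
proof (rule has_humps_subsequence[OF r], rule has_humps_bumps)
  let ?rad = "\<lambda>n. s (r n) / 4"
  have dv: "D / 4 \<le> dv (r n)" for n
    using dist_triangle[of "u (r n)" basepoint "v (r n)"] D(2)[of n] small(1)[of n] by linarith
  show "?rad n \<le> dist (v (r n)) basepoint" for n
    using dv[of n] small(1)[of n] zero_le_dist[of "u (r n)" "v (r n)"] by linarith
  show "?rad i + ?rad j \<le> dist (v (r i)) (v (r j))" if "i < j" for i j
  proof -
    have "s (r i) \<le> dist (u (r i)) (u (r j)) + s (r j) + dist (v (r i)) (v (r j))"
      using dist_triangle[of "u (r i)" "v (r i)" "u (r j)"] dist_triangle[of "u (r j)" "v (r i)" "v (r j)"]
      by (simp add: dist_commute)
    moreover have "max (s (r i)) (s (r j)) = s (r i)"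
      using sparse[OF that] zero_le_dist[of "u (r i)" "v (r i)"] by (intro max_absorb1) linarith
    ultimately show ?thesis
      using sparse[OF that] close[OF that] zero_le_dist[of "u (r i)" "v (r i)"] by linarith
  qed
  show "0 < c / 8" using c by simp
  fix n h assume h: "lip0_apply h = bump (v (r n)) (?rad n)" "norm h \<le> 1"
  define k where "k = r n"
  have hk: "lip_pairing h (\<gamma> k) = b k * complex_of_real (s k / 4)"
    by (simp add: pairing h(1) bump_def k_def)
  have pair: "norm (lip_pairing h (\<gamma> k)) = norm (b k) * s k / 4"
    unfolding hk by (simp add: norm_mult)
  have "norm (a k + b k) * (D / 4) \<le> norm (a k + b k) * dv k"
    using dv[of n] by (intro mult_left_mono) (simp_all add: k_def)
  also have "\<dots> \<le> 3 * C" using norm_sum_dv_le[of k] norm_a_s_le[of k] by simp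
  finally have "norm (a k + b k) \<le> 12 * C / D" using D(1) by (simp add: field_simps)
  then have "norm (a k + b k) * s k \<le> 12 * C / D * s k" by (rule mult_right_mono) simp
  also have "\<dots> \<le> c / 2" using small(2)[of n] D(1) by (simp add: k_def field_simps)
  finally have "norm (a k + b k) * s k \<le> c / 2" .
  moreover have "norm (a k) * s k \<le> (norm (a k + b k) + norm (b k)) * s k"
    using norm_triangle_ineq4[of "a k + b k" "b k"] by (intro mult_right_mono) auto
  ultimately have "c / 2 \<le> norm (b k) * s k"
    using c(2)[of n] by (simp add: k_def distrib_right)
  with pair show "c / 8 \<le> norm (lip_pairing h (\<gamma> (r n)))" by (simp add: k_def)
qed

text \<open>With s bounded below the coefficients a are bounded too, and the points u crowd; along a
  subsequence the vectors a \<delta>(u) vary by at most e/2. The separation must then come from the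
  vectors b \<delta>(v), to which the single-evaluation case applies.\<close>

lemma humps_converging:
  fixes r :: "nat \<Rightarrow> nat"
  assumes r: "strict_mono r"
    and \<rho>: "0 < \<rho>" "16 * C * \<rho> \<le> e"
    and close: "\<And>i j. i < j \<Longrightarrow> dist (u (r i)) (u (r j)) \<le> \<rho> * max (s (r i)) (s (r j))"
    and D: "0 < D" "\<And>n. du (r n) \<le> 2 * D"
    and \<eta>: "0 < \<eta>" "\<And>n. \<eta> \<le> s (r n)"
  shows "has_humps \<gamma>"
proof -
  have s_bdd: "s (r n) \<le> 4 * D" for n using s_le[of "r n"] D(2)[of n] by linarith
  have a_bdd: "norm (a (r n)) \<le> 2 * C / \<eta>" for n
  proof -
    have "norm (a (r n)) * \<eta> \<le> norm (a (r n)) * s (r n)" using \<eta> by (intro mult_left_mono) auto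
    also have "\<dots> \<le> 2 * C" by (rule norm_a_s_le)
    finally show ?thesis using \<eta>(1) by (simp add: field_simps)
  qed
  \<comment> \<open>Values of s that differ by less than their lower bound \<eta> agree up to a
    factor 2.\<close>
  obtain t1 :: "nat \<Rightarrow> nat" where t1: "strict_mono t1"
      "\<And>i j. norm (complex_of_real (s (r (t1 i))) - complex_of_real (s (r (t1 j)))) < \<eta>"
    by (rule bounded_close_subsequence[of "\<lambda>n. complex_of_real (s (r n))" "4 * D" \<eta>])
      (use s_bdd \<eta> in auto)
  obtain t2 :: "nat \<Rightarrow> nat" where t2: "strict_mono t2"
      "\<And>i j. norm (a (r (t1 (t2 i))) - a (r (t1 (t2 j)))) < e / (8 * D)"
    by (rule bounded_close_subsequence[of "\<lambda>n. a (r (t1 n))" "2 * C / \<eta>" "e / (8 * D)"])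
      (use a_bdd D e_pos in auto)
  define q where "q n = r (t1 (t2 n))" for n
  have mono: "strict_mono q" using r t1(1) t2(1) by (simp add: q_def strict_mono_def)
  have q_close: "dist (u (q i)) (u (q j)) \<le> \<rho> * max (s (q i)) (s (q j))" if "i < j" for i j
    unfolding q_def using t1(1) t2(1) that by (intro close) (simp add: strict_mono_def)
  have ratio: "s (q j) \<le> 2 * s (q i)" for i j
    using t1(2)[of "t2 j" "t2 i"] \<eta>(2)[of "t1 (t2 i)"]
    by (simp add: q_def flip: of_real_diff)
  have sep_lt: "e / 2 \<le> norm (b (q i) *\<^sub>C lip_delta (v (q i)) - b (q j) *\<^sub>C lip_delta (v (q j)))"
    if "i < j" for i j
  proof -
    let ?A = "a (q i) *\<^sub>C lip_delta (u (q i)) - a (q j) *\<^sub>C lip_delta (u (q j))"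
    let ?B = "b (q i) *\<^sub>C lip_delta (v (q i)) - b (q j) *\<^sub>C lip_delta (v (q j))"
    have "q i \<noteq> q j" using mono that by (metis strict_mono_eq less_irrefl)
    then have "e \<le> norm (?A + ?B)" using sep by (simp add: algebra_simps)
    also have "\<dots> \<le> norm ?A + norm ?B" by (rule norm_triangle_ineq)
    also have "norm ?A \<le> norm (a (q i)) * dist (u (q i)) (u (q j)) + norm (a (q i) - a (q j)) * du (q j)"
      by (rule norm_scaled_delta_diff_le)
    also have "norm (a (q i)) * dist (u (q i)) (u (q j)) \<le> norm (a (q i)) * (\<rho> * (2 * s (q i)))"
    proof (rule mult_left_mono)
      have "\<rho> * max (s (q i)) (s (q j)) \<le> \<rho> * (2 * s (q i))"
        using \<rho> ratio[of i i] ratio[of j i] by (intro mult_left_mono) auto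
      with q_close[OF that] show "dist (u (q i)) (u (q j)) \<le> \<rho> * (2 * s (q i))" by linarith
    qed simp
    also have "norm (a (q i)) * (\<rho> * (2 * s (q i))) = 2 * \<rho> * (norm (a (q i)) * s (q i))" by simp
    also have "\<dots> \<le> 2 * \<rho> * (2 * C)" using \<rho> by (intro mult_left_mono norm_a_s_le) auto
    also have "\<dots> \<le> e / 4" using \<rho>(2) by (simp add: algebra_simps)
    also have "norm (a (q i) - a (q j)) * du (q j) \<le> e / (8 * D) * (2 * D)"
      using t2(2)[of i j] D e_pos by (intro mult_mono) (auto simp: q_def)
    also have "\<dots> = e / 4" using D by simp
    finally show ?thesis by simp
  qed
  have sep': "e / 2 \<le> norm (b (q i) *\<^sub>C lip_delta (v (q i)) - b (q j) *\<^sub>C lip_delta (v (q j)))"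
    if "i \<noteq> j" for i j
    using sep_lt[of i j] sep_lt[of j i] that
    by (cases i j rule: linorder_cases) (auto simp: norm_minus_commute)
  define C' where "C' = C + 2 * C / \<eta> * (2 * D)"
  have C': "0 < C'" using C_pos \<eta> D by (simp add: C'_def add_pos_nonneg)
  have bdd': "norm (b (q n)) * dist (v (q n)) basepoint \<le> C'" for n
  proof -
    have "norm (b (q n)) * dv (q n) = norm (\<gamma> (q n) - a (q n) *\<^sub>C lip_delta (u (q n)))"
      by (simp add: \<gamma>_def norm_scaled_delta)
    also have "\<dots> \<le> norm (\<gamma> (q n)) + norm (a (q n)) * du (q n)"
      unfolding norm_scaled_delta[symmetric] by (rule norm_triangle_ineq4)
    also have "\<dots> \<le> C + 2 * C / \<eta> * (2 * D)"
    proof (rule add_mono)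
      show "norm (\<gamma> (q n)) \<le> C" unfolding \<gamma>_def by (rule bdd)
      show "norm (a (q n)) * du (q n) \<le> 2 * C / \<eta> * (2 * D)"
        unfolding q_def using a_bdd D C_pos \<eta> by (intro mult_mono) auto
    qed
    finally show ?thesis by (simp add: C'_def)
  qed
  define \<rho>' where "\<rho>' = min (1 / 4) (e / 2 / (16 * C'))"
  obtain t :: "nat \<Rightarrow> nat" where t: "strict_mono t"
      "\<And>n. e / 2 / 2 \<le> norm (b (q (t n))) * dist (v (q (t n))) basepoint"
      "\<And>i j. i < j \<Longrightarrow> \<rho>' * (dist (v (q (t i))) basepoint + dist (v (q (t j))) basepoint)
        \<le> dist (v (q (t i))) (v (q (t j)))"
    by (rule separated_deltas[OF bdd' sep' C' _ \<rho>'_def]) (use e_pos in auto)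
  \<comment> \<open>The base distance of v is at most 2 D, so the second entry keeps the radius
    below \<eta>, hence below s, and u outside the bump.\<close>
  define \<sigma> where "\<sigma> = min \<rho>' (\<eta> / (2 * D))"
  have "\<sigma> \<le> \<eta> / (2 * D)" "\<rho>' \<le> 1 / 4" "\<sigma> \<le> \<rho>'"
    unfolding \<sigma>_def \<rho>'_def by (rule min.cobounded1 min.cobounded2)+
  moreover have "0 < \<sigma>" using e_pos C' \<eta> D by (simp add: \<sigma>_def \<rho>'_def)
  ultimately have \<sigma>: "0 < \<sigma>" "\<sigma> \<le> \<rho>'" "\<sigma> \<le> 1" "\<sigma> * (2 * D) \<le> \<eta>"
    using D by (auto simp: field_simps)
  show ?thesis
  proof (rule has_humps_subsequence[OF mono], rule has_humps_subsequence[OF t(1)], rule has_humps_bumps)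
    show "\<sigma> * dv (q (t n)) \<le> dist (v (q (t n))) basepoint" for n
      using \<sigma> by (intro mult_left_le_one_le) auto
    show "\<sigma> * dv (q (t i)) + \<sigma> * dv (q (t j)) \<le> dist (v (q (t i))) (v (q (t j)))" if "i < j" for i j
    proof -
      have "\<sigma> * (dv (q (t i)) + dv (q (t j))) \<le> \<rho>' * (dv (q (t i)) + dv (q (t j)))"
        using \<sigma> by (intro mult_right_mono) auto
      with t(3)[OF that] show ?thesis by (simp add: distrib_left)
    qed
    show "0 < \<sigma> * (e / 4)" using \<sigma> e_pos by simp
    fix n h assume h: "lip0_apply h = bump (v (q (t n))) (\<sigma> * dv (q (t n)))" "norm h \<le> 1"
    define k where "k = q (t n)"
    have "\<sigma> * dv k \<le> \<sigma> * (2 * D)"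
      using \<sigma>(1) ordered[of k] D(2)[of "t1 (t2 (t n))"] by (intro mult_left_mono) (auto simp: k_def q_def)
    then have "\<sigma> * dv k \<le> s k" using \<sigma>(4) \<eta>(2)[of "t1 (t2 (t n))"] by (simp add: k_def q_def)
    then have hk: "lip_pairing h (\<gamma> k) = b k * complex_of_real (\<sigma> * dv k)"
      using \<sigma>(1) by (simp add: pairing h(1) bump_def flip: k_def)
    have "norm (lip_pairing h (\<gamma> k)) = \<sigma> * (norm (b k) * dv k)"
      unfolding hk using \<sigma>(1) by (simp add: norm_mult)
    also have "\<dots> \<ge> \<sigma> * (e / 4)"
      using \<sigma>(1) t(2)[of n] by (intro mult_left_mono) (simp_all add: k_def)
    finally show "\<sigma> * (e / 4) \<le> norm (lip_pairing h (\<gamma> (q (t n))))" by (simp add: k_def)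
  qed
qed

text \<open>Ramsey's theorem decides, in this order, whether the dipole weight is small, whether the
  points u are spread out at the scale of s, and whether s decays geometrically.\<close>

lemma humps: "has_humps \<gamma>"
proof -
  define c where "c = e / 8 * min (1 / 4) (e / (64 * C))"
  have c: "0 < c" using e_pos C_pos by (simp add: c_def)
  obtain r0 :: "nat \<Rightarrow> nat" where r0: "strict_mono r0"
      "(\<forall>n. norm (a (r0 n)) * s (r0 n) < c) \<or> (\<forall>n. \<not> norm (a (r0 n)) * s (r0 n) < c)"
    by (rule dichotomy_subsequence[of "\<lambda>n. norm (a n) * s n < c"])
  from r0(2) show ?thesis
  proof
    assume "\<forall>n. norm (a (r0 n)) * s (r0 n) < c"
    then show ?thesis by (intro humps_merging[OF r0(1)]) (simp add: c_def)
  next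
    assume "\<forall>n. \<not> norm (a (r0 n)) * s (r0 n) < c"
    then have c_le: "c \<le> norm (a (r0 n)) * s (r0 n)" for n by (simp add: not_less)
    \<comment> \<open>The entry 1/8 serves the comparison of base distances and the sparse case; the
      bound 16 C \<rho> \<le> e serves the converging case.\<close>
    define \<rho> where "\<rho> = min (1 / 8) (e / (16 * C))"
    have \<rho>: "0 < \<rho>" "\<rho> \<le> 1 / 8" "16 * C * \<rho> \<le> e"
      using e_pos C_pos by (auto simp: \<rho>_def min_def field_simps)
    let ?far = "\<lambda>i j. \<rho> * max (s (r0 i)) (s (r0 j)) \<le> dist (u (r0 i)) (u (r0 j))"
    obtain r1 :: "nat \<Rightarrow> nat" where r1: "strict_mono r1"
        "(\<forall>i j. i < j \<longrightarrow> ?far (r1 i) (r1 j)) \<or> (\<forall>i j. i < j \<longrightarrow> \<not> ?far (r1 i) (r1 j))"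
      by (rule Ramsey_subsequence[of ?far])
    define r where "r n = r0 (r1 n)" for n
    have r: "strict_mono r" using r0(1) r1(1) by (simp add: r_def strict_mono_def)
    have c_r: "c \<le> norm (a (r n)) * s (r n)" for n unfolding r_def by (rule c_le)
    from r1(2) show ?thesis
    proof
      assume "\<forall>i j. i < j \<longrightarrow> ?far (r1 i) (r1 j)"
      then show ?thesis
        using \<rho> by (intro humps_far[OF r c c_r, of \<rho>]) (auto simp: r_def)
    next
      assume "\<forall>i j. i < j \<longrightarrow> \<not> ?far (r1 i) (r1 j)"
      then have close: "dist (u (r i)) (u (r j)) < \<rho> * max (s (r i)) (s (r j))" if "i < j" for i j
        using that unfolding r_def by (simp add: not_le)
      define D where "D = du (r 0)"
      have "s (r 0) \<noteq> 0" using c c_r[of 0] by auto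
      then have D: "0 < D"
        using s_le[of "r 0"] zero_le_dist[of "u (r 0)" "v (r 0)"] unfolding D_def by linarith
      have range: "D / 2 \<le> du (r n) \<and> du (r n) \<le> 2 * D" for n
      proof (cases "n = 0")
        case False
        have "max (s (r 0)) (s (r n)) \<le> 2 * max D (du (r n))"
          using s_le[of "r 0"] s_le[of "r n"] unfolding D_def by (simp add: max_def)
        then have "\<rho> * max (s (r 0)) (s (r n)) \<le> 1 / 8 * (2 * max D (du (r n)))"
          using \<rho> by (intro mult_mono) (auto simp: le_max_iff_disj)
        then have "dist (u (r 0)) (u (r n)) \<le> 1 / 4 * max D (du (r n))"
          using close[of 0 n] False by simp
        moreover have "D \<le> dist (u (r 0)) (u (r n)) + du (r n)" "du (r n) \<le> dist (u (r 0)) (u (r n)) + D"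
          unfolding D_def by (metis dist_triangle dist_commute)+
        ultimately show ?thesis using D by (auto simp: max_def split: if_splits)
      qed (use D in \<open>simp add: D_def\<close>)
      \<comment> \<open>The sparse case needs the ratio 1/16 and s (24 C) \<le> c D; since s \<le> 4
        l D there, the latter amounts to 96 C l \<le> c.\<close>
      define l where "l = min (1 / 16) (c / (96 * C))"
      have l: "0 < l" "l \<le> 1 / 16" "96 * C * l \<le> c"
        using c C_pos by (auto simp: l_def min_def field_simps)
      obtain t0 :: "nat \<Rightarrow> nat" where t0: "strict_mono t0"
          "(\<forall>i j. i < j \<longrightarrow> s (r (t0 j)) \<le> l * s (r (t0 i))) \<or> (\<forall>i j. i < j \<longrightarrow> \<not> s (r (t0 j)) \<le> l * s (r (t0 i)))"
        by (rule Ramsey_subsequence[of "\<lambda>i j. s (r j) \<le> l * s (r i)"])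
      \<comment> \<open>Index 0 is kept out of the sequence as a reference: each alternative
        compares all s (q n) with its value, which yields smallness in one case and a positive lower
        bound in the other.\<close>
      define q where "q n = r (t0 (Suc n))" for n
      have q: "strict_mono q" using r t0(1) by (simp add: q_def strict_mono_def)
      have q_close: "dist (u (q i)) (u (q j)) \<le> \<rho> * max (s (q i)) (s (q j))" if "i < j" for i j
        unfolding q_def using t0(1) that by (intro less_imp_le close) (simp add: strict_mono_def)
      have c_q: "c \<le> norm (a (q n)) * s (q n)" for n unfolding q_def by (rule c_r)
      have range_q: "D / 2 \<le> du (q n) \<and> du (q n) \<le> 2 * D" for n unfolding q_def by (rule range)
      have s0: "0 < s (r (t0 0))" "s (r (t0 0)) \<le> 4 * D"
        using c c_r[of "t0 0"] s_le[of "r (t0 0)"] range[of "t0 0"] by (auto simp: zero_less_dist_iff)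
      from t0(2) show ?thesis
      proof
        assume sparse: "\<forall>i j. i < j \<longrightarrow> s (r (t0 j)) \<le> l * s (r (t0 i))"
        have le: "s (q n) \<le> l * (4 * D)" for n
        proof -
          have "s (q n) \<le> l * s (r (t0 0))" using sparse by (simp add: q_def)
          also have "\<dots> \<le> l * (4 * D)" using l s0 by (intro mult_left_mono) auto
          finally show ?thesis .
        qed
        show ?thesis
        proof (rule humps_sparse[OF q c c_q _ D])
          show "dist (u (q i)) (u (q j)) \<le> 1 / 8 * max (s (q i)) (s (q j))" if "i < j" for i j
            using \<rho> by (intro order_trans[OF q_close[OF that]] mult_right_mono) (auto simp: le_max_iff_disj)
          show "D / 2 \<le> du (q n)" for n using range_q by blast
          show "s (q n) \<le> D / 4" for n
            using le[of n] mult_right_mono[OF l(2), of "4 * D"] D by linarith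
          show "s (q n) * (24 * C) \<le> c * D" for n
          proof -
            have "s (q n) * (24 * C) \<le> l * (4 * D) * (24 * C)"
              using le[of n] C_pos by (intro mult_right_mono) auto
            also have "\<dots> = (96 * C * l) * D" by simp
            also have "\<dots> \<le> c * D" using l(3) D by (intro mult_right_mono) auto
            finally show ?thesis .
          qed
          fix i j :: nat assume "i < j"
          then have "s (q j) \<le> l * s (q i)" using sparse by (simp add: q_def)
          also have "\<dots> \<le> 1 / 16 * s (q i)" using l(2) by (rule mult_right_mono) simp
          finally show "s (q j) \<le> s (q i) / 16" by simp
        qed
      next
        assume "\<forall>i j. i < j \<longrightarrow> \<not> s (r (t0 j)) \<le> l * s (r (t0 i))"
        then have "l * s (r (t0 0)) \<le> s (q n)" for n by (simp add: q_def not_le less_imp_le)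
        then show ?thesis
          using \<rho> l s0 q_close D range_q by (intro humps_converging[OF q, of \<rho> D "l * s (r (t0 0))"]) auto
      qed
    qed
  qed
qed

end

text \<open>The roles of u and v are symmetric, so after passing to a subsequence the nearer point
  may be called v.\<close>

lemma humps_of_two_deltas:
  fixes u v :: "nat \<Rightarrow> 'n::pointed_metric_space" and a b :: "nat \<Rightarrow> complex"
  assumes \<gamma>: "\<And>n. \<gamma> n = a n *\<^sub>C lip_delta (u n) + b n *\<^sub>C lip_delta (v n)"
    and bdd: "\<And>n. norm (\<gamma> n) \<le> C" and sep: "\<And>i j. i \<noteq> j \<Longrightarrow> e \<le> norm (\<gamma> i - \<gamma> j)"
    and "0 < C" "0 < e"
  shows "has_humps \<gamma>"
proof -
  obtain r :: "nat \<Rightarrow> nat" where r: "strict_mono r"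
      "(\<forall>n. dist (v (r n)) basepoint \<le> dist (u (r n)) basepoint) \<or>
       (\<forall>n. \<not> dist (v (r n)) basepoint \<le> dist (u (r n)) basepoint)"
    by (rule dichotomy_subsequence[of "\<lambda>n. dist (v n) basepoint \<le> dist (u n) basepoint"])
  have ri: "r i \<noteq> r j" if "i \<noteq> j" for i j using r that by (metis strict_mono_eq)
  from r(2) show ?thesis
  proof
    assume le: "\<forall>n. dist (v (r n)) basepoint \<le> dist (u (r n)) basepoint"
    interpret two_deltas "\<lambda>n. u (r n)" "\<lambda>n. v (r n)" "\<lambda>n. a (r n)" "\<lambda>n. b (r n)" C e
      using bdd sep[OF ri] le assms(4,5) by unfold_locales (simp_all add: \<gamma>)
    have "has_humps (\<lambda>n. \<gamma> (r n))" using humps by (simp add: \<gamma> \<gamma>_def[abs_def])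
    then show ?thesis by (rule has_humps_subsequence[OF r(1)])
  next
    assume le: "\<forall>n. \<not> dist (v (r n)) basepoint \<le> dist (u (r n)) basepoint"
    have le': "dist (u (r n)) basepoint \<le> dist (v (r n)) basepoint" for n by (meson le nle_le)
    interpret two_deltas "\<lambda>n. v (r n)" "\<lambda>n. u (r n)" "\<lambda>n. b (r n)" "\<lambda>n. a (r n)" C e
      using bdd sep[OF ri] le' assms(4,5) by unfold_locales (simp_all add: \<gamma> add.commute)
    have "has_humps (\<lambda>n. \<gamma> (r n))" using humps by (simp add: \<gamma> \<gamma>_def[abs_def] add.commute)
    then show ?thesis by (rule has_humps_subsequence[OF r(1)])
  qed
qed

section \<open>Non-compact operators\<close>

text \<open>Two points meet the supports of at most two of the functions, whence the constant 2.\<close>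

lemma sum_norm_lip_pairing_le:
  fixes g :: "nat \<Rightarrow> 'n::pointed_metric_space lip0"
  assumes le: "\<And>n. norm (g n) \<le> 1"
    and disj: "\<And>p n m. lip0_apply (g n) p \<noteq> 0 \<Longrightarrow> lip0_apply (g m) p \<noteq> 0 \<Longrightarrow> n = m"
  shows "(\<Sum>k<n. norm (lip_pairing (g k) y)) \<le> 2 * norm y"
proof -
  \<comment> \<open>These phases turn the sum of absolute values into one pairing with \<Sum>
    \<theta>_k g_k, a function with Lipschitz constant 2.\<close>
  define \<theta> where "\<theta> k = cnj (sgn (lip_pairing (g k) y))" for k
  have \<theta>: "norm (\<theta> k) \<le> 1" for k by (simp add: \<theta>_def norm_sgn)
  have \<theta>y: "\<theta> k * lip_pairing (g k) y = complex_of_real (norm (lip_pairing (g k) y))" for k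
  proof (cases "lip_pairing (g k) y = 0")
    case False
    then show ?thesis
      by (simp add: \<theta>_def complex_sgn_def scaleR_conv_of_real mult.assoc complex_norm_square[symmetric]
          mult.commute[of "cnj _"] power2_eq_square)
  qed simp
  have lip: "(\<Sum>k<n. norm (lip0_apply (g k) p - lip0_apply (g k) q)) \<le> 2 * dist p q" for p q
  proof -
    define S where "S x = {k. k < n \<and> lip0_apply (g k) x \<noteq> 0}" for x
    have S: "finite (S x)" "card (S x) \<le> 1" for x
      using disj by (auto simp: S_def card_le_Suc0_iff_eq)
    have "(\<Sum>k<n. norm (lip0_apply (g k) p - lip0_apply (g k) q))
        = (\<Sum>k\<in>S p \<union> S q. norm (lip0_apply (g k) p - lip0_apply (g k) q))"
      by (rule sum.mono_neutral_right) (auto simp: S_def)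
    also have "\<dots> \<le> of_nat (card (S p \<union> S q)) * dist p q"
    proof (rule sum_bounded_above)
      fix k
      have "norm (lip0_apply (g k) p - lip0_apply (g k) q) \<le> norm (g k) * dist p q"
        by (rule norm_lip0_apply_diff_le)
      also have "\<dots> \<le> dist p q" using le by (intro mult_left_le_one_le) auto
      finally show "norm (lip0_apply (g k) p - lip0_apply (g k) q) \<le> dist p q" .
    qed
    also have "\<dots> \<le> 2 * dist p q"
      using card_Un_le[of "S p" "S q"] S(2)[of p] S(2)[of q] by (intro mult_right_mono) auto
    finally show ?thesis .
  qed
  let ?G = "\<lambda>u. \<Sum>k<n. \<theta> k * lip_pairing (g k) u"
  have G: "bounded_clinear ?G"
  proof -
    have "bounded_linear ?G"
      by (intro bounded_linear_sum bounded_linear_const_mult bounded_clinearD(1)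
          bounded_clinear_lip_pairing)
    then show ?thesis
      by (simp add: bounded_clinear_def bounded_clinearD[OF bounded_clinear_lip_pairing]
          scaleC_complex_def sum_distrib_left mult.left_commute)
  qed
  have "2-lipschitz_on UNIV (\<lambda>x. ?G (lip_delta x))"
    unfolding lipschitz_on_def
  proof (intro conjI ballI)
    fix p q
    have "norm (?G (lip_delta p) - ?G (lip_delta q))
        = norm (\<Sum>k<n. \<theta> k * (lip0_apply (g k) p - lip0_apply (g k) q))"
      by (simp add: lip_pairing_delta right_diff_distrib sum_subtractf)
    also have "\<dots> \<le> (\<Sum>k<n. norm (lip0_apply (g k) p - lip0_apply (g k) q))"
      using \<theta> by (intro sum_norm_le) (simp add: norm_mult mult_left_le_one_le)
    also have "\<dots> \<le> 2 * dist p q" by (rule lip)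
    finally show "dist (?G (lip_delta p)) (?G (lip_delta q)) \<le> 2 * dist p q" by (simp add: dist_norm)
  qed simp
  moreover have "?G (lip_delta basepoint) = 0"
    by (simp add: lip_delta_basepoint bounded_clinearD(2)[OF bounded_clinear_lip_pairing])
  ultimately obtain h where h: "lip0_apply h = (\<lambda>x. ?G (lip_delta x))" "norm h \<le> 2"
    by (rule lip0_of_lipschitz_on)
  have "?G y = lip_pairing h y"
    by (rule bounded_clinear_eq_on_lip_delta[OF G bounded_clinear_lip_pairing])
      (simp add: lip_pairing_delta h(1))
  then have h_y: "lip_pairing h y = complex_of_real (\<Sum>k<n. norm (lip_pairing (g k) y))"
    by (simp add: \<theta>y)
  have "(\<Sum>k<n. norm (lip_pairing (g k) y)) = norm (lip_pairing h y)"
    unfolding h_y norm_of_real by (simp add: sum_nonneg)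
  also have "\<dots> \<le> norm h * norm y" by (rule norm_lip_pairing_le)
  also have "\<dots> \<le> 2 * norm y" using h(2) by (rule mult_right_mono) simp
  finally show ?thesis .
qed

text \<open>The supports being disjoint, each \<open>\<gamma> j\<close> is annihilated by all but at most two of the functions,
  so that the off-diagonal entries vanish along a subsequence.\<close>

lemma biorthogonal_subsequence:
  fixes g :: "nat \<Rightarrow> 'n::pointed_metric_space lip0"
  assumes disj: "\<And>p n m. lip0_apply (g n) p \<noteq> 0 \<Longrightarrow> lip0_apply (g m) p \<noteq> 0 \<Longrightarrow> n = m"
    and \<gamma>: "\<And>n. \<gamma> n = a n *\<^sub>C lip_delta (u n) + b n *\<^sub>C lip_delta (v n)"
    and diag: "\<And>n. lip_pairing (g n) (\<gamma> n) \<noteq> 0"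
  obtains s :: "nat \<Rightarrow> nat" where "strict_mono s" "\<And>i j. i \<noteq> j \<Longrightarrow> lip_pairing (g (s i)) (\<gamma> (s j)) = 0"
proof -
  let ?A = "\<lambda>i j. lip_pairing (g i) (\<gamma> j) \<noteq> 0"
  have pt: "lip0_apply (g i) (u j) \<noteq> 0 \<or> lip0_apply (g i) (v j) \<noteq> 0" if "?A i j" for i j
    using that by (auto simp: \<gamma> bounded_clinearD[OF bounded_clinear_lip_pairing] lip_pairing_delta
        scaleC_complex_def)
  \<comment> \<open>The functions with indices i, i' and j are each nonzero at u_j or v_j; among
    three functions two share a point and therefore coincide.\<close>
  have three: "i = i' \<or> i = j \<or> i' = j" if "?A i j" "?A i' j" for i i' j
    using pt[OF that(1)] pt[OF that(2)] pt[OF diag[of j]] disj by metis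
  obtain r :: "nat \<Rightarrow> nat" where r: "strict_mono r"
      "(\<forall>i j. i < j \<longrightarrow> ?A (r i) (r j)) \<or> (\<forall>i j. i < j \<longrightarrow> \<not> ?A (r i) (r j))"
    by (rule Ramsey_subsequence[of ?A])
  have neq_r: "r i \<noteq> r j" if "i \<noteq> j" for i j using r(1) that by (metis strict_mono_eq)
  have upper: "\<not> ?A (r i) (r j)" if "i < j" for i j
  proof
    assume "?A (r i) (r j)"
    with r(2) that have all: "\<And>i j. i < j \<Longrightarrow> ?A (r i) (r j)" by blast
    show False
      \<comment> \<open>Column 2 would have the nonzero entries 0, 1 and 2; below the diagonal,
        column 0 plays the same part.\<close>
      using three[OF all[of 0 2] all[of 1 2]] neq_r[of 0 1] neq_r[of 0 2] neq_r[of 1 2] by simp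
  qed
  obtain t :: "nat \<Rightarrow> nat" where t: "strict_mono t"
      "(\<forall>i j. i < j \<longrightarrow> ?A (r (t j)) (r (t i))) \<or> (\<forall>i j. i < j \<longrightarrow> \<not> ?A (r (t j)) (r (t i)))"
    by (rule Ramsey_subsequence[of "\<lambda>i j. ?A (r j) (r i)"])
  have neq_t: "r (t i) \<noteq> r (t j)" if "i \<noteq> j" for i j using t(1) neq_r that by (metis strict_mono_eq)
  have lower: "\<not> ?A (r (t j)) (r (t i))" if "i < j" for i j
  proof
    assume "?A (r (t j)) (r (t i))"
    with t(2) that have all: "\<And>i j. i < j \<Longrightarrow> ?A (r (t j)) (r (t i))" by blast
    show False
      using three[OF all[of 0 1] all[of 0 2]] neq_t[of 1 2] neq_t[of 1 0] neq_t[of 2 0] by simp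
  qed
  show thesis
  proof (rule that)
    show "strict_mono (\<lambda>n. r (t n))" using r(1) t(1) by (simp add: strict_mono_def)
    show "lip_pairing (g (r (t i))) (\<gamma> (r (t j))) = 0" if "i \<noteq> j" for i j
      using that upper[of "t i" "t j"] lower[of j i] t(1)
      by (cases i j rule: linorder_cases) (auto simp: strict_mono_def)
  qed
qed

lemma not_compact_imp_l1_biorthogonal:
  fixes f :: "'m::pointed_metric_space \<Rightarrow> 'n::pointed_metric_space"
    and T :: "'m lipschitz_free \<Rightarrow> 'n lipschitz_free"
  assumes T: "bounded_clinear T"
    and T_delta: "\<And>x. T (lip_delta x) = \<omega> x *\<^sub>C lip_delta (f x)"
    and "\<not> compact_operator T"
  obtains x \<phi> C D where "l1_biorthogonal T x \<phi> C D"
proof -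
  have "\<not> (\<forall>e>0. \<exists>k. finite k \<and> (\<lambda>(p, q). T (molecule p q)) ` {(p, q). p \<noteq> q} \<subseteq> (\<Union>x\<in>k. ball x e))"
    using compact_operator_if_molecules_totally_bounded[OF T] assms(3) by blast
  then obtain e and y :: "nat \<Rightarrow> 'n lipschitz_free" where e: "0 < e"
      and y: "\<And>n. y n \<in> (\<lambda>(p, q). T (molecule p q)) ` {(p, q). p \<noteq> q}"
      and sep: "\<And>i j. i \<noteq> j \<Longrightarrow> e \<le> dist (y i) (y j)"
    by (rule separated_sequence) blast
  have "\<exists>p q. y n = T (molecule p q)" for n using y[of n] by auto
  then obtain p q where pq: "\<And>n. y n = T (molecule (p n) (q n))" by metis
  define d where "d n = complex_of_real (inverse (dist (p n) (q n)))" for n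
  have y_eq: "y n = (d n * \<omega> (p n)) *\<^sub>C lip_delta (f (p n)) + (- (d n * \<omega> (q n))) *\<^sub>C lip_delta (f (q n))" for n
    by (simp add: pq molecule_def scaleR_scaleC bounded_clinearD[OF T] T_delta scaleC_scaleC d_def
        complex_vector.scale_right_diff_distrib)
  obtain L where L: "0 < L" "\<And>u. norm (T u) \<le> norm u * L"
    using bounded_linear.pos_bounded[OF bounded_clinearD(1)[OF T]] by blast
  have "norm (y n) \<le> L" for n
    using order_trans[OF L(2) mult_right_mono[OF norm_molecule_le, of L]] L(1) by (simp add: pq)
  then have "has_humps y"
    using sep L(1) e by (intro humps_of_two_deltas[OF y_eq, where C = L and e = e]) (auto simp: dist_norm)
  then obtain r :: "nat \<Rightarrow> nat" and g c where c: "0 < c" and g: "\<And>n. norm (g n) \<le> 1"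
      and disj: "\<And>p n m. lip0_apply (g n) p \<noteq> 0 \<Longrightarrow> lip0_apply (g m) p \<noteq> 0 \<Longrightarrow> n = m"
      and diag: "\<And>n. c \<le> norm (lip_pairing (g n) (y (r n)))"
    unfolding has_humps_def by metis
  have diag0: "lip_pairing (g n) (y (r n)) \<noteq> 0" for n using diag[of n] c by auto
  obtain s :: "nat \<Rightarrow> nat" where s: "strict_mono s"
      "\<And>i j. i \<noteq> j \<Longrightarrow> lip_pairing (g (s i)) (y (r (s j))) = 0"
    by (rule biorthogonal_subsequence[where g = g and \<gamma> = "\<lambda>n. y (r n)", OF disj y_eq diag0]) auto
  define \<phi> where "\<phi> k = lip_pairing (g (s k))" for k
  \<comment> \<open>Dividing by the diagonal entry normalises the pairing to 1; the entries are at
    least c in modulus, whence the bound 1/c for the vectors.\<close>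
  define x where "x k = inverse (\<phi> k (y (r (s k)))) *\<^sub>C molecule (p (r (s k))) (q (r (s k)))" for k
  have disj_s: "n = m" if "lip0_apply (g (s n)) z \<noteq> 0" "lip0_apply (g (s m)) z \<noteq> 0" for z n m
    using disj[OF that] s(1) by (simp add: strict_mono_eq)
  have partial: "(\<Sum>k<n. norm (\<phi> k z)) \<le> 2 * norm z" for n z
    unfolding \<phi>_def by (rule sum_norm_lip_pairing_le[OF g disj_s])
  have "l1_biorthogonal T x \<phi> 2 (inverse c)"
  proof
    show "bounded_clinear T" by fact
    show "bounded_clinear (\<phi> k)" for k unfolding \<phi>_def by (rule bounded_clinear_lip_pairing)
    show "norm (x k) \<le> inverse c" for k
    proof -
      have "norm (x k) = inverse (norm (\<phi> k (y (r (s k))))) * norm (molecule (p (r (s k))) (q (r (s k))))"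
        by (simp add: x_def norm_scaleC norm_inverse)
      also have "\<dots> \<le> inverse c * 1"
        using diag[of "s k"] c by (intro mult_mono norm_molecule_le le_imp_inverse_le) (auto simp: \<phi>_def)
      finally show ?thesis by simp
    qed
    show summ: "summable (\<lambda>k. norm (\<phi> k z))" for z
      by (rule summableI_nonneg_bounded[OF _ partial]) simp
    show "(\<Sum>k. norm (\<phi> k z)) \<le> 2 * norm z" for z
      by (rule suminf_le_const[OF summ partial])
    show "\<phi> k (T (x j)) = (if k = j then 1 else 0)" for k j
    proof -
      have "\<phi> k (T (x j)) = inverse (\<phi> j (y (r (s j)))) * \<phi> k (y (r (s j)))"
        by (simp add: x_def \<phi>_def bounded_clinearD[OF T] bounded_clinearD[OF bounded_clinear_lip_pairing]
            scaleC_complex_def pq)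
      then show ?thesis using diag0[of "s k"] s(2)[of k j] by (auto simp: \<phi>_def)
    qed
  qed
  then show thesis by (rule that)
qed

theorem theorem1p2:
  fixes f :: "'m::pointed_metric_space \<Rightarrow> 'n::pointed_metric_space"
    and \<omega> :: "'m \<Rightarrow> complex"
    and T :: "'m lipschitz_free \<Rightarrow> 'n lipschitz_free"
  assumes "infinite (UNIV :: 'm set)"
    and "infinite (UNIV :: 'n set)"
    and "f basepoint = basepoint \<or> \<omega> basepoint = 0"
    and "bounded_clinear T"
    and "\<And>x. T (lip_delta x) = \<omega> x *\<^sub>C lip_delta (f x)"
  shows "(compact_operator T \<longleftrightarrow> weakly_compact_operator T) \<and>
    (compact_operator T \<longleftrightarrow> super_strictly_singular T) \<and>
    (compact_operator T \<longleftrightarrow> super_strictly_cosingular T) \<and>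
    (compact_operator T \<longleftrightarrow> strictly_singular T) \<and>
    (compact_operator T \<longleftrightarrow> strictly_cosingular T) \<and>
    (compact_operator T \<longleftrightarrow> \<not> fixes_copy_of_ell1 T) \<and>
    (compact_operator T \<longleftrightarrow> \<not> fixes_complemented_copy_of_ell1 T)"
proof -
  note T = \<open>bounded_clinear T\<close>
  have fixes_weaken: "fixes_copy_of_ell1 T" if "fixes_complemented_copy_of_ell1 T"
    using that unfolding fixes_complemented_copy_of_ell1_def fixes_copy_of_ell1_def by blast
  show ?thesis
  proof (cases "compact_operator T")
    case True
    have "weakly_compact_operator T"
    proof (rule compact_imp_weakly_compact[OF True])
      fix u v :: "'n lipschitz_free" assume "u \<noteq> v"
      then obtain g where "lip_pairing g u \<noteq> lip_pairing g v" using lip_pairing_eqI by blast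
      then show "\<exists>\<phi> :: 'n lipschitz_free \<Rightarrow> complex. bounded_clinear \<phi> \<and> \<phi> u \<noteq> \<phi> v"
        using bounded_clinear_lip_pairing by blast
    qed
    moreover note compact_imp_super_strictly_singular[OF T True]
    moreover from this have "strictly_singular T" by (rule super_strictly_singular_imp_strictly_singular)
    moreover note compact_imp_super_strictly_cosingular[OF T True]
      compact_imp_strictly_cosingular[OF T True] compact_imp_not_fixes_copy_of_ell1[OF T True]
    ultimately show ?thesis using True fixes_weaken by blast
  next
    case False
    obtain x \<phi> C D where "l1_biorthogonal T x \<phi> C D"
      by (rule not_compact_imp_l1_biorthogonal[OF T assms(5) False])
    then interpret l1_biorthogonal T x \<phi> C D .
    \<comment> \<open>All eight properties fail together here; super strict singularity fails
      because it would imply strict singularity.\<close>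
    show ?thesis
      using False not_weakly_compact not_strictly_singular not_strictly_cosingular
        not_super_strictly_cosingular fixes_complemented_copy fixes_weaken
        super_strictly_singular_imp_strictly_singular
      by blast
  qed
qed

end
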